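(* Let $\mathcal{I},\mathcal{J}\subseteq R$ be ideals, and let $\mathcal{X}$ and $\mathcal{Y}$ be free resolutions of $R/\mathcal{I}$ and $R/\mathcal{J}$ over $R$, respectively, with $\mathcal{X}_0=\mathcal{Y}_0=R$. If $\mathcal{I}$ and $\mathcal{J}$ are Tor-independent, then the star product $\mathcal{X}*_R\mathcal{Y}$ is a free resolution of $R/\mathcal{I}\mathcal{J}$ over $R$. Moreover, if $\mathcal{X}$ and $\mathcal{Y}$ are minimal, then $\mathcal{X}*_R\mathcal{Y}$ is also minimal.
   Context: $R$ is a commutative noetherian ring that is either local with maximal ideal $\mathfrak{M}_R$ or standard graded with homogeneous maximal ideal $\mathfrak{M}_R$ (in the graded case, minimality refers to graded resolutions of quotients by homogeneous ideals). A complex $\mathcal{C}$ of free $R$-modules is minimal if $\partial^{\mathcal{C}}(\mathcal{C})\subseteq\mathfrak{M}_R\mathcal{C}$. Ideals $\mathcal{I},\mathcal{J}$ are Tor-independent if $\operatorname{Tor}_i^R(R/\mathcal{I},R/\mathcal{J})=0$ for all $i\ge1$. For a complex $\mathcal C$, $\mathcal C_{\ge1}$ is the hard truncation: $(\mathcal C_{\ge1})_q=\mathcal C_q$ for $q\ge1$ and $0$ otherwise, with $\partial_q^{\mathcal C_{\ge1}}=\partial_q^{\mathcal C}$ for $q>1$ and $0$ for $q\le1$. Tensor products carry the differential $\partial(a\otimes b)=\partial(a)\otimes b+(-1)^{|a|}a\otimes\partial(b)$. The star product $\mathcal{X}*_R\mathcal{Y}$ is the complex with $(\mathcal{X}*_R\mathcal{Y})_n=(\mathcal{X}_{\ge1}\otimes_R\mathcal{Y}_{\ge1})_{n+1}$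 for $n\ge1$, $\mathcal{X}_0\otimes_R\mathcal{Y}_0$ for $n=0$, and $0$ for $n<0$; its differential is $\partial_{n+1}^{\mathcal{X}_{\ge1}\otimes\mathcal{Y}_{\ge1}}$ for $n\ge2$, $\partial_1^{\mathcal{X}}\otimes\partial_1^{\mathcal{Y}}$ for $n=1$, and $0$ for $n\le0$. *)

theory Defs
  imports "HOL-Algebra.Algebra"
begin

(* Modules are records of HOL-Algebra's theory Module, characterised by the locale "module".
   Such a record also carries the ring fields mult and one, which the locale ignores; they are
   left undefined below. *)

section \<open>Modules over a commutative ring\<close>

definition linear_maps ::
  "('a, 'r) ring_scheme \<Rightarrow> ('a, 'm) module \<Rightarrow> ('a, 'n) module \<Rightarrow> ('m \<Rightarrow> 'n) set" where
  "linear_maps R M N =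
     {h \<in> hom (add_monoid M) (add_monoid N).
        \<forall>r \<in> carrier R. \<forall>x \<in> carrier M. h (r \<odot>\<^bsub>M\<^esub> x) = r \<odot>\<^bsub>N\<^esub> h x}"

definition linear_isos ::
  "('a, 'r) ring_scheme \<Rightarrow> ('a, 'm) module \<Rightarrow> ('a, 'n) module \<Rightarrow> ('m \<Rightarrow> 'n) set" where
  "linear_isos R M N = {h \<in> linear_maps R M N. bij_betw h (carrier M) (carrier N)}"

definition regular_module :: "('a, 'r) ring_scheme \<Rightarrow> ('a, 'a) module" where
  "regular_module R =
     \<lparr>carrier = carrier R, monoid.mult = undefined, one = undefined,
      ring.zero = \<zero>\<^bsub>R\<^esub>, ring.add = (\<oplus>\<^bsub>R\<^esub>), smult = (\<otimes>\<^bsub>R\<^esub>)\<rparr>"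

definition zero_submodule :: "('a, 'm) module \<Rightarrow> ('a, 'm) module" where
  "zero_submodule M = M\<lparr>carrier := {\<zero>\<^bsub>M\<^esub>}\<rparr>"

definition span_module :: "('a, 'r) ring_scheme \<Rightarrow> ('a, 'm) module \<Rightarrow> 'm set \<Rightarrow> 'm set" where
  "span_module R M S = \<Inter>{N. submodule N R M \<and> S \<subseteq> N}"

definition quot_module :: "('a, 'm) module \<Rightarrow> 'm set \<Rightarrow> ('a, 'm set) module" where
  "quot_module M N =
     \<lparr>carrier = a_rcosets\<^bsub>M\<^esub> N, monoid.mult = undefined, one = undefined,
      ring.zero = N, ring.add = set_add M, smult = (\<lambda>r C. \<Union>c\<in>C. N +>\<^bsub>M\<^esub> (r \<odot>\<^bsub>M\<^esub> c))\<rparr>"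

text \<open>The underlying additive group is that of the quotient ring \<open>R Quot I\<close>.\<close>

definition cyclic_module :: "('a, 'r) ring_scheme \<Rightarrow> 'a set \<Rightarrow> ('a, 'a set) module" where
  "cyclic_module R I = quot_module (regular_module R) I"

definition ideal_smult ::
  "('a, 'r) ring_scheme \<Rightarrow> 'a set \<Rightarrow> ('a, 'm) module \<Rightarrow> 'm set" where
  "ideal_smult R I M = span_module R M {a \<odot>\<^bsub>M\<^esub> x | a x. a \<in> I \<and> x \<in> carrier M}"

definition direct_sum :: "'i set \<Rightarrow> ('i \<Rightarrow> ('a, 'm) module) \<Rightarrow> ('a, 'i \<Rightarrow> 'm) module" where
  "direct_sum A M =
     \<lparr>carrier = {u \<in> (\<Pi>\<^sub>E i\<in>A. carrier (M i)). finite {i \<in> A. u i \<noteq> \<zero>\<^bsub>M i\<^esub>}},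
      monoid.mult = undefined, one = undefined,
      ring.zero = (\<lambda>i\<in>A. \<zero>\<^bsub>M i\<^esub>),
      ring.add = (\<lambda>u v. \<lambda>i\<in>A. u i \<oplus>\<^bsub>M i\<^esub> v i),
      smult = (\<lambda>r u. \<lambda>i\<in>A. r \<odot>\<^bsub>M i\<^esub> u i)\<rparr>"

text \<open>The free module on a set \<open>B\<close>: finitely supported functions, zero outside \<open>B\<close>.\<close>

definition free_module :: "('a, 'r) ring_scheme \<Rightarrow> 'b set \<Rightarrow> ('a, 'b \<Rightarrow> 'a) module" where
  "free_module R B =
     \<lparr>carrier = {f. (\<forall>b. f b \<in> carrier R) \<and> (\<forall>b. b \<notin> B \<longrightarrow> f b = \<zero>\<^bsub>R\<^esub>) \<and> finite {b. f b \<noteq> \<zero>\<^bsub>R\<^esub>}},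
      monoid.mult = undefined, one = undefined,
      ring.zero = (\<lambda>b. \<zero>\<^bsub>R\<^esub>),
      ring.add = (\<lambda>f g b. f b \<oplus>\<^bsub>R\<^esub> g b),
      smult = (\<lambda>r f b. r \<otimes>\<^bsub>R\<^esub> f b)\<rparr>"

definition free_gen :: "('a, 'r) ring_scheme \<Rightarrow> 'b \<Rightarrow> 'b \<Rightarrow> 'a" where
  "free_gen R b = (\<lambda>b'. if b' = b then \<one>\<^bsub>R\<^esub> else \<zero>\<^bsub>R\<^esub>)"

definition is_basis :: "('a, 'r) ring_scheme \<Rightarrow> ('a, 'm) module \<Rightarrow> 'm set \<Rightarrow> bool" where
  "is_basis R M B \<longleftrightarrow> B \<subseteq> carrier M \<and>
     (\<forall>x \<in> carrier M. \<exists>!c. c \<in> carrier (free_module R B) \<and>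
        x = (\<Oplus>\<^bsub>M\<^esub>b\<in>{b. c b \<noteq> \<zero>\<^bsub>R\<^esub>}. c b \<odot>\<^bsub>M\<^esub> b))"

definition is_free :: "('a, 'r) ring_scheme \<Rightarrow> ('a, 'm) module \<Rightarrow> bool" where
  "is_free R M \<longleftrightarrow> module R M \<and> (\<exists>B. is_basis R M B)"


section \<open>Tensor products\<close>

definition tensor_relations ::
  "('a, 'r) ring_scheme \<Rightarrow> ('a, 'm) module \<Rightarrow> ('a, 'n) module \<Rightarrow> ('m \<times> 'n \<Rightarrow> 'a) set" where
  "tensor_relations R M N =
    (let F = free_module R (carrier M \<times> carrier N); \<delta> = (\<lambda>x y. free_gen R (x, y)) in
     span_module R F
      ({\<delta> (x \<oplus>\<^bsub>M\<^esub> x') y \<ominus>\<^bsub>F\<^esub> (\<delta> x y \<oplus>\<^bsub>F\<^esub> \<delta> x' y) | x x' y.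
          x \<in> carrier M \<and> x' \<in> carrier M \<and> y \<in> carrier N} \<union>
       {\<delta> x (y \<oplus>\<^bsub>N\<^esub> y') \<ominus>\<^bsub>F\<^esub> (\<delta> x y \<oplus>\<^bsub>F\<^esub> \<delta> x y') | x y y'.
          x \<in> carrier M \<and> y \<in> carrier N \<and> y' \<in> carrier N} \<union>
       {\<delta> (r \<odot>\<^bsub>M\<^esub> x) y \<ominus>\<^bsub>F\<^esub> r \<odot>\<^bsub>F\<^esub> \<delta> x y | r x y.
          r \<in> carrier R \<and> x \<in> carrier M \<and> y \<in> carrier N} \<union>
       {\<delta> x (r \<odot>\<^bsub>N\<^esub> y) \<ominus>\<^bsub>F\<^esub> r \<odot>\<^bsub>F\<^esub> \<delta> x y | r x y.
          r \<in> carrier R \<and> x \<in> carrier M \<and> y \<in> carrier N}))"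

definition tensor ::
  "('a, 'r) ring_scheme \<Rightarrow> ('a, 'm) module \<Rightarrow> ('a, 'n) module \<Rightarrow> ('a, ('m \<times> 'n \<Rightarrow> 'a) set) module"
  where
  "tensor R M N = quot_module (free_module R (carrier M \<times> carrier N)) (tensor_relations R M N)"

definition pure_tensor ::
  "('a, 'r) ring_scheme \<Rightarrow> ('a, 'm) module \<Rightarrow> ('a, 'n) module \<Rightarrow> 'm \<Rightarrow> 'n \<Rightarrow> ('m \<times> 'n \<Rightarrow> 'a) set"
  where
  "pure_tensor R M N x y =
     tensor_relations R M N +>\<^bsub>free_module R (carrier M \<times> carrier N)\<^esub> free_gen R (x, y)"

text \<open>The induced map \<open>f \<otimes> g\<close>; extensionality makes it unique as a HOL function.\<close>

definition tensor_map ::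
  "('a, 'r) ring_scheme \<Rightarrow> ('a, 'm) module \<Rightarrow> ('a, 'n) module \<Rightarrow> ('a, 'm2) module \<Rightarrow> ('a, 'n2) module
   \<Rightarrow> ('m \<Rightarrow> 'm2) \<Rightarrow> ('n \<Rightarrow> 'n2) \<Rightarrow> ('m \<times> 'n \<Rightarrow> 'a) set \<Rightarrow> ('m2 \<times> 'n2 \<Rightarrow> 'a) set" where
  "tensor_map R M N M' N' f g =
     (THE h. h \<in> linear_maps R (tensor R M N) (tensor R M' N') \<inter> extensional (carrier (tensor R M N)) \<and>
        (\<forall>x \<in> carrier M. \<forall>y \<in> carrier N.
           h (pure_tensor R M N x y) = pure_tensor R M' N' (f x) (g y)))"


section \<open>Complexes, resolutions and Tor\<close>

text \<open>\<open>bd C n\<close> is the differential from degree \<open>n\<close> to degree \<open>n - 1\<close>.\<close>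

record ('a, 'm) cplx =
  component :: "int \<Rightarrow> ('a, 'm) module"
  bd :: "int \<Rightarrow> 'm \<Rightarrow> 'm"

definition is_complex :: "('a, 'r) ring_scheme \<Rightarrow> ('a, 'm) cplx \<Rightarrow> bool" where
  "is_complex R C \<longleftrightarrow>
     (\<forall>n. module R (component C n)) \<and>
     (\<forall>n. bd C n \<in> linear_maps R (component C n) (component C (n - 1))) \<and>
     (\<forall>n. \<forall>x \<in> carrier (component C n). bd C (n - 1) (bd C n x) = \<zero>\<^bsub>component C (n - 2)\<^esub>)"

definition cycles :: "('a, 'm) cplx \<Rightarrow> int \<Rightarrow> 'm set" where
  "cycles C n = {x \<in> carrier (component C n). bd C n x = \<zero>\<^bsub>component C (n - 1)\<^esub>}"

definition boundaries :: "('a, 'm) cplx \<Rightarrow> int \<Rightarrow> 'm set" where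
  "boundaries C n = bd C (n + 1) ` carrier (component C (n + 1))"

definition homology :: "('a, 'm) cplx \<Rightarrow> int \<Rightarrow> ('a, 'm set) module" where
  "homology C n = quot_module (component C n\<lparr>carrier := cycles C n\<rparr>) (boundaries C n)"

definition is_augmentation ::
  "('a, 'r) ring_scheme \<Rightarrow> ('a, 'm) cplx \<Rightarrow> ('a, 'n) module \<Rightarrow> ('m \<Rightarrow> 'n) \<Rightarrow> bool" where
  "is_augmentation R F M \<epsilon> \<longleftrightarrow>
     \<epsilon> \<in> linear_maps R (component F 0) M \<and>
     \<epsilon> ` carrier (component F 0) = carrier M \<and>
     {x \<in> carrier (component F 0). \<epsilon> x = \<zero>\<^bsub>M\<^esub>} = boundaries F 0"

definition free_resolution ::
  "('a, 'r) ring_scheme \<Rightarrow> ('a, 'm) cplx \<Rightarrow> ('a, 'n) module \<Rightarrow> bool" where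
  "free_resolution R F M \<longleftrightarrow>
     is_complex R F \<and>
     (\<forall>n. is_free R (component F n)) \<and>
     (\<forall>n<0. carrier (component F n) = {\<zero>\<^bsub>component F n\<^esub>}) \<and>
     (\<forall>n\<ge>1. cycles F n = boundaries F n) \<and>
     (\<exists>\<epsilon>. is_augmentation R F M \<epsilon>)"

definition tensor_cplx_module ::
  "('a, 'r) ring_scheme \<Rightarrow> ('a, 'm) cplx \<Rightarrow> ('a, 'n) module \<Rightarrow> ('a, ('m \<times> 'n \<Rightarrow> 'a) set) cplx" where
  "tensor_cplx_module R F N =
     \<lparr>component = (\<lambda>n. tensor R (component F n) N),
      bd = (\<lambda>n. tensor_map R (component F n) N (component F (n - 1)) N (bd F n) (\<lambda>y. y))\<rparr>"

text \<open>
  Tor is computed from a chosen free resolution. A choice in HOL ranges over a fixed type, so that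
  type has to contain a resolution of every module with elements in \<open>'m\<close>. The names below suffice:
  take degree 0 free on the names \<open>Gen x\<close>, and degree \<open>n + 1\<close> free on the names \<open>Syz l\<close>, where the
  list \<open>l\<close> of coefficients and names of degree \<open>n\<close> spells out a cycle of degree \<open>n\<close> (in degree 0,
  an element of the kernel of the augmentation).
\<close>

datatype ('a, 'm) syz_name = Gen 'm | Syz "('a \<times> ('a, 'm) syz_name) list"

definition some_free_resolution ::
  "('a, 'r) ring_scheme \<Rightarrow> ('a, 'm) module \<Rightarrow> ('a, ('a, 'm) syz_name \<Rightarrow> 'a) cplx" where
  "some_free_resolution R M = (SOME F. free_resolution R F M)"

definition Tor ::
  "('a, 'r) ring_scheme \<Rightarrow> int \<Rightarrow> ('a, 'm) module \<Rightarrow> ('a, 'n) module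
   \<Rightarrow> ('a, ((('a, 'm) syz_name \<Rightarrow> 'a) \<times> 'n \<Rightarrow> 'a) set set) module" where
  "Tor R i M N = homology (tensor_cplx_module R (some_free_resolution R M) N) i"

definition Tor_independent :: "('a, 'r) ring_scheme \<Rightarrow> 'a set \<Rightarrow> 'a set \<Rightarrow> bool" where
  "Tor_independent R I J \<longleftrightarrow>
     (\<forall>i\<ge>1. carrier (Tor R i (cyclic_module R I) (cyclic_module R J)) =
            {\<zero>\<^bsub>Tor R i (cyclic_module R I) (cyclic_module R J)\<^esub>})"

definition minimal_complex ::
  "('a, 'r) ring_scheme \<Rightarrow> 'a set \<Rightarrow> ('a, 'm) cplx \<Rightarrow> bool" where
  "minimal_complex R \<mm> C \<longleftrightarrow>
     (\<forall>n. bd C n ` carrier (component C n) \<subseteq> ideal_smult R \<mm> (component C (n - 1)))"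


section \<open>The star product\<close>

definition trunc_ge1 :: "('a, 'm) cplx \<Rightarrow> ('a, 'm) cplx" where
  "trunc_ge1 C =
     \<lparr>component = (\<lambda>q. if q \<ge> 1 then component C q else zero_submodule (component C q)),
      bd = (\<lambda>q. if q > 1 then bd C q else (\<lambda>_. \<zero>\<^bsub>component C (q - 1)\<^esub>))\<rparr>"

definition bidegrees :: "int \<Rightarrow> (int \<times> int) set" where
  "bidegrees n = {(p, q). p + q = n}"

text \<open>
  The component in bidegree \<open>(p, q)\<close> of the differential of \<open>u\<close> collects the contributions of
  \<open>u (p + 1, q)\<close> and \<open>u (p, q + 1)\<close>; the latter has first degree \<open>p\<close>, whence the sign \<open>(-1)\<^sup>p\<close>.
\<close>

definition tensor_cplx ::
  "('a, 'r) ring_scheme \<Rightarrow> ('a, 'm) cplx \<Rightarrow> ('a, 'n) cplx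
   \<Rightarrow> ('a, int \<times> int \<Rightarrow> ('m \<times> 'n \<Rightarrow> 'a) set) cplx" where
  "tensor_cplx R Xs Ys =
     \<lparr>component = (\<lambda>n. direct_sum (bidegrees n) (\<lambda>(p, q). tensor R (component Xs p) (component Ys q))),
      bd = (\<lambda>n u. restrict (\<lambda>(p, q).
        let T = tensor R (component Xs p) (component Ys q);
            a = tensor_map R (component Xs (p + 1)) (component Ys q) (component Xs p) (component Ys q)
                  (bd Xs (p + 1)) (\<lambda>y. y) (u (p + 1, q));
            b = tensor_map R (component Xs p) (component Ys (q + 1)) (component Xs p) (component Ys q)
                  (\<lambda>x. x) (bd Ys (q + 1)) (u (p, q + 1))
        in a \<oplus>\<^bsub>T\<^esub> (if even p then b else \<ominus>\<^bsub>T\<^esub> b)) (bidegrees (n - 1)))\<rparr>"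

text \<open>
  All modules of a complex share one carrier type, so the module \<open>Xs\<^sub>0 \<otimes> Ys\<^sub>0\<close> in degree 0 is the
  direct sum with the single summand indexed by \<open>(0, 0)\<close>. For the differential in degree 1, note
  that \<open>(1, 1)\<close> is the only bidegree of total degree 2 in which the product of the truncations
  does not vanish.
\<close>

definition star_product ::
  "('a, 'r) ring_scheme \<Rightarrow> ('a, 'm) cplx \<Rightarrow> ('a, 'n) cplx
   \<Rightarrow> ('a, int \<times> int \<Rightarrow> ('m \<times> 'n \<Rightarrow> 'a) set) cplx" where
  "star_product R Xs Ys =
    (let T = tensor_cplx R (trunc_ge1 Xs) (trunc_ge1 Ys);
         S = (\<lambda>n. if n \<ge> 1 then component T (n + 1)
                  else if n = 0 then direct_sum {(0, 0)} (\<lambda>_. tensor R (component Xs 0) (component Ys 0))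
                  else zero_submodule (component T (n + 1)))
     in \<lparr>component = S,
         bd = (\<lambda>n. if n \<ge> 2 then bd T (n + 1)
                   else if n = 1 then
                     (\<lambda>u. \<lambda>_\<in>{(0, 0)}.
                        tensor_map R (component Xs 1) (component Ys 1) (component Xs 0) (component Ys 0)
                          (bd Xs 1) (bd Ys 1) (u (1, 1)))
                   else (\<lambda>_. \<zero>\<^bsub>S (n - 1)\<^esub>))\<rparr>)"


section \<open>Local and standard graded rings\<close>

definition local_ring :: "('a, 'r) ring_scheme \<Rightarrow> 'a set \<Rightarrow> bool" where
  "local_ring R \<mm> \<longleftrightarrow> maximalideal \<mm> R \<and> (\<forall>\<nn>. maximalideal \<nn> R \<longrightarrow> \<nn> = \<mm>)"

text \<open>
  A grading is a family of homogeneous components indexed by all integers. For a standard graded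
  ring the components of negative degree vanish.
\<close>

definition graded_module ::
  "('a, 'r) ring_scheme \<Rightarrow> (int \<Rightarrow> 'a set) \<Rightarrow> ('a, 'm) module \<Rightarrow> (int \<Rightarrow> 'm set) \<Rightarrow> bool" where
  "graded_module R G M H \<longleftrightarrow>
     module R M \<and>
     (\<forall>d. subgroup (H d) (add_monoid M)) \<and>
     (\<forall>i d. \<forall>r \<in> G i. \<forall>x \<in> H d. r \<odot>\<^bsub>M\<^esub> x \<in> H (i + d)) \<and>
     (\<forall>x \<in> carrier M. \<exists>!c. (\<forall>d. c d \<in> H d) \<and> finite {d. c d \<noteq> \<zero>\<^bsub>M\<^esub>} \<and>
        x = (\<Oplus>\<^bsub>M\<^esub>d\<in>{d. c d \<noteq> \<zero>\<^bsub>M\<^esub>}. c d))"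

definition standard_graded_ring :: "('a, 'r) ring_scheme \<Rightarrow> (int \<Rightarrow> 'a set) \<Rightarrow> bool" where
  "standard_graded_ring R G \<longleftrightarrow>
     graded_module R G (regular_module R) G \<and>
     (\<forall>n<0. G n = {\<zero>\<^bsub>R\<^esub>}) \<and>
     subfield (G 0) R \<and>
     generate_ring R (G 0 \<union> G 1) = carrier R"

definition irrelevant_ideal :: "('a, 'r) ring_scheme \<Rightarrow> (int \<Rightarrow> 'a set) \<Rightarrow> 'a set" where
  "irrelevant_ideal R G = Idl\<^bsub>R\<^esub> (\<Union>n\<in>{1..}. G n)"

definition homogeneous_ideal :: "('a, 'r) ring_scheme \<Rightarrow> (int \<Rightarrow> 'a set) \<Rightarrow> 'a set \<Rightarrow> bool" where
  "homogeneous_ideal R G I \<longleftrightarrow> ideal I R \<and> I = Idl\<^bsub>R\<^esub> (I \<inter> (\<Union>n. G n))"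

definition cyclic_grading ::
  "('a, 'r) ring_scheme \<Rightarrow> (int \<Rightarrow> 'a set) \<Rightarrow> 'a set \<Rightarrow> int \<Rightarrow> 'a set set" where
  "cyclic_grading R G I d = (\<lambda>x. I +>\<^bsub>R\<^esub> x) ` G d"

definition graded_free ::
  "('a, 'r) ring_scheme \<Rightarrow> (int \<Rightarrow> 'a set) \<Rightarrow> ('a, 'm) module \<Rightarrow> (int \<Rightarrow> 'm set) \<Rightarrow> bool" where
  "graded_free R G M H \<longleftrightarrow>
     graded_module R G M H \<and> (\<exists>B. is_basis R M B \<and> B \<subseteq> (\<Union>d. H d))"

text \<open>
  \<open>K n d\<close> is the component of internal degree \<open>d\<close> in homological degree \<open>n\<close>; the differentials
  and the augmentation preserve the internal degree.
\<close>

definition graded_free_resolution ::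
  "('a, 'r) ring_scheme \<Rightarrow> (int \<Rightarrow> 'a set) \<Rightarrow> ('a, 'm) cplx \<Rightarrow> (int \<Rightarrow> int \<Rightarrow> 'm set)
   \<Rightarrow> ('a, 'n) module \<Rightarrow> (int \<Rightarrow> 'n set) \<Rightarrow> bool" where
  "graded_free_resolution R G F K M H \<longleftrightarrow>
     free_resolution R F M \<and>
     (\<forall>n. graded_free R G (component F n) (K n)) \<and>
     (\<forall>n d. bd F n ` K n d \<subseteq> K (n - 1) d) \<and>
     (\<exists>\<epsilon>. is_augmentation R F M \<epsilon> \<and> (\<forall>d. \<epsilon> ` K 0 d \<subseteq> H d))"

definition tensor_grading ::
  "('a, 'r) ring_scheme \<Rightarrow> ('a, 'm) module \<Rightarrow> (int \<Rightarrow> 'm set) \<Rightarrow> ('a, 'n) module \<Rightarrow> (int \<Rightarrow> 'n set)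
   \<Rightarrow> int \<Rightarrow> ('m \<times> 'n \<Rightarrow> 'a) set set" where
  "tensor_grading R M H N H' d =
     generate (add_monoid (tensor R M N))
       {pure_tensor R M N x y | x y i j. x \<in> H i \<and> y \<in> H' j \<and> i + j = d}"

definition trunc_grading ::
  "('a, 'm) cplx \<Rightarrow> (int \<Rightarrow> int \<Rightarrow> 'm set) \<Rightarrow> int \<Rightarrow> int \<Rightarrow> 'm set" where
  "trunc_grading C K q d = (if q \<ge> 1 then K q d else {\<zero>\<^bsub>component C q\<^esub>})"

definition star_grading ::
  "('a, 'r) ring_scheme \<Rightarrow> ('a, 'm) cplx \<Rightarrow> (int \<Rightarrow> int \<Rightarrow> 'm set)
   \<Rightarrow> ('a, 'n) cplx \<Rightarrow> (int \<Rightarrow> int \<Rightarrow> 'n set)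
   \<Rightarrow> int \<Rightarrow> int \<Rightarrow> (int \<times> int \<Rightarrow> ('m \<times> 'n \<Rightarrow> 'a) set) set" where
  "star_grading R Xs K Ys L n d =
     (if n \<ge> 1 then
        {u \<in> carrier (component (star_product R Xs Ys) n). \<forall>(p, q) \<in> bidegrees (n + 1).
           u (p, q) \<in> tensor_grading R (component (trunc_ge1 Xs) p) (trunc_grading Xs K p)
                         (component (trunc_ge1 Ys) q) (trunc_grading Ys L q) d}
      else if n = 0 then
        {u \<in> carrier (component (star_product R Xs Ys) 0).
           u (0, 0) \<in> tensor_grading R (component Xs 0) (K 0) (component Ys 0) (L 0) d}
      else {\<zero>\<^bsub>component (star_product R Xs Ys) n\<^esub>})"

end

theory Submission
  imports Defs
begin

text \<open>
  Write \<open>X\<close> and \<open>Y\<close> for the two resolutions, \<open>\<partial>\<close> for their differentials, and \<open>T\<close> for the total complex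
  of \<open>X\<^sub>p \<otimes> Y\<^sub>q\<close> with \<open>p, q \<ge> 1\<close>, which up to a shift is the star product in positive degrees. The heart of
  the theorem is that the star product is exact in degrees \<open>n \<ge> 1\<close>. Let \<open>u\<close> be a cycle there,
  with components \<open>u (p, q)\<close> for \<open>p + q = n + 1\<close>. As \<open>X\<^sub>p\<close> is free, tensoring with it is exact
  (\<open>free_tensor_exact\<close>), so the complexes \<open>X\<^sub>p \<otimes> Y\<close> are exact in degrees \<open>q \<ge> 1\<close>. Hence a preimage of
  \<open>u\<close> can be constructed one component at a time, in the direction of growing \<open>q\<close>, once the
  corner component \<open>u (n, 1)\<close> has been written as \<open>(\<partial> \<otimes> 1) s \<plusminus> (1 \<otimes> \<partial>) r\<close> (\<open>Tot_zigzag\<close>).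

  The corner is where Tor-independence is needed (\<open>star_corner_step\<close>). The element
  \<open>(1 \<otimes> \<partial>) u (n, 1)\<close> of \<open>X\<^sub>n \<otimes> Y\<^sub>0\<close>, which is a copy of \<open>X\<^sub>n\<close>, is a cycle and therefore the image of some
  \<open>w\<close> in \<open>X\<^bsub>n+1\<^esub> \<otimes> Y\<^sub>0\<close>. The class of \<open>w\<close> in \<open>X\<^bsub>n+1\<^esub> \<otimes> R/J\<close> is a cycle, and since \<open>Tor\<close> vanishes it
  is a boundary; so \<open>w\<close> can be changed by a boundary until it comes from some \<open>s\<close> in \<open>X\<^bsub>n+1\<^esub> \<otimes> Y\<^sub>1\<close>. Now
  \<open>u (n, 1) - (\<partial> \<otimes> 1) s\<close> is killed by \<open>1 \<otimes> \<partial>\<close> and hence of the form \<open>(1 \<otimes> \<partial>) r\<close>.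

  To use the vanishing of \<open>Tor\<close>, which is defined by one chosen resolution, for the given
  resolution \<open>X\<close>, two classical facts are proved: a free resolution exists whose generators are
  names of the type over which the choice ranges (\<open>syz_resolution_is_free_resolution\<close>), and two
  free resolutions are related by chain maps whose composite is homotopic to the identity
  (\<open>chain_map_lift\<close> and \<open>chain_null_homotopy\<close>), so that
  exactness after tensoring does not depend on the resolution (\<open>tensor_exact_transfer\<close>).

  In degree zero, \<open>X\<^sub>0 \<otimes> Y\<^sub>0\<close> is a copy of \<open>R\<close>, in which the images of \<open>X\<^sub>1\<close> and \<open>Y\<^sub>1\<close> are \<open>I\<close> and \<open>J\<close>; so the
  image of \<open>\<partial> \<otimes> \<partial>\<close> is \<open>I J\<close> (\<open>star_augmentation\<close>). The star product is minimal because each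
  component of its differential is a tensor product of maps one of which has image in
  \<open>\<mm>\<close> times its target (\<open>star_minimal\<close>). In the graded case, a graded free module is one in which the
  degree of an element can be read off from its coordinates (\<open>graded_free_coords\<close>); in this
  description the gradings of tensor products and direct sums are again those of graded free
  modules, with the expected degrees of the basis elements.
\<close>

section \<open>Linear maps\<close>

lemma mem_a_r_coset: "c \<in> N +>\<^bsub>M\<^esub> x \<longleftrightarrow> (\<exists>n\<in>N. c = n \<oplus>\<^bsub>M\<^esub> x)"
  unfolding a_r_coset_def' by simp

text \<open>A locale of its own, rather than \<^locale>\<open>cring\<close>, keeps facts about modules from being replayed
in every structure that extends \<^locale>\<open>cring\<close>.\<close>

locale base_ring =
  fixes R :: "('a, 'r) ring_scheme" (structure)
  assumes R_cring: "cring R"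

sublocale base_ring \<subseteq> cring R by (rule R_cring)

context base_ring begin

lemma linear_mapsI:
  assumes "\<And>x. x \<in> carrier M \<Longrightarrow> h x \<in> carrier N"
    and "\<And>x y. x \<in> carrier M \<Longrightarrow> y \<in> carrier M \<Longrightarrow> h (x \<oplus>\<^bsub>M\<^esub> y) = h x \<oplus>\<^bsub>N\<^esub> h y"
    and "\<And>r x. r \<in> carrier R \<Longrightarrow> x \<in> carrier M \<Longrightarrow> h (r \<odot>\<^bsub>M\<^esub> x) = r \<odot>\<^bsub>N\<^esub> h x"
  shows "h \<in> linear_maps R M N"
  using assms by (auto simp: linear_maps_def hom_def)

lemma linear_closed: "h \<in> linear_maps R M N \<Longrightarrow> x \<in> carrier M \<Longrightarrow> h x \<in> carrier N"
  by (auto simp: linear_maps_def hom_def)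

lemma linear_add: "h \<in> linear_maps R M N \<Longrightarrow> x \<in> carrier M \<Longrightarrow> y \<in> carrier M
    \<Longrightarrow> h (x \<oplus>\<^bsub>M\<^esub> y) = h x \<oplus>\<^bsub>N\<^esub> h y"
  by (auto simp: linear_maps_def hom_def)

lemma linear_smult: "h \<in> linear_maps R M N \<Longrightarrow> r \<in> carrier R \<Longrightarrow> x \<in> carrier M
    \<Longrightarrow> h (r \<odot>\<^bsub>M\<^esub> x) = r \<odot>\<^bsub>N\<^esub> h x"
  by (auto simp: linear_maps_def)

lemma linear_zero:
  assumes "h \<in> linear_maps R M N" "module R M" "module R N"
  shows "h \<zero>\<^bsub>M\<^esub> = \<zero>\<^bsub>N\<^esub>"
proof -
  interpret M: module R M by fact
  interpret N: module R N by fact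
  have "h \<zero>\<^bsub>M\<^esub> = h (\<zero> \<odot>\<^bsub>M\<^esub> \<zero>\<^bsub>M\<^esub>)" by simp
  also have "\<dots> = \<zero> \<odot>\<^bsub>N\<^esub> h \<zero>\<^bsub>M\<^esub>" using assms by (intro linear_smult) auto
  also have "\<dots> = \<zero>\<^bsub>N\<^esub>" using assms by (simp add: linear_closed)
  finally show ?thesis .
qed

lemma module_neg_eq:
  assumes "module R M" "x \<in> carrier M" shows "\<ominus>\<^bsub>M\<^esub> x = (\<ominus> \<one>) \<odot>\<^bsub>M\<^esub> x"
  using assms by (simp add: module.smult_l_minus module.smult_one)

lemma linear_neg:
  assumes "h \<in> linear_maps R M N" "module R M" "module R N" "x \<in> carrier M"
  shows "h (\<ominus>\<^bsub>M\<^esub> x) = \<ominus>\<^bsub>N\<^esub> h x"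
  using assms by (simp add: module_neg_eq linear_smult linear_closed)

lemma linear_minus:
  assumes "h \<in> linear_maps R M N" "module R M" "module R N" "x \<in> carrier M" "y \<in> carrier M"
  shows "h (x \<ominus>\<^bsub>M\<^esub> y) = h x \<ominus>\<^bsub>N\<^esub> h y"
proof -
  interpret M: module R M by fact
  show ?thesis using assms by (simp add: a_minus_def linear_add linear_neg)
qed

lemma linear_finsum:
  assumes h: "h \<in> linear_maps R M N" and M: "module R M" and N: "module R N"
    and f: "\<And>i. i \<in> S \<Longrightarrow> f i \<in> carrier M"
  shows "h (\<Oplus>\<^bsub>M\<^esub>i\<in>S. f i) = (\<Oplus>\<^bsub>N\<^esub>i\<in>S. h (f i))"
proof -
  interpret M: module R M by fact
  interpret N: module R N by fact
  show ?thesis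
  proof (cases "finite S")
    case True then show ?thesis using f
    proof (induction S rule: finite_induct)
      case empty then show ?case using linear_zero[OF h M N] by simp
    next
      case (insert a S)
      have "f \<in> S \<rightarrow> carrier M" "(\<lambda>i. h (f i)) \<in> S \<rightarrow> carrier N" "h (f a) \<in> carrier N"
        using insert by (auto intro!: linear_closed[OF h])
      then show ?case using insert
        by (simp add: M.finsum_insert N.finsum_insert linear_add[OF h])
    qed
  next
    case False then show ?thesis using linear_zero[OF h M N]
      by (simp add: M.finsum_infinite N.finsum_infinite)
  qed
qed

lemma linear_comp:
  "g \<in> linear_maps R N Q \<Longrightarrow> h \<in> linear_maps R M N \<Longrightarrow> (\<lambda>x. g (h x)) \<in> linear_maps R M Q"
  by (rule linear_mapsI) (auto simp: linear_closed linear_add linear_smult)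

lemma linear_id: "(\<lambda>x. x) \<in> linear_maps R M M"
  by (rule linear_mapsI) auto

lemma linear_cong:
  assumes "h \<in> linear_maps R M N" "module R M" "\<And>x. x \<in> carrier M \<Longrightarrow> h x = g x"
  shows "g \<in> linear_maps R M N"
proof -
  interpret M: module R M by fact
  show ?thesis
    by (rule linear_mapsI)
      (simp_all add: assms(3)[symmetric] linear_closed[OF assms(1)] linear_add[OF assms(1)]
        linear_smult[OF assms(1)])
qed

lemma linear_null:
  assumes "module R N" shows "(\<lambda>x. \<zero>\<^bsub>N\<^esub>) \<in> linear_maps R M N"
proof -
  interpret N: module R N by fact
  show ?thesis by (rule linear_mapsI) auto
qed

lemma linear_sum:
  assumes "module R N" "g \<in> linear_maps R M N" "h \<in> linear_maps R M N"
  shows "(\<lambda>x. g x \<oplus>\<^bsub>N\<^esub> h x) \<in> linear_maps R M N"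
proof -
  interpret N: module R N by fact
  show ?thesis
    by (rule linear_mapsI)
      (auto simp: linear_closed[OF assms(2)] linear_closed[OF assms(3)] linear_add[OF assms(2)]
        linear_add[OF assms(3)] linear_smult[OF assms(2)] linear_smult[OF assms(3)]
        N.smult_r_distr N.a_ac)
qed

lemma linear_uminus:
  assumes "module R N" "h \<in> linear_maps R M N"
  shows "(\<lambda>x. \<ominus>\<^bsub>N\<^esub> h x) \<in> linear_maps R M N"
proof -
  interpret N: module R N by fact
  show ?thesis
    by (rule linear_mapsI)
      (auto simp: linear_closed[OF assms(2)] linear_add[OF assms(2)] linear_smult[OF assms(2)]
        N.smult_r_minus N.minus_add)
qed

lemma linear_scale:
  assumes "module R N" "h \<in> linear_maps R M N" "r \<in> carrier R"
  shows "(\<lambda>x. r \<odot>\<^bsub>N\<^esub> h x) \<in> linear_maps R M N"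
proof -
  interpret N: module R N by fact
  show ?thesis
    by (rule linear_mapsI)
      (auto simp: linear_closed[OF assms(2)] linear_add[OF assms(2)] linear_smult[OF assms(2)]
        N.smult_r_distr assms(3) N.smult_assoc1[symmetric] m_comm)
qed

lemma kernel_submodule:
  assumes "h \<in> linear_maps R M N" "module R M" "module R N"
  shows "submodule {x \<in> carrier M. h x = \<zero>\<^bsub>N\<^esub>} R M"
proof -
  interpret M: module R M by fact
  interpret N: module R N by fact
  show ?thesis using assms
    by (intro M.submoduleI) (auto simp: linear_zero linear_add linear_neg linear_smult)
qed

lemma linear_image_submodule:
  assumes "h \<in> linear_maps R M N" "module R M" "module R N"
  shows "submodule (h ` carrier M) R N"
proof -
  interpret M: module R M by fact
  interpret N: module R N by fact
  show ?thesis
  proof (rule N.submoduleI)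
    show "h ` carrier M \<subseteq> carrier N" using assms by (auto simp: linear_closed)
    show "\<zero>\<^bsub>N\<^esub> \<in> h ` carrier M" using linear_zero[OF assms] by (metis M.zero_closed imageI)
    show "\<ominus>\<^bsub>N\<^esub> a \<in> h ` carrier M" if "a \<in> h ` carrier M" for a
      using that linear_neg[OF assms] by (auto intro!: image_eqI[where x="\<ominus>\<^bsub>M\<^esub> _"])
    show "a \<oplus>\<^bsub>N\<^esub> b \<in> h ` carrier M" if "a \<in> h ` carrier M" "b \<in> h ` carrier M" for a b
      using that linear_add[OF assms(1)] by (auto simp: image_iff) (metis M.a_closed)
    show "r \<odot>\<^bsub>N\<^esub> a \<in> h ` carrier M" if "r \<in> carrier R" "a \<in> h ` carrier M" for r a
      using that linear_smult[OF assms(1)] by (auto simp: image_iff) (metis M.smult_closed)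
  qed
qed

lemma linear_inj:
  assumes "h \<in> linear_maps R M N" "module R M" "module R N"
    and "\<And>x. x \<in> carrier M \<Longrightarrow> h x = \<zero>\<^bsub>N\<^esub> \<Longrightarrow> x = \<zero>\<^bsub>M\<^esub>"
    and "x \<in> carrier M" "y \<in> carrier M" "h x = h y"
  shows "x = y"
proof -
  interpret M: module R M by fact
  interpret N: module R N by fact
  have "h (x \<ominus>\<^bsub>M\<^esub> y) = \<zero>\<^bsub>N\<^esub>" using assms(7) linear_closed[OF assms(1) assms(6)]
    by (simp add: linear_minus[OF assms(1-3,5,6)] N.minus_eq N.r_neg)
  then have "x \<ominus>\<^bsub>M\<^esub> y = \<zero>\<^bsub>M\<^esub>" using assms(4)[of "x \<ominus>\<^bsub>M\<^esub> y"] assms(5,6) by simp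
  moreover have "(x \<ominus>\<^bsub>M\<^esub> y) \<oplus>\<^bsub>M\<^esub> y = x"
    using assms(5,6) by (simp add: M.minus_eq M.a_assoc M.l_neg)
  ultimately show ?thesis using assms(5,6) by simp
qed

lemma linear_iso_inverse:
  assumes "h \<in> linear_isos R M N" "module R M" "module R N"
  obtains g where "g \<in> linear_isos R N M" "\<And>x. x \<in> carrier M \<Longrightarrow> g (h x) = x"
    "\<And>y. y \<in> carrier N \<Longrightarrow> h (g y) = y"
proof -
  interpret M: module R M by fact
  interpret N: module R N by fact
  let ?g = "inv_into (carrier M) h"
  have h: "h \<in> linear_maps R M N" and b: "bij_betw h (carrier M) (carrier N)"
    using assms by (auto simp: linear_isos_def)
  have gh: "?g (h x) = x" if "x \<in> carrier M" for x
    using b that by (simp add: bij_betw_def)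
  have hg: "h (?g y) = y" if "y \<in> carrier N" for y
    using b that by (simp add: bij_betw_inv_into_right)
  have gc: "?g y \<in> carrier M" if "y \<in> carrier N" for y
    using b that by (metis bij_betw_def inv_into_into)
  have "?g \<in> linear_maps R N M"
  proof (rule linear_mapsI)
    show "?g (x \<oplus>\<^bsub>N\<^esub> y) = ?g x \<oplus>\<^bsub>M\<^esub> ?g y" if "x \<in> carrier N" "y \<in> carrier N" for x y
      using gh[of "?g x \<oplus>\<^bsub>M\<^esub> ?g y"] that by (simp add: gc hg linear_add[OF h])
    show "?g (r \<odot>\<^bsub>N\<^esub> x) = r \<odot>\<^bsub>M\<^esub> ?g x" if "r \<in> carrier R" "x \<in> carrier N" for r x
      using gh[of "r \<odot>\<^bsub>M\<^esub> ?g x"] that by (simp add: gc hg linear_smult[OF h])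
  qed (rule gc)
  moreover have "bij_betw ?g (carrier N) (carrier M)" by (rule bij_betw_inv_into[OF b])
  ultimately have "?g \<in> linear_isos R N M" by (simp add: linear_isos_def)
  then show ?thesis using that gh hg by blast
qed

section \<open>Quotient modules\<close>

lemma submodule_abelian_subgroup:
  assumes "module R M" "submodule N R M" shows "abelian_subgroup N M"
  using assms by (intro abelian_subgroupI3) (auto simp: additive_subgroup_def submodule_def module_def)

lemma span_module_submodule:
  assumes "module R M" "S \<subseteq> carrier M"
  shows "submodule (span_module R M S) R M"
proof -
  interpret M: module R M by fact
  have c: "submodule (carrier M) R M" by (rule M.carrier_is_submodule)
  show ?thesis unfolding span_module_def
  proof (rule M.submoduleI)
    show "\<Inter>{N. submodule N R M \<and> S \<subseteq> N} \<subseteq> carrier M" using c assms by auto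
    show "\<zero>\<^bsub>M\<^esub> \<in> \<Inter>{N. submodule N R M \<and> S \<subseteq> N}"
      using subgroup.one_closed[OF submodule.axioms(1)] by fastforce
    show "\<ominus>\<^bsub>M\<^esub> a \<in> \<Inter>{N. submodule N R M \<and> S \<subseteq> N}" if "a \<in> \<Inter>{N. submodule N R M \<and> S \<subseteq> N}" for a
      using that M.submoduleE(3) by blast
    show "a \<oplus>\<^bsub>M\<^esub> b \<in> \<Inter>{N. submodule N R M \<and> S \<subseteq> N}"
      if "a \<in> \<Inter>{N. submodule N R M \<and> S \<subseteq> N}" "b \<in> \<Inter>{N. submodule N R M \<and> S \<subseteq> N}" for a b
      using that M.submoduleE(5) by blast
    show "r \<odot>\<^bsub>M\<^esub> a \<in> \<Inter>{N. submodule N R M \<and> S \<subseteq> N}"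
      if "r \<in> carrier R" "a \<in> \<Inter>{N. submodule N R M \<and> S \<subseteq> N}" for r a
      using that M.submoduleE(4) by blast
  qed
qed

lemma span_module_base: "S \<subseteq> span_module R M S"
  by (auto simp: span_module_def)

lemma span_module_minimal: "submodule N R M \<Longrightarrow> S \<subseteq> N \<Longrightarrow> span_module R M S \<subseteq> N"
  by (auto simp: span_module_def)

context
  fixes M :: "('a, 'm) module" and N :: "'m set"
  assumes M: "module R M" and N: "submodule N R M"
begin

interpretation M: module R M by (rule M)
interpretation N: abelian_subgroup N M by (rule submodule_abelian_subgroup[OF M N])

lemma quot_carrier: "carrier (quot_module M N) = (\<lambda>x. N +>\<^bsub>M\<^esub> x) ` carrier M"
  by (auto simp: quot_module_def A_RCOSETS_def')

lemma quot_zero: "\<zero>\<^bsub>quot_module M N\<^esub> = N +>\<^bsub>M\<^esub> \<zero>\<^bsub>M\<^esub>"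
  by (simp add: quot_module_def N.a_subset)

lemma quot_add: "x \<in> carrier M \<Longrightarrow> y \<in> carrier M \<Longrightarrow>
    (N +>\<^bsub>M\<^esub> x) \<oplus>\<^bsub>quot_module M N\<^esub> (N +>\<^bsub>M\<^esub> y) = N +>\<^bsub>M\<^esub> (x \<oplus>\<^bsub>M\<^esub> y)"
  by (simp add: quot_module_def N.a_rcos_sum)

lemma quot_smult:
  assumes r: "r \<in> carrier R" and x: "x \<in> carrier M"
  shows "r \<odot>\<^bsub>quot_module M N\<^esub> (N +>\<^bsub>M\<^esub> x) = N +>\<^bsub>M\<^esub> (r \<odot>\<^bsub>M\<^esub> x)"
proof -
  have *: "N +>\<^bsub>M\<^esub> (r \<odot>\<^bsub>M\<^esub> c) = N +>\<^bsub>M\<^esub> (r \<odot>\<^bsub>M\<^esub> x)" if c: "c \<in> N +>\<^bsub>M\<^esub> x" for c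
  proof -
    obtain n where n: "n \<in> N" "c = n \<oplus>\<^bsub>M\<^esub> x" using c unfolding mem_a_r_coset by (rule bexE)
    then have "r \<odot>\<^bsub>M\<^esub> c = r \<odot>\<^bsub>M\<^esub> n \<oplus>\<^bsub>M\<^esub> r \<odot>\<^bsub>M\<^esub> x" using r x by (simp add: M.smult_r_distr)
    moreover have "r \<odot>\<^bsub>M\<^esub> n \<in> N" using n r N by (simp add: submodule.smult_closed)
    ultimately have "r \<odot>\<^bsub>M\<^esub> c \<in> N +>\<^bsub>M\<^esub> (r \<odot>\<^bsub>M\<^esub> x)"
      unfolding mem_a_r_coset by (rule bexI)
    then show ?thesis using r x N.a_repr_independence'[symmetric, of _ "r \<odot>\<^bsub>M\<^esub> x"] by simp
  qed
  have x': "x \<in> N +>\<^bsub>M\<^esub> x" using x by (rule N.a_rcos_self)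
  have "(\<Union>c\<in>N +>\<^bsub>M\<^esub> x. N +>\<^bsub>M\<^esub> (r \<odot>\<^bsub>M\<^esub> c)) = (\<Union>c\<in>N +>\<^bsub>M\<^esub> x. N +>\<^bsub>M\<^esub> (r \<odot>\<^bsub>M\<^esub> x))"
    by (rule SUP_cong[OF refl *])
  also have "\<dots> = N +>\<^bsub>M\<^esub> (r \<odot>\<^bsub>M\<^esub> x)" using x' by (rule UN_constant_eq) simp
  finally show ?thesis by (simp add: quot_module_def)
qed

lemma quot_module_module: "module R (quot_module M N)"
proof (rule moduleI)
  let ?Q = "quot_module M N"
  show "abelian_group ?Q"
  proof (rule abelian_groupI)
    fix x assume "x \<in> carrier ?Q"
    then obtain a where a: "x = N +>\<^bsub>M\<^esub> a" "a \<in> carrier M"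
      unfolding quot_carrier by (rule imageE)
    then have "(N +>\<^bsub>M\<^esub> (\<ominus>\<^bsub>M\<^esub> a)) \<oplus>\<^bsub>?Q\<^esub> x = \<zero>\<^bsub>?Q\<^esub>"
      by (simp add: quot_add quot_zero M.l_neg)
    moreover have "N +>\<^bsub>M\<^esub> (\<ominus>\<^bsub>M\<^esub> a) \<in> carrier ?Q"
      unfolding quot_carrier using a by (intro imageI) simp
    ultimately show "\<exists>y\<in>carrier ?Q. y \<oplus>\<^bsub>?Q\<^esub> x = \<zero>\<^bsub>?Q\<^esub>" by (rule bexI)
  qed (auto simp: quot_carrier quot_add quot_zero M.a_ac)
qed (auto simp: quot_carrier quot_smult quot_add M.smult_l_distr M.smult_r_distr M.smult_assoc1
      is_cring)

lemma quot_proj_linear: "(\<lambda>x. N +>\<^bsub>M\<^esub> x) \<in> linear_maps R M (quot_module M N)"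
  by (rule linear_mapsI) (auto simp: quot_carrier quot_add quot_smult)

lemma quot_zero_iff: "x \<in> carrier M \<Longrightarrow> N +>\<^bsub>M\<^esub> x = \<zero>\<^bsub>quot_module M N\<^esub> \<longleftrightarrow> x \<in> N"
proof -
  assume x: "x \<in> carrier M"
  have "\<zero>\<^bsub>quot_module M N\<^esub> = N" by (simp add: quot_module_def)
  then show ?thesis using x N.a_rcos_self[OF x]
    by (metis M.a_coset_join2 N.a_subset N.is_additive_subgroup additive_subgroup.a_subgroup)
qed

text \<open>The induced map evaluates \<open>h\<close> at an arbitrary representative of the coset, which is harmless
because two representatives differ by an element that \<open>h\<close> kills.\<close>

lemma quot_lift:
  assumes Q: "module R Q" and h: "h \<in> linear_maps R M Q" and k: "\<And>x. x \<in> N \<Longrightarrow> h x = \<zero>\<^bsub>Q\<^esub>"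
  obtains g where "g \<in> linear_maps R (quot_module M N) Q"
    "\<And>x. x \<in> carrier M \<Longrightarrow> g (N +>\<^bsub>M\<^esub> x) = h x"
proof -
  interpret Q: module R Q by fact
  define g where "g = (\<lambda>C. h (SOME c. c \<in> C))"
  have g: "g (N +>\<^bsub>M\<^esub> x) = h x" if x: "x \<in> carrier M" for x
  proof -
    have "(SOME c. c \<in> N +>\<^bsub>M\<^esub> x) \<in> N +>\<^bsub>M\<^esub> x" using N.a_rcos_self[OF x] by (rule someI)
    then obtain n where n: "n \<in> N" "(SOME c. c \<in> N +>\<^bsub>M\<^esub> x) = n \<oplus>\<^bsub>M\<^esub> x"
      unfolding mem_a_r_coset by (rule bexE)
    then show ?thesis using x h k linear_closed[OF h x]
      by (simp add: g_def linear_add[OF h])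
  qed
  have "g \<in> linear_maps R (quot_module M N) Q"
    by (rule linear_mapsI)
      (auto simp: quot_carrier quot_add quot_smult g linear_closed[OF h] linear_add[OF h]
        linear_smult[OF h])
  then show ?thesis using g that by blast
qed

end

end

section \<open>Free modules and bases\<close>

text \<open>The linear extension of \<open>v\<close> to a free module. The sum is the one in the definition of a basis, so
that a set \<open>B\<close> is a basis exactly when the extension of the identity of \<open>B\<close> is bijective.\<close>

definition free_lift :: "('a, 'r) ring_scheme \<Rightarrow> ('a, 'm) module \<Rightarrow> ('b \<Rightarrow> 'm) \<Rightarrow> ('b \<Rightarrow> 'a) \<Rightarrow> 'm" where
  "free_lift R Q v f = (\<Oplus>\<^bsub>Q\<^esub>b\<in>{b. f b \<noteq> \<zero>\<^bsub>R\<^esub>}. f b \<odot>\<^bsub>Q\<^esub> v b)"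

text \<open>A basis indexed by \<open>A\<close>, together with its coordinate map. Indexing, instead of using the set
of basis elements itself, lets the bases of tensor products and direct sums be indexed by pairs,
and only the coordinate map is needed in calculations. Surjectivity of \<open>\<kappa>\<close> is automatic, because
its image contains all generators.\<close>

definition basis_coords ::
  "('a, 'r) ring_scheme \<Rightarrow> ('a, 'm) module \<Rightarrow> 'i set \<Rightarrow> ('m \<Rightarrow> 'i \<Rightarrow> 'a) \<Rightarrow> ('i \<Rightarrow> 'm) \<Rightarrow> bool" where
  "basis_coords R M A \<kappa> e \<longleftrightarrow>
     \<kappa> \<in> linear_maps R M (free_module R A) \<and> e \<in> A \<rightarrow> carrier M \<and>
     (\<forall>b\<in>A. \<kappa> (e b) = free_gen R b) \<and>
     (\<forall>x\<in>carrier M. \<kappa> x = (\<lambda>_. \<zero>\<^bsub>R\<^esub>) \<longrightarrow> x = \<zero>\<^bsub>M\<^esub>)"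

context base_ring begin

lemma free_carrier: "f \<in> carrier (free_module R A) \<longleftrightarrow>
    (\<forall>b. f b \<in> carrier R) \<and> (\<forall>b. b \<notin> A \<longrightarrow> f b = \<zero>) \<and> finite {b. f b \<noteq> \<zero>}"
  by (simp add: free_module_def)

lemma free_zero: "\<zero>\<^bsub>free_module R A\<^esub> = (\<lambda>_. \<zero>)"
  and free_add: "f \<oplus>\<^bsub>free_module R A\<^esub> g = (\<lambda>b. f b \<oplus> g b)"
  and free_smult: "r \<odot>\<^bsub>free_module R A\<^esub> f = (\<lambda>b. r \<otimes> f b)"
  by (simp_all add: free_module_def)

lemma free_module_module: "module R (free_module R A)"
proof (rule moduleI)
  let ?F = "free_module R A"
  show "cring R" by (rule is_cring)
  have fin: "finite {b. f b \<oplus> g b \<noteq> \<zero>}" if "f \<in> carrier ?F" "g \<in> carrier ?F" for f g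
    by (rule finite_subset[of _ "{b. f b \<noteq> \<zero>} \<union> {b. g b \<noteq> \<zero>}"]) (use that in \<open>auto simp: free_carrier\<close>)
  show "abelian_group ?F"
  proof (rule abelian_groupI)
    fix f assume f: "f \<in> carrier ?F"
    have "(\<lambda>b. \<ominus> f b) \<in> carrier ?F"
      using f by (auto simp: free_carrier elim!: rev_finite_subset)
    moreover have "(\<lambda>b. \<ominus> f b) \<oplus>\<^bsub>?F\<^esub> f = \<zero>\<^bsub>?F\<^esub>"
      using f by (auto simp: free_carrier free_zero free_add l_neg)
    ultimately show "\<exists>g\<in>carrier ?F. g \<oplus>\<^bsub>?F\<^esub> f = \<zero>\<^bsub>?F\<^esub>" by blast
    show "f \<oplus>\<^bsub>?F\<^esub> g \<in> carrier ?F" if g: "g \<in> carrier ?F" for g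
      using f g fin[OF f g] by (simp add: free_carrier free_add)
  qed (auto simp: free_carrier free_zero free_add a_ac)
  show "a \<odot>\<^bsub>?F\<^esub> x \<in> carrier ?F" if "a \<in> carrier R" "x \<in> carrier ?F" for a x
    using that by (auto simp: free_carrier free_smult elim!: rev_finite_subset)
qed (auto simp: free_carrier free_add free_smult l_distr r_distr m_assoc)

lemma free_gen_closed: "b \<in> A \<Longrightarrow> free_gen R b \<in> carrier (free_module R A)"
  by (auto simp: free_carrier free_gen_def)

text \<open>Induction on the size of the support. Together with the next lemma it replaces almost all
calculations with finite sums.\<close>

lemma free_induct [consumes 1, case_names zero step]:
  assumes "f \<in> carrier (free_module R A)"
    and "P (\<lambda>_. \<zero>)"
    and "\<And>f r b. f \<in> carrier (free_module R A) \<Longrightarrow> r \<in> carrier R \<Longrightarrow> b \<in> A \<Longrightarrow> P f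
      \<Longrightarrow> P (r \<odot>\<^bsub>free_module R A\<^esub> free_gen R b \<oplus>\<^bsub>free_module R A\<^esub> f)"
  shows "P f"
  using assms(1)
proof (induction "card {b. f b \<noteq> \<zero>}" arbitrary: f)
  case 0
  then have "f = (\<lambda>_. \<zero>)" by (auto simp: free_carrier)
  then show ?case using assms(2) by simp
next
  case (Suc n)
  then have "{b. f b \<noteq> \<zero>} \<noteq> {}" by (metis Zero_not_Suc card.empty)
  then obtain b where b: "f b \<noteq> \<zero>" by blast
  let ?g = "f(b := \<zero>)"
  have supp: "{x. ?g x \<noteq> \<zero>} = {x. f x \<noteq> \<zero>} - {b}" by auto
  have g: "?g \<in> carrier (free_module R A)"
    using Suc.prems supp by (auto simp: free_carrier)
  have "finite {x. f x \<noteq> \<zero>}" using Suc.prems by (simp add: free_carrier)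
  then have "card {x. ?g x \<noteq> \<zero>} = n" using Suc.hyps(2) b supp by simp
  then have Pg: "P ?g" using Suc.hyps(1)[of ?g] g by simp
  have bA: "b \<in> A" and fb: "f b \<in> carrier R" using Suc.prems b by (auto simp: free_carrier)
  have "f = f b \<odot>\<^bsub>free_module R A\<^esub> free_gen R b \<oplus>\<^bsub>free_module R A\<^esub> ?g"
    using Suc.prems by (auto simp: free_carrier free_add free_smult free_gen_def)
  then show ?case using assms(3)[OF g fb bA Pg] by simp
qed

lemma linear_free_eq:
  assumes Q: "module R Q" and g: "g \<in> linear_maps R (free_module R A) Q"
    and h: "h \<in> linear_maps R (free_module R A) Q"
    and eq: "\<And>b. b \<in> A \<Longrightarrow> g (free_gen R b) = h (free_gen R b)"
    and f: "f \<in> carrier (free_module R A)"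
  shows "g f = h f"
  using f
proof (induction rule: free_induct)
  case zero
  then show ?case using linear_zero[OF g free_module_module Q] linear_zero[OF h free_module_module Q]
    by (simp add: free_zero)
next
  case (step f r b)
  interpret F: module R "free_module R A" by (rule free_module_module)
  show ?case using step free_gen_closed[OF step(3)]
    by (simp add: linear_add[OF g] linear_add[OF h] linear_smult[OF g] linear_smult[OF h] eq)
qed

lemma free_lift_superset:
  assumes Q: "module R Q" and v: "v \<in> A \<rightarrow> carrier Q" and f: "f \<in> carrier (free_module R A)"
    and S: "finite S" "{b. f b \<noteq> \<zero>} \<subseteq> S" "S \<subseteq> A"
  shows "free_lift R Q v f = (\<Oplus>\<^bsub>Q\<^esub>b\<in>S. f b \<odot>\<^bsub>Q\<^esub> v b)"
proof -
  interpret Q: module R Q by fact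
  have c: "f b \<odot>\<^bsub>Q\<^esub> v b \<in> carrier Q" if "b \<in> S" for b
  proof -
    have "v b \<in> carrier Q" "f b \<in> carrier R" using f v S that by (auto simp: free_carrier)
    then show ?thesis by simp
  qed
  have z: "f b \<odot>\<^bsub>Q\<^esub> v b = \<zero>\<^bsub>Q\<^esub>" if "b \<in> S - {b. f b \<noteq> \<zero>}" for b
  proof -
    have "f b = \<zero>" "v b \<in> carrier Q" using that v S by auto
    then show ?thesis by simp
  qed
  show ?thesis unfolding free_lift_def
    by (rule Q.add.finprod_mono_neutral_cong_left) (use c z S in auto)
qed

lemma free_lift_linear:
  assumes Q: "module R Q" and v: "v \<in> A \<rightarrow> carrier Q"
  shows "free_lift R Q v \<in> linear_maps R (free_module R A) Q"
proof (rule linear_mapsI)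
  interpret Q: module R Q by fact
  interpret F: module R "free_module R A" by (rule free_module_module)
  have c: "f b \<odot>\<^bsub>Q\<^esub> v b \<in> carrier Q" if "f \<in> carrier (free_module R A)" "b \<in> A" for b f
    using v that by (auto simp: free_carrier)
  have supp: "{b. f b \<noteq> \<zero>} \<subseteq> A" "finite {b. f b \<noteq> \<zero>}" if "f \<in> carrier (free_module R A)" for f
    using that by (auto simp: free_carrier)
  fix f assume f: "f \<in> carrier (free_module R A)"
  show "free_lift R Q v f \<in> carrier Q"
    unfolding free_lift_def using c[OF f] supp[OF f] by (intro Q.finsum_closed) auto
  show "free_lift R Q v (r \<odot>\<^bsub>free_module R A\<^esub> f) = r \<odot>\<^bsub>Q\<^esub> free_lift R Q v f" if r: "r \<in> carrier R" for r
  proof -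
    let ?S = "{b. f b \<noteq> \<zero>}"
    have rf: "r \<odot>\<^bsub>free_module R A\<^esub> f \<in> carrier (free_module R A)" using r f by simp
    have vb: "v b \<in> carrier Q" "f b \<in> carrier R" if "b \<in> ?S" for b
      using that v f supp[OF f] by (auto simp: free_carrier)
    have "free_lift R Q v (r \<odot>\<^bsub>free_module R A\<^esub> f) = (\<Oplus>\<^bsub>Q\<^esub>b\<in>?S. (r \<odot>\<^bsub>free_module R A\<^esub> f) b \<odot>\<^bsub>Q\<^esub> v b)"
      by (rule free_lift_superset[OF Q v rf]) (use supp[OF f] r in \<open>auto simp: free_smult\<close>)
    also have "\<dots> = (\<Oplus>\<^bsub>Q\<^esub>b\<in>?S. r \<odot>\<^bsub>Q\<^esub> (f b \<odot>\<^bsub>Q\<^esub> v b))"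
      by (rule Q.add.finprod_cong') (use r vb in \<open>auto simp: free_smult Q.smult_assoc1\<close>)
    also have "\<dots> = r \<odot>\<^bsub>Q\<^esub> free_lift R Q v f"
      unfolding free_lift_def by (rule Q.finsum_smult_ldistr[symmetric]) (use r vb supp[OF f] in auto)
    finally show ?thesis .
  qed
  fix g assume g: "g \<in> carrier (free_module R A)"
  let ?S = "{b. f b \<noteq> \<zero>} \<union> {b. g b \<noteq> \<zero>}"
  have S: "finite ?S" "?S \<subseteq> A" using supp[OF f] supp[OF g] by auto
  have vb: "v b \<in> carrier Q" "f b \<in> carrier R" "g b \<in> carrier R" if "b \<in> ?S" for b
    using that v f g S by (auto simp: free_carrier)
  have fg: "f \<oplus>\<^bsub>free_module R A\<^esub> g \<in> carrier (free_module R A)" using f g by simp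
  have "free_lift R Q v (f \<oplus>\<^bsub>free_module R A\<^esub> g) = (\<Oplus>\<^bsub>Q\<^esub>b\<in>?S. (f \<oplus>\<^bsub>free_module R A\<^esub> g) b \<odot>\<^bsub>Q\<^esub> v b)"
    by (rule free_lift_superset[OF Q v fg]) (use S in \<open>auto simp: free_add\<close>)
  also have "\<dots> = (\<Oplus>\<^bsub>Q\<^esub>b\<in>?S. f b \<odot>\<^bsub>Q\<^esub> v b \<oplus>\<^bsub>Q\<^esub> g b \<odot>\<^bsub>Q\<^esub> v b)"
    by (rule Q.add.finprod_cong') (use vb in \<open>auto simp: free_add Q.smult_l_distr\<close>)
  also have "\<dots> = (\<Oplus>\<^bsub>Q\<^esub>b\<in>?S. f b \<odot>\<^bsub>Q\<^esub> v b) \<oplus>\<^bsub>Q\<^esub> (\<Oplus>\<^bsub>Q\<^esub>b\<in>?S. g b \<odot>\<^bsub>Q\<^esub> v b)"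
    by (rule Q.finsum_addf) (use vb in auto)
  also have "\<dots> = free_lift R Q v f \<oplus>\<^bsub>Q\<^esub> free_lift R Q v g"
    using free_lift_superset[OF Q v f S(1) _ S(2)] free_lift_superset[OF Q v g S(1) _ S(2)] by simp
  finally show "free_lift R Q v (f \<oplus>\<^bsub>free_module R A\<^esub> g) = free_lift R Q v f \<oplus>\<^bsub>Q\<^esub> free_lift R Q v g" .
qed

lemma free_lift_gen:
  assumes Q: "module R Q" and v: "v \<in> A \<rightarrow> carrier Q" and b: "b \<in> A"
  shows "free_lift R Q v (free_gen R b) = v b"
proof -
  interpret Q: module R Q by fact
  have vb: "v b \<in> carrier Q" using v b by auto
  have "free_lift R Q v (free_gen R b) = (\<Oplus>\<^bsub>Q\<^esub>b'\<in>{b}. free_gen R b b' \<odot>\<^bsub>Q\<^esub> v b')"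
    by (rule free_lift_superset[OF Q v free_gen_closed[OF b]]) (use b in \<open>auto simp: free_gen_def\<close>)
  also have "\<dots> = v b" using vb by (simp add: free_gen_def)
  finally show ?thesis .
qed

lemma basis_coordsD:
  assumes "basis_coords R M A \<kappa> e"
  shows "\<kappa> \<in> linear_maps R M (free_module R A)" "e \<in> A \<rightarrow> carrier M"
    "\<And>b. b \<in> A \<Longrightarrow> e b \<in> carrier M"
    "\<And>b. b \<in> A \<Longrightarrow> \<kappa> (e b) = free_gen R b"
    "\<And>x. x \<in> carrier M \<Longrightarrow> \<kappa> x = (\<lambda>_. \<zero>) \<Longrightarrow> x = \<zero>\<^bsub>M\<^esub>"
    "\<And>x. x \<in> carrier M \<Longrightarrow> \<kappa> x \<in> carrier (free_module R A)"
    "\<And>x b. x \<in> carrier M \<Longrightarrow> \<kappa> x b \<in> carrier R"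
  using assms linear_closed[of \<kappa> M "free_module R A"] by (auto simp: basis_coords_def free_carrier)

lemma coords_free_lift:
  assumes M: "module R M" and c: "basis_coords R M A \<kappa> e" and f: "f \<in> carrier (free_module R A)"
  shows "\<kappa> (free_lift R M e f) = f"
proof (rule linear_free_eq[OF free_module_module _ _ _ f])
  show "(\<lambda>f. \<kappa> (free_lift R M e f)) \<in> linear_maps R (free_module R A) (free_module R A)"
    by (rule linear_comp[OF basis_coordsD(1)[OF c] free_lift_linear[OF M basis_coordsD(2)[OF c]]])
  show "(\<lambda>f. f) \<in> linear_maps R (free_module R A) (free_module R A)" by (rule linear_id)
  show "\<kappa> (free_lift R M e (free_gen R b)) = free_gen R b" if "b \<in> A" for b
    using free_lift_gen[OF M basis_coordsD(2)[OF c] that] basis_coordsD(4)[OF c that] by simp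
qed

lemma coords_inj:
  assumes M: "module R M" and c: "basis_coords R M A \<kappa> e"
    and "x \<in> carrier M" "y \<in> carrier M" "\<kappa> x = \<kappa> y"
  shows "x = y"
  by (rule linear_inj[OF basis_coordsD(1)[OF c] M free_module_module _ assms(3-5)])
    (simp add: free_zero basis_coordsD(5)[OF c])

lemma coords_expand:
  assumes M: "module R M" and c: "basis_coords R M A \<kappa> e" and x: "x \<in> carrier M"
  shows "free_lift R M e (\<kappa> x) = x"
proof (rule coords_inj[OF M c _ x])
  have k: "\<kappa> x \<in> carrier (free_module R A)" by (rule basis_coordsD(6)[OF c x])
  show "free_lift R M e (\<kappa> x) \<in> carrier M"
    by (rule linear_closed[OF free_lift_linear[OF M basis_coordsD(2)[OF c]] k])
  show "\<kappa> (free_lift R M e (\<kappa> x)) = \<kappa> x" by (rule coords_free_lift[OF M c k])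
qed

lemma coords_linear_eq:
  assumes M: "module R M" and Q: "module R Q" and c: "basis_coords R M A \<kappa> e"
    and g: "g \<in> linear_maps R M Q" and h: "h \<in> linear_maps R M Q"
    and eq: "\<And>b. b \<in> A \<Longrightarrow> g (e b) = h (e b)" and x: "x \<in> carrier M"
  shows "g x = h x"
proof -
  note l = free_lift_linear[OF M basis_coordsD(2)[OF c]]
  have "g (free_lift R M e (\<kappa> x)) = h (free_lift R M e (\<kappa> x))"
    by (rule linear_free_eq[OF Q linear_comp[OF g l] linear_comp[OF h l] _ basis_coordsD(6)[OF c x]])
      (simp add: free_lift_gen[OF M basis_coordsD(2)[OF c]] eq)
  then show ?thesis by (simp add: coords_expand[OF M c x])
qed

text \<open>Membership is required of the pieces \<open>\<kappa> x b \<odot> e b\<close> only, and \<open>N\<close> need not be a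
submodule: the lemma is applied to homogeneous components, which are not closed under scalars.\<close>

lemma coords_sum_in:
  assumes M: "module R M" and c: "basis_coords R M A \<kappa> e" and x: "x \<in> carrier M"
    and zero: "\<zero>\<^bsub>M\<^esub> \<in> N" and add: "\<And>x y. x \<in> N \<Longrightarrow> y \<in> N \<Longrightarrow> x \<oplus>\<^bsub>M\<^esub> y \<in> N"
    and e: "\<And>b. b \<in> A \<Longrightarrow> \<kappa> x b \<odot>\<^bsub>M\<^esub> e b \<in> N"
  shows "x \<in> N"
proof -
  interpret M: module R M by fact
  have k: "\<kappa> x \<in> carrier (free_module R A)" by (rule basis_coordsD(6)[OF c x])
  have "(\<Oplus>\<^bsub>M\<^esub>b\<in>S. \<kappa> x b \<odot>\<^bsub>M\<^esub> e b) \<in> N" if "finite S" "S \<subseteq> A" for S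
    using that
  proof (induction S rule: finite_induct)
    case empty
    then show ?case using zero by simp
  next
    case (insert b S)
    then have "(\<lambda>b. \<kappa> x b \<odot>\<^bsub>M\<^esub> e b) \<in> S \<rightarrow> carrier M" "\<kappa> x b \<odot>\<^bsub>M\<^esub> e b \<in> carrier M"
      using basis_coordsD(3,7)[OF c] x by (auto intro!: M.smult_closed)
    then show ?case using insert e add by (simp add: M.finsum_insert)
  qed
  moreover have "{b. \<kappa> x b \<noteq> \<zero>} \<subseteq> A" "finite {b. \<kappa> x b \<noteq> \<zero>}" using k by (auto simp: free_carrier)
  ultimately have "free_lift R M e (\<kappa> x) \<in> N" by (simp add: free_lift_def)
  then show ?thesis by (simp add: coords_expand[OF M c x])
qed

lemma is_basis_coords:
  assumes M: "module R M" and B: "is_basis R M B"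
  obtains \<kappa> where "basis_coords R M B \<kappa> (\<lambda>b. b)"
proof -
  have v: "(\<lambda>b. b) \<in> B \<rightarrow> carrier M" using B by (auto simp: is_basis_def)
  have ex1: "\<exists>!c. c \<in> carrier (free_module R B) \<and> x = free_lift R M (\<lambda>b. b) c" if "x \<in> carrier M" for x
    using B that unfolding is_basis_def free_lift_def by blast
  note l = free_lift_linear[OF M v]
  have inj: "inj_on (free_lift R M (\<lambda>b. b)) (carrier (free_module R B))"
    using ex1 linear_closed[OF l] unfolding inj_on_def by metis
  have surj: "free_lift R M (\<lambda>b. b) ` carrier (free_module R B) = carrier M"
    using ex1 linear_closed[OF l] by blast
  have "free_lift R M (\<lambda>b. b) \<in> linear_isos R (free_module R B) M"
    using l inj surj by (simp add: linear_isos_def bij_betw_def)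
  then obtain k where k: "k \<in> linear_isos R M (free_module R B)"
    "\<And>f. f \<in> carrier (free_module R B) \<Longrightarrow> k (free_lift R M (\<lambda>b. b) f) = f"
    "\<And>x. x \<in> carrier M \<Longrightarrow> free_lift R M (\<lambda>b. b) (k x) = x"
    using linear_iso_inverse[OF _ free_module_module M] by blast
  have "basis_coords R M B k (\<lambda>b. b)" unfolding basis_coords_def
  proof (intro conjI ballI impI)
    show "k \<in> linear_maps R M (free_module R B)" using k(1) by (simp add: linear_isos_def)
    show "k b = free_gen R b" if b: "b \<in> B" for b
      using k(2)[OF free_gen_closed[OF b]] free_lift_gen[OF M v b] by simp
    show "x = \<zero>\<^bsub>M\<^esub>" if "x \<in> carrier M" "k x = (\<lambda>_. \<zero>)" for x
      using k(3)[OF that(1)] that(2) linear_zero[OF l free_module_module M] by (simp add: free_zero)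
  qed (rule v)
  then show ?thesis by (rule that)
qed

lemma is_free_coords:
  assumes "is_free R M"
  obtains B \<kappa> where "basis_coords R M B \<kappa> (\<lambda>b. b)"
  using assms is_basis_coords unfolding is_free_def by metis

text \<open>The basis is \<open>e ` A\<close>. The coefficient functions on \<open>e ` A\<close> and on \<open>A\<close> correspond along \<open>e\<close>, which
is injective because the generators \<open>free_gen R b\<close> are distinct when \<open>\<one> \<noteq> \<zero>\<close>.\<close>

lemma coords_is_basis:
  assumes M: "module R M" and c: "basis_coords R M A \<kappa> e" and one: "\<one> \<noteq> \<zero>"
  shows "is_basis R M (e ` A)"
proof -
  note ce = basis_coordsD[OF c]
  let ?B = "e ` A"
  have inj: "inj_on e A"
  proof (rule inj_onI)
    fix a b assume ab: "a \<in> A" "b \<in> A" "e a = e b"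
    then have "free_gen R a = free_gen R b" using ce(4)[of a] ce(4)[of b] by simp
    then have "free_gen R a a = free_gen R b a" by simp
    then show "a = b" using one by (simp add: free_gen_def split: if_splits)
  qed
  define \<rho> where "\<rho> c = (\<lambda>b. if b \<in> A then c (e b) else \<zero>)" for c :: "_ \<Rightarrow> 'a"
  have rho_lin: "\<rho> \<in> linear_maps R (free_module R ?B) (free_module R A)"
  proof (rule linear_mapsI)
    fix c assume c: "c \<in> carrier (free_module R ?B)"
    have "finite (e -` {m. c m \<noteq> \<zero>} \<inter> A)"
      using c inj by (intro finite_vimage_IntI) (auto simp: free_carrier)
    then have "finite {b. \<rho> c b \<noteq> \<zero>}" by (rule rev_finite_subset) (auto simp: \<rho>_def split: if_splits)
    then show "\<rho> c \<in> carrier (free_module R A)" using c by (auto simp: free_carrier \<rho>_def)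
  qed (auto simp: \<rho>_def free_add free_smult)
  have rho_gen: "\<rho> (free_gen R (e b)) = free_gen R b" if "b \<in> A" for b
    using that inj by (auto simp: \<rho>_def free_gen_def inj_on_def)
  have rho_inj: "c = c'" if "c \<in> carrier (free_module R ?B)" "c' \<in> carrier (free_module R ?B)" "\<rho> c = \<rho> c'" for c c'
  proof
    fix m show "c m = c' m"
    proof (cases "m \<in> ?B")
      case True
      then obtain b where "b \<in> A" "m = e b" by blast
      then show ?thesis using fun_cong[OF that(3), of b] by (simp add: \<rho>_def)
    next
      case False then show ?thesis using that by (simp add: free_carrier)
    qed
  qed
  have lift_rho: "free_lift R M (\<lambda>m. m) c = free_lift R M e (\<rho> c)" if cc: "c \<in> carrier (free_module R ?B)" for c
  proof (rule linear_free_eq[OF M _ _ _ cc])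
    show "free_lift R M (\<lambda>m. m) \<in> linear_maps R (free_module R ?B) M"
      by (rule free_lift_linear[OF M]) (use ce in auto)
    show "(\<lambda>c. free_lift R M e (\<rho> c)) \<in> linear_maps R (free_module R ?B) M"
      by (rule linear_comp[OF free_lift_linear[OF M ce(2)] rho_lin])
    show "free_lift R M (\<lambda>m. m) (free_gen R m) = free_lift R M e (\<rho> (free_gen R m))" if "m \<in> ?B" for m
    proof -
      from that obtain b where b: "b \<in> A" "m = e b" by blast
      have "free_lift R M (\<lambda>m. m) (free_gen R m) = m"
        by (rule free_lift_gen[OF M _ that]) (use ce in auto)
      then show ?thesis using b free_lift_gen[OF M ce(2) b(1)] by (simp add: rho_gen)
    qed
  qed
  have rho_surj: "\<exists>c\<in>carrier (free_module R ?B). \<rho> c = f" if f: "f \<in> carrier (free_module R A)" for f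
  proof (rule bexI)
    let ?h = "free_lift R (free_module R ?B) (\<lambda>b. free_gen R (e b))"
    have v: "(\<lambda>b. free_gen R (e b)) \<in> A \<rightarrow> carrier (free_module R ?B)" by (auto intro: free_gen_closed)
    have hl: "?h \<in> linear_maps R (free_module R A) (free_module R ?B)"
      by (rule free_lift_linear[OF free_module_module v])
    show "?h f \<in> carrier (free_module R ?B)" by (rule linear_closed[OF hl f])
    show "\<rho> (?h f) = f"
      by (rule linear_free_eq[OF free_module_module linear_comp[OF rho_lin hl] linear_id _ f])
        (simp add: free_lift_gen[OF free_module_module v] rho_gen)
  qed
  have "\<exists>!c. c \<in> carrier (free_module R ?B) \<and> x = free_lift R M (\<lambda>m. m) c" if x: "x \<in> carrier M" for x
  proof -
    obtain c where cc: "c \<in> carrier (free_module R ?B)" "\<rho> c = \<kappa> x" using rho_surj[OF ce(6)[OF x]] by blast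
    show ?thesis
    proof (rule ex1I[of _ c])
      show "c \<in> carrier (free_module R ?B) \<and> x = free_lift R M (\<lambda>m. m) c"
        using cc lift_rho[OF cc(1)] coords_expand[OF M c x] by simp
      fix c' assume c': "c' \<in> carrier (free_module R ?B) \<and> x = free_lift R M (\<lambda>m. m) c'"
      then have "\<kappa> x = \<rho> c'"
        using lift_rho[of c'] coords_free_lift[OF M c linear_closed[OF rho_lin, of c']] by simp
      then show "c' = c" using cc c' by (intro rho_inj) auto
    qed
  qed
  then show ?thesis unfolding is_basis_def using ce(3) by (auto simp: free_lift_def)
qed

lemma coords_is_free:
  assumes "module R M" "basis_coords R M A \<kappa> e" "\<one> \<noteq> \<zero>" shows "is_free R M"
  using assms coords_is_basis unfolding is_free_def by blast

text \<open>Free modules are projective: choose preimages of the values on a basis and extend linearly. This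
is the step by which chain maps and homotopies are built.\<close>

lemma free_projective:
  assumes P: "is_free R P" and N: "module R N" and M: "module R M"
    and \<phi>: "\<phi> \<in> linear_maps R P N" and \<psi>: "\<psi> \<in> linear_maps R M N"
    and im: "\<And>x. x \<in> carrier P \<Longrightarrow> \<phi> x \<in> \<psi> ` carrier M"
  obtains \<theta> where "\<theta> \<in> linear_maps R P M" "\<And>x. x \<in> carrier P \<Longrightarrow> \<psi> (\<theta> x) = \<phi> x"
proof -
  have mP: "module R P" using P by (simp add: is_free_def)
  obtain A \<kappa> where c: "basis_coords R P A \<kappa> (\<lambda>b. b)" using is_free_coords[OF P] .
  note ce = basis_coordsD[OF c]
  define v where "v b = (SOME m. m \<in> carrier M \<and> \<psi> m = \<phi> b)" for b
  have vb: "v b \<in> carrier M \<and> \<psi> (v b) = \<phi> b" if "b \<in> A" for b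
  proof -
    have "\<exists>m. m \<in> carrier M \<and> \<psi> m = \<phi> b" using im[OF ce(3)[OF that]] by (auto simp: image_iff)
    then show ?thesis unfolding v_def by (rule someI_ex)
  qed
  then have v: "v \<in> A \<rightarrow> carrier M" by auto
  define \<theta> where "\<theta> x = free_lift R M v (\<kappa> x)" for x
  have t: "\<theta> \<in> linear_maps R P M"
    unfolding \<theta>_def by (rule linear_comp[OF free_lift_linear[OF M v] ce(1)])
  have "\<psi> (\<theta> x) = \<phi> x" if "x \<in> carrier P" for x
    by (rule coords_linear_eq[OF mP N c linear_comp[OF \<psi> t] \<phi> _ that])
      (simp add: \<theta>_def ce(4) free_lift_gen[OF M v] vb)
  then show ?thesis using t that by blast
qed

end

section \<open>Tensor products\<close>

definition bilinear_map ::
  "('a, 'r) ring_scheme \<Rightarrow> ('a, 'm) module \<Rightarrow> ('a, 'n) module \<Rightarrow> ('a, 'q) module \<Rightarrow> ('m \<Rightarrow> 'n \<Rightarrow> 'q) \<Rightarrow> bool" where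
  "bilinear_map R M N Q \<beta> \<longleftrightarrow>
     (\<forall>x\<in>carrier M. \<beta> x \<in> linear_maps R N Q) \<and>
     (\<forall>y\<in>carrier N. (\<lambda>x. \<beta> x y) \<in> linear_maps R M Q)"

context base_ring begin

lemma quot_eqI:
  fixes M :: "('a, 'm) module"
  assumes M: "module R M" and N: "submodule N R M" and u: "u \<in> carrier M" and v: "v \<in> carrier M"
    and d: "u \<ominus>\<^bsub>M\<^esub> v \<in> N"
  shows "N +>\<^bsub>M\<^esub> u = N +>\<^bsub>M\<^esub> v"
proof -
  interpret M: module R M by fact
  let ?Q = "quot_module M N" and ?p = "\<lambda>x. N +>\<^bsub>M\<^esub> x"
  interpret Q: module R ?Q by (rule quot_module_module[OF M N])
  note p = quot_proj_linear[OF M N]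
  have c: "?p u \<in> carrier ?Q" "?p v \<in> carrier ?Q" using linear_closed[OF p] u v by auto
  have uv: "u \<ominus>\<^bsub>M\<^esub> v \<in> carrier M" using u v by simp
  have "?p u \<ominus>\<^bsub>?Q\<^esub> ?p v = ?p (u \<ominus>\<^bsub>M\<^esub> v)"
    by (rule linear_minus[OF p M Q.module_axioms u v, symmetric])
  also have "\<dots> = \<zero>\<^bsub>?Q\<^esub>" using quot_zero_iff[OF M N uv] d by blast
  finally have 0: "?p u \<ominus>\<^bsub>?Q\<^esub> ?p v = \<zero>\<^bsub>?Q\<^esub>" .
  have "?p u = (?p u \<ominus>\<^bsub>?Q\<^esub> ?p v) \<oplus>\<^bsub>?Q\<^esub> ?p v"
    using c by (simp add: Q.minus_eq Q.a_assoc Q.l_neg)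
  also have "\<dots> = ?p v" unfolding 0 using c by simp
  finally show ?thesis .
qed

lemma bilinear_mapD:
  assumes "bilinear_map R M N Q \<beta>" "x \<in> carrier M" "y \<in> carrier N"
  shows "\<beta> x y \<in> carrier Q"
    "x' \<in> carrier M \<Longrightarrow> \<beta> (x \<oplus>\<^bsub>M\<^esub> x') y = \<beta> x y \<oplus>\<^bsub>Q\<^esub> \<beta> x' y"
    "y' \<in> carrier N \<Longrightarrow> \<beta> x (y \<oplus>\<^bsub>N\<^esub> y') = \<beta> x y \<oplus>\<^bsub>Q\<^esub> \<beta> x y'"
    "r \<in> carrier R \<Longrightarrow> \<beta> (r \<odot>\<^bsub>M\<^esub> x) y = r \<odot>\<^bsub>Q\<^esub> \<beta> x y"
    "r \<in> carrier R \<Longrightarrow> \<beta> x (r \<odot>\<^bsub>N\<^esub> y) = r \<odot>\<^bsub>Q\<^esub> \<beta> x y"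
  using assms linear_closed[of "\<beta> x" N Q y] linear_add[of "\<beta> x" N Q y y'] linear_smult[of "\<beta> x" N Q r y]
    linear_add[of "\<lambda>x. \<beta> x y" M Q x x'] linear_smult[of "\<lambda>x. \<beta> x y" M Q r x]
  by (auto simp: bilinear_map_def)

context
  fixes M :: "('a, 'm) module" and N :: "('a, 'n) module"
  assumes M: "module R M" and N: "module R N"
begin

interpretation M: module R M by (rule M)
interpretation N: module R N by (rule N)

private abbreviation "F \<equiv> free_module R (carrier M \<times> carrier N)"
private abbreviation "K \<equiv> tensor_relations R M N"
private abbreviation "\<delta> x y \<equiv> free_gen R (x, y)"
private abbreviation "T \<equiv> tensor R M N"

interpretation F: module R F by (rule free_module_module)

private lemma d_closed: "x \<in> carrier M \<Longrightarrow> y \<in> carrier N \<Longrightarrow> \<delta> x y \<in> carrier F"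
  by (rule free_gen_closed) simp

private definition "rels =
      ({\<delta> (x \<oplus>\<^bsub>M\<^esub> x') y \<ominus>\<^bsub>F\<^esub> (\<delta> x y \<oplus>\<^bsub>F\<^esub> \<delta> x' y) | x x' y.
          x \<in> carrier M \<and> x' \<in> carrier M \<and> y \<in> carrier N} \<union>
       {\<delta> x (y \<oplus>\<^bsub>N\<^esub> y') \<ominus>\<^bsub>F\<^esub> (\<delta> x y \<oplus>\<^bsub>F\<^esub> \<delta> x y') | x y y'.
          x \<in> carrier M \<and> y \<in> carrier N \<and> y' \<in> carrier N} \<union>
       {\<delta> (r \<odot>\<^bsub>M\<^esub> x) y \<ominus>\<^bsub>F\<^esub> r \<odot>\<^bsub>F\<^esub> \<delta> x y | r x y.
          r \<in> carrier R \<and> x \<in> carrier M \<and> y \<in> carrier N} \<union>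
       {\<delta> x (r \<odot>\<^bsub>N\<^esub> y) \<ominus>\<^bsub>F\<^esub> r \<odot>\<^bsub>F\<^esub> \<delta> x y | r x y.
          r \<in> carrier R \<and> x \<in> carrier M \<and> y \<in> carrier N})"

private lemma K_eq: "K = span_module R F rels"
  by (simp add: tensor_relations_def rels_def Let_def)

private lemma rels_sub: "rels \<subseteq> carrier F"
  unfolding rels_def by (auto intro!: F.minus_closed F.a_closed F.smult_closed d_closed)

private lemma K_sub: "submodule K R F"
  unfolding K_eq by (rule span_module_submodule[OF F.module_axioms rels_sub])

lemma tensor_module: "module R T"
  unfolding tensor_def by (rule quot_module_module[OF F.module_axioms K_sub])

private lemma proj_linear: "(\<lambda>f. K +>\<^bsub>F\<^esub> f) \<in> linear_maps R F T"
  unfolding tensor_def by (rule quot_proj_linear[OF F.module_axioms K_sub])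

lemma pure_closed: "x \<in> carrier M \<Longrightarrow> y \<in> carrier N \<Longrightarrow> pure_tensor R M N x y \<in> carrier T"
  unfolding pure_tensor_def by (rule linear_closed[OF proj_linear d_closed])

private lemma rel_eq:
  assumes "u \<in> carrier F" "v \<in> carrier F" "u \<ominus>\<^bsub>F\<^esub> v \<in> rels" shows "K +>\<^bsub>F\<^esub> u = K +>\<^bsub>F\<^esub> v"
  using assms span_module_base[of rels F]
  by (intro quot_eqI[OF F.module_axioms K_sub]) (auto simp: K_eq)

lemma pure_add_left:
  assumes "x \<in> carrier M" "x' \<in> carrier M" "y \<in> carrier N"
  shows "pure_tensor R M N (x \<oplus>\<^bsub>M\<^esub> x') y = pure_tensor R M N x y \<oplus>\<^bsub>T\<^esub> pure_tensor R M N x' y"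
proof -
  have "K +>\<^bsub>F\<^esub> \<delta> (x \<oplus>\<^bsub>M\<^esub> x') y = K +>\<^bsub>F\<^esub> (\<delta> x y \<oplus>\<^bsub>F\<^esub> \<delta> x' y)"
    by (rule rel_eq) (use assms in \<open>auto simp: rels_def intro!: d_closed F.a_closed\<close>)
  then show ?thesis
    using assms by (simp add: pure_tensor_def linear_add[OF proj_linear] d_closed)
qed

lemma pure_add_right:
  assumes "x \<in> carrier M" "y \<in> carrier N" "y' \<in> carrier N"
  shows "pure_tensor R M N x (y \<oplus>\<^bsub>N\<^esub> y') = pure_tensor R M N x y \<oplus>\<^bsub>T\<^esub> pure_tensor R M N x y'"
proof -
  have "K +>\<^bsub>F\<^esub> \<delta> x (y \<oplus>\<^bsub>N\<^esub> y') = K +>\<^bsub>F\<^esub> (\<delta> x y \<oplus>\<^bsub>F\<^esub> \<delta> x y')"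
    by (rule rel_eq) (use assms in \<open>auto simp: rels_def intro!: d_closed F.a_closed\<close>)
  then show ?thesis
    using assms by (simp add: pure_tensor_def linear_add[OF proj_linear] d_closed)
qed

lemma pure_smult_left:
  assumes "r \<in> carrier R" "x \<in> carrier M" "y \<in> carrier N"
  shows "pure_tensor R M N (r \<odot>\<^bsub>M\<^esub> x) y = r \<odot>\<^bsub>T\<^esub> pure_tensor R M N x y"
proof -
  have "K +>\<^bsub>F\<^esub> \<delta> (r \<odot>\<^bsub>M\<^esub> x) y = K +>\<^bsub>F\<^esub> (r \<odot>\<^bsub>F\<^esub> \<delta> x y)"
    by (rule rel_eq) (use assms in \<open>auto simp: rels_def intro!: d_closed F.smult_closed\<close>)
  then show ?thesis
    using assms by (simp add: pure_tensor_def linear_smult[OF proj_linear] d_closed)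
qed

lemma pure_smult_right:
  assumes "r \<in> carrier R" "x \<in> carrier M" "y \<in> carrier N"
  shows "pure_tensor R M N x (r \<odot>\<^bsub>N\<^esub> y) = r \<odot>\<^bsub>T\<^esub> pure_tensor R M N x y"
proof -
  have "K +>\<^bsub>F\<^esub> \<delta> x (r \<odot>\<^bsub>N\<^esub> y) = K +>\<^bsub>F\<^esub> (r \<odot>\<^bsub>F\<^esub> \<delta> x y)"
    by (rule rel_eq) (use assms in \<open>auto simp: rels_def intro!: d_closed F.smult_closed\<close>)
  then show ?thesis
    using assms by (simp add: pure_tensor_def linear_smult[OF proj_linear] d_closed)
qed

lemma pure_bilinear: "bilinear_map R M N T (pure_tensor R M N)"
  unfolding bilinear_map_def
  by (auto intro!: linear_mapsI simp: pure_closed pure_add_left pure_add_right pure_smult_left pure_smult_right)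

text \<open>Every scalar multiple of a pure tensor is pure, so addition is the only closure property that an
induction has to check. The zero element is the pure tensor of two zeros.\<close>

lemma tensor_induct [consumes 1, case_names pure add]:
  assumes z: "z \<in> carrier T"
    and pure: "\<And>x y. x \<in> carrier M \<Longrightarrow> y \<in> carrier N \<Longrightarrow> P (pure_tensor R M N x y)"
    and add: "\<And>z w. z \<in> carrier T \<Longrightarrow> w \<in> carrier T \<Longrightarrow> P z \<Longrightarrow> P w \<Longrightarrow> P (z \<oplus>\<^bsub>T\<^esub> w)"
  shows "P z"
proof -
  interpret T: module R T by (rule tensor_module)
  obtain f where f: "f \<in> carrier F" "z = K +>\<^bsub>F\<^esub> f"
    using z unfolding tensor_def quot_carrier[OF F.module_axioms K_sub] by blast
  have "P (K +>\<^bsub>F\<^esub> f)" using f(1)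
  proof (induction rule: free_induct)
    case zero
    have "pure_tensor R M N \<zero>\<^bsub>M\<^esub> \<zero>\<^bsub>N\<^esub> = \<zero> \<odot>\<^bsub>T\<^esub> pure_tensor R M N \<zero>\<^bsub>M\<^esub> \<zero>\<^bsub>N\<^esub>"
      using pure_smult_left[of \<zero> "\<zero>\<^bsub>M\<^esub>" "\<zero>\<^bsub>N\<^esub>"] by simp
    also have "\<dots> = \<zero>\<^bsub>T\<^esub>" by (simp add: pure_closed)
    also have "\<dots> = K +>\<^bsub>F\<^esub> (\<lambda>_. \<zero>)"
      using linear_zero[OF proj_linear F.module_axioms tensor_module] by (simp add: free_zero)
    finally show ?case using pure[of "\<zero>\<^bsub>M\<^esub>" "\<zero>\<^bsub>N\<^esub>"] by simp
  next
    case (step f r b)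
    obtain x y where b: "b = (x, y)" "x \<in> carrier M" "y \<in> carrier N" using step(3) by auto
    have d: "\<delta> x y \<in> carrier F" using b by (simp add: d_closed)
    have "K +>\<^bsub>F\<^esub> (r \<odot>\<^bsub>F\<^esub> free_gen R b \<oplus>\<^bsub>F\<^esub> f) = pure_tensor R M N (r \<odot>\<^bsub>M\<^esub> x) y \<oplus>\<^bsub>T\<^esub> (K +>\<^bsub>F\<^esub> f)"
      using b step(1,2) d
      by (simp add: linear_add[OF proj_linear] linear_smult[OF proj_linear] pure_smult_left)
        (simp add: pure_tensor_def)
    then show ?case using b step
      by (simp add: add pure pure_closed linear_closed[OF proj_linear])
  qed
  then show ?thesis using f by simp
qed

lemma linear_tensor_eq:
  assumes Q: "module R Q" and g: "g \<in> linear_maps R T Q" and h: "h \<in> linear_maps R T Q"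
    and "\<And>x y. x \<in> carrier M \<Longrightarrow> y \<in> carrier N \<Longrightarrow> g (pure_tensor R M N x y) = h (pure_tensor R M N x y)"
    and z: "z \<in> carrier T"
  shows "g z = h z"
  using z by (induction rule: tensor_induct) (simp_all add: assms(4) linear_add[OF g] linear_add[OF h])

text \<open>The universal property: the linear extension of \<open>\<beta>\<close> to the free module on pairs kills each of the
defining relations, hence their span. From here on the construction of the tensor product is
used only through this lemma, the induction rule and the bilinearity of pure tensors.\<close>

lemma tensor_lift:
  assumes Q: "module R Q" and \<beta>: "bilinear_map R M N Q \<beta>"
  obtains h where "h \<in> linear_maps R T Q"
    "\<And>x y. x \<in> carrier M \<Longrightarrow> y \<in> carrier N \<Longrightarrow> h (pure_tensor R M N x y) = \<beta> x y"
proof -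
  interpret Q: module R Q by fact
  let ?v = "\<lambda>(x, y). \<beta> x y"
  let ?h = "free_lift R Q ?v"
  note b = bilinear_mapD[OF \<beta>]
  have v: "?v \<in> carrier M \<times> carrier N \<rightarrow> carrier Q" using b(1) by auto
  have l: "?h \<in> linear_maps R F Q" by (rule free_lift_linear[OF Q v])
  have hd: "?h (\<delta> x y) = \<beta> x y" if "x \<in> carrier M" "y \<in> carrier N" for x y
    using free_lift_gen[OF Q v, of "(x, y)"] that by simp
  have hm: "?h (u \<ominus>\<^bsub>F\<^esub> w) = \<zero>\<^bsub>Q\<^esub>" if "u \<in> carrier F" "w \<in> carrier F" "?h u = ?h w" for u w
    using that linear_minus[OF l F.module_axioms Q that(1,2)] linear_closed[OF l that(2)]
    by (simp add: Q.minus_eq Q.r_neg)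
  have "rels \<subseteq> {f \<in> carrier F. ?h f = \<zero>\<^bsub>Q\<^esub>}"
    unfolding rels_def
    by (auto intro!: hm d_closed F.minus_closed F.a_closed F.smult_closed
        simp: hd linear_add[OF l] linear_smult[OF l] b d_closed)
  then have "K \<subseteq> {f \<in> carrier F. ?h f = \<zero>\<^bsub>Q\<^esub>}"
    unfolding K_eq by (rule span_module_minimal[OF kernel_submodule[OF l F.module_axioms Q]])
  then obtain g where g: "g \<in> linear_maps R T Q" "\<And>f. f \<in> carrier F \<Longrightarrow> g (K +>\<^bsub>F\<^esub> f) = ?h f"
    using quot_lift[OF F.module_axioms K_sub Q l] unfolding tensor_def by blast
  show ?thesis by (rule that[OF g(1)]) (simp add: pure_tensor_def g(2) d_closed hd)
qed

end

lemma bilinear_comp: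
  assumes "bilinear_map R M' N' Q \<beta>" "f \<in> linear_maps R M M'" "g \<in> linear_maps R N N'"
  shows "bilinear_map R M N Q (\<lambda>x y. \<beta> (f x) (g y))"
  unfolding bilinear_map_def
proof (intro conjI ballI)
  show "(\<lambda>y. \<beta> (f x) (g y)) \<in> linear_maps R N Q" if "x \<in> carrier M" for x
    using assms linear_closed[OF assms(2) that]
    by (intro linear_comp[where g="\<beta> (f x)" and h=g, OF _ assms(3)]) (simp add: bilinear_map_def)
  show "(\<lambda>x. \<beta> (f x) (g y)) \<in> linear_maps R M Q" if "y \<in> carrier N" for y
    using assms linear_closed[OF assms(3) that]
    by (intro linear_comp[where g="\<lambda>x. \<beta> x (g y)" and h=f, OF _ assms(2)]) (simp add: bilinear_map_def)
qed

lemma tensor_map_unique_ex: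
  assumes M: "module R M" and N: "module R N" and M': "module R M'" and N': "module R N'"
    and f: "f \<in> linear_maps R M M'" and g: "g \<in> linear_maps R N N'"
  shows "\<exists>!h. h \<in> linear_maps R (tensor R M N) (tensor R M' N') \<inter> extensional (carrier (tensor R M N)) \<and>
        (\<forall>x \<in> carrier M. \<forall>y \<in> carrier N. h (pure_tensor R M N x y) = pure_tensor R M' N' (f x) (g y))"
proof -
  note T = tensor_module[OF M N] and T' = tensor_module[OF M' N']
  obtain h where h: "h \<in> linear_maps R (tensor R M N) (tensor R M' N')"
    "\<And>x y. x \<in> carrier M \<Longrightarrow> y \<in> carrier N \<Longrightarrow> h (pure_tensor R M N x y) = pure_tensor R M' N' (f x) (g y)"
    by (rule tensor_lift[OF M N T' bilinear_comp[OF pure_bilinear[OF M' N'] f g]]) blast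
  let ?h = "restrict h (carrier (tensor R M N))"
  have hl: "?h \<in> linear_maps R (tensor R M N) (tensor R M' N')"
    by (rule linear_cong[OF h(1) T]) simp
  have he: "?h \<in> extensional (carrier (tensor R M N))" by (rule restrict_extensional)
  have hp: "?h (pure_tensor R M N x y) = pure_tensor R M' N' (f x) (g y)"
    if "x \<in> carrier M" "y \<in> carrier N" for x y
    using h(2)[OF that] pure_closed[OF M N that] by simp
  have uniq: "k = ?h" if k: "k \<in> linear_maps R (tensor R M N) (tensor R M' N')"
    and ke: "k \<in> extensional (carrier (tensor R M N))"
    and kp: "\<And>x y. x \<in> carrier M \<Longrightarrow> y \<in> carrier N \<Longrightarrow> k (pure_tensor R M N x y) = pure_tensor R M' N' (f x) (g y)"
  for k
  proof (rule extensionalityI[OF ke he])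
    fix z assume z: "z \<in> carrier (tensor R M N)"
    show "k z = ?h z"
      by (rule linear_tensor_eq[OF M N T' k hl _ z]) (simp only: kp hp)
  qed
  show ?thesis
  proof (rule ex1I)
    show "?h \<in> linear_maps R (tensor R M N) (tensor R M' N') \<inter> extensional (carrier (tensor R M N)) \<and>
        (\<forall>x \<in> carrier M. \<forall>y \<in> carrier N. ?h (pure_tensor R M N x y) = pure_tensor R M' N' (f x) (g y))"
      by (intro conjI IntI ballI hl he hp)
  next
    fix k
    assume k: "k \<in> linear_maps R (tensor R M N) (tensor R M' N') \<inter> extensional (carrier (tensor R M N)) \<and>
        (\<forall>x \<in> carrier M. \<forall>y \<in> carrier N. k (pure_tensor R M N x y) = pure_tensor R M' N' (f x) (g y))"
    show "k = ?h"
      by (rule uniq[OF IntD1[OF conjunct1[OF k]] IntD2[OF conjunct1[OF k]]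
          bspec[OF bspec[OF conjunct2[OF k]]]])
  qed
qed

context
  fixes M :: "('a, 'm) module" and N :: "('a, 'n) module"
    and M' :: "('a, 'm2) module" and N' :: "('a, 'n2) module" and f g
  assumes M: "module R M" and N: "module R N" and M': "module R M'" and N': "module R N'"
    and f: "f \<in> linear_maps R M M'" and g: "g \<in> linear_maps R N N'"
begin

lemma tensor_map_linear: "tensor_map R M N M' N' f g \<in> linear_maps R (tensor R M N) (tensor R M' N')"
  and tensor_map_pure: "x \<in> carrier M \<Longrightarrow> y \<in> carrier N \<Longrightarrow>
    tensor_map R M N M' N' f g (pure_tensor R M N x y) = pure_tensor R M' N' (f x) (g y)"
  using theI'[OF tensor_map_unique_ex[OF M N M' N' f g], folded tensor_map_def] by simp_all

end

lemma tensor_map_comp: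
  assumes M: "module R M" and N: "module R N" and M1: "module R M1" and N1: "module R N1"
    and M2: "module R M2" and N2: "module R N2"
    and f: "f \<in> linear_maps R M M1" and g: "g \<in> linear_maps R N N1"
    and f': "f' \<in> linear_maps R M1 M2" and g': "g' \<in> linear_maps R N1 N2"
    and z: "z \<in> carrier (tensor R M N)"
  shows "tensor_map R M1 N1 M2 N2 f' g' (tensor_map R M N M1 N1 f g z)
    = tensor_map R M N M2 N2 (\<lambda>x. f' (f x)) (\<lambda>y. g' (g y)) z"
  by (rule linear_tensor_eq[OF M N tensor_module[OF M2 N2]
        linear_comp[OF tensor_map_linear[OF M1 N1 M2 N2 f' g'] tensor_map_linear[OF M N M1 N1 f g]]
        tensor_map_linear[OF M N M2 N2 linear_comp[OF f' f] linear_comp[OF g' g]] _ z])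
    (simp add: tensor_map_pure[OF M N M1 N1 f g] tensor_map_pure[OF M1 N1 M2 N2 f' g']
      tensor_map_pure[OF M N M2 N2 linear_comp[OF f' f] linear_comp[OF g' g]]
      linear_closed[OF f] linear_closed[OF g])

lemma tensor_map_cong:
  assumes M: "module R M" and N: "module R N" and M': "module R M'" and N': "module R N'"
    and f: "f \<in> linear_maps R M M'" and g: "g \<in> linear_maps R N N'"
    and f': "f' \<in> linear_maps R M M'" and g': "g' \<in> linear_maps R N N'"
    and ef: "\<And>x. x \<in> carrier M \<Longrightarrow> f x = f' x" and eg: "\<And>y. y \<in> carrier N \<Longrightarrow> g y = g' y"
    and z: "z \<in> carrier (tensor R M N)"
  shows "tensor_map R M N M' N' f g z = tensor_map R M N M' N' f' g' z"
  by (rule linear_tensor_eq[OF M N tensor_module[OF M' N'] tensor_map_linear[OF M N M' N' f g]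
        tensor_map_linear[OF M N M' N' f' g'] _ z])
    (simp add: tensor_map_pure[OF M N M' N' f g] tensor_map_pure[OF M N M' N' f' g'] ef eg)

lemma pure_zero_left:
  assumes M: "module R M" and N: "module R N" and y: "y \<in> carrier N"
  shows "pure_tensor R M N \<zero>\<^bsub>M\<^esub> y = \<zero>\<^bsub>tensor R M N\<^esub>"
proof -
  have "(\<lambda>x. pure_tensor R M N x y) \<in> linear_maps R M (tensor R M N)"
    using pure_bilinear[OF M N] y by (simp add: bilinear_map_def)
  from linear_zero[OF this M tensor_module[OF M N]] show ?thesis .
qed

lemma pure_zero_right:
  assumes M: "module R M" and N: "module R N" and x: "x \<in> carrier M"
  shows "pure_tensor R M N x \<zero>\<^bsub>N\<^esub> = \<zero>\<^bsub>tensor R M N\<^esub>"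
proof -
  have "pure_tensor R M N x \<in> linear_maps R N (tensor R M N)"
    using pure_bilinear[OF M N] x by (simp add: bilinear_map_def)
  from linear_zero[OF this N tensor_module[OF M N]] show ?thesis .
qed

lemma tensor_map_zero:
  assumes M: "module R M" and N: "module R N" and M': "module R M'" and N': "module R N'"
    and f: "f \<in> linear_maps R M M'" and g: "g \<in> linear_maps R N N'"
    and 0: "(\<forall>x\<in>carrier M. f x = \<zero>\<^bsub>M'\<^esub>) \<or> (\<forall>y\<in>carrier N. g y = \<zero>\<^bsub>N'\<^esub>)"
    and z: "z \<in> carrier (tensor R M N)"
  shows "tensor_map R M N M' N' f g z = \<zero>\<^bsub>tensor R M' N'\<^esub>"
proof (rule linear_tensor_eq[OF M N tensor_module[OF M' N'] tensor_map_linear[OF M N M' N' f g]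
        linear_null[OF tensor_module[OF M' N']] _ z])
  fix x y assume "x \<in> carrier M" "y \<in> carrier N"
  then show "tensor_map R M N M' N' f g (pure_tensor R M N x y) = \<zero>\<^bsub>tensor R M' N'\<^esub>"
    using 0 by (auto simp: tensor_map_pure[OF M N M' N' f g] pure_zero_left[OF M' N'] pure_zero_right[OF M' N']
        linear_closed[OF f] linear_closed[OF g])
qed

text \<open>The image is a submodule, and it contains all pure tensors.\<close>

lemma tensor_map_surj:
  assumes M: "module R M" and N: "module R N" and M': "module R M'" and N': "module R N'"
    and f: "f \<in> linear_maps R M M'" and g: "g \<in> linear_maps R N N'"
    and sf: "f ` carrier M = carrier M'" and sg: "g ` carrier N = carrier N'"
    and z: "z \<in> carrier (tensor R M' N')"
  shows "z \<in> tensor_map R M N M' N' f g ` carrier (tensor R M N)"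
  using z
proof (induction rule: tensor_induct[OF M' N', consumes 1, case_names pure add])
  case (pure x y)
  then obtain a b where "a \<in> carrier M" "x = f a" "b \<in> carrier N" "y = g b" using sf sg by blast
  then show ?case
    using tensor_map_pure[OF M N M' N' f g, of a b] pure_closed[OF M N, of a b] by (auto intro: image_eqI)
next
  case (add z w)
  note sub = linear_image_submodule[OF tensor_map_linear[OF M N M' N' f g] tensor_module[OF M N] tensor_module[OF M' N']]
  show ?case by (rule module.submoduleE(5)[OF tensor_module[OF M' N'] sub add(3,4)])
qed

section \<open>Tensor products with free modules\<close>

text \<open>The slice at \<open>b\<close> is the map \<open>P \<otimes> N \<rightarrow> N\<close> induced by the \<open>b\<close>-th coordinate of \<open>P\<close>. The slices identify
\<open>P \<otimes> N\<close> with the finitely supported families in \<open>N\<close>.\<close>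

lemma tensor_slice:
  assumes P: "module R P" and N: "module R N" and c: "basis_coords R P A \<kappa> e"
  obtains s where "\<And>b. s b \<in> linear_maps R (tensor R P N) N"
    "\<And>b x y. x \<in> carrier P \<Longrightarrow> y \<in> carrier N \<Longrightarrow> s b (pure_tensor R P N x y) = \<kappa> x b \<odot>\<^bsub>N\<^esub> y"
proof -
  interpret P: module R P by fact
  interpret N: module R N by fact
  note ce = basis_coordsD[OF c]
  have "\<exists>h. h \<in> linear_maps R (tensor R P N) N \<and>
     (\<forall>x\<in>carrier P. \<forall>y\<in>carrier N. h (pure_tensor R P N x y) = \<kappa> x b \<odot>\<^bsub>N\<^esub> y)" for b
  proof -
    have "bilinear_map R P N N (\<lambda>x y. \<kappa> x b \<odot>\<^bsub>N\<^esub> y)"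
      unfolding bilinear_map_def
      by (auto intro!: linear_mapsI linear_scale[OF N linear_id] simp: ce(7) linear_add[OF ce(1)]
          linear_smult[OF ce(1)] free_add free_smult N.smult_l_distr N.smult_assoc1)
    then show ?thesis using tensor_lift[OF P N N] by metis
  qed
  then obtain s where "\<And>b. s b \<in> linear_maps R (tensor R P N) N \<and>
     (\<forall>x\<in>carrier P. \<forall>y\<in>carrier N. s b (pure_tensor R P N x y) = \<kappa> x b \<odot>\<^bsub>N\<^esub> y)"
    by metis
  then show ?thesis using that by blast
qed

text \<open>The support of the slices must be part of the statement, since the sum of two tensors is expanded
over the union of their supports and the added terms have to vanish.\<close>

lemma tensor_slice_expand:
  assumes P: "module R P" and N: "module R N" and c: "basis_coords R P A \<kappa> e"
    and s: "\<And>b. s b \<in> linear_maps R (tensor R P N) N"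
      "\<And>b x y. x \<in> carrier P \<Longrightarrow> y \<in> carrier N \<Longrightarrow> s b (pure_tensor R P N x y) = \<kappa> x b \<odot>\<^bsub>N\<^esub> y"
    and z: "z \<in> carrier (tensor R P N)"
  shows "\<exists>S. finite S \<and> S \<subseteq> A \<and> (\<forall>b. b \<notin> S \<longrightarrow> s b z = \<zero>\<^bsub>N\<^esub>) \<and>
    z = (\<Oplus>\<^bsub>tensor R P N\<^esub>b\<in>S. pure_tensor R P N (e b) (s b z))"
proof -
  interpret P: module R P by fact
  interpret N: module R N by fact
  note ce = basis_coordsD[OF c]
  show ?thesis using z
  proof (induction rule: tensor_induct[OF P N, consumes 1, case_names pure add])
    case (pure x y)
    let ?S = "{b. \<kappa> x b \<noteq> \<zero>}"
    have S: "finite ?S" "?S \<subseteq> A" using ce(6)[OF pure(1)] by (auto simp: free_carrier)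
    have pl: "(\<lambda>x. pure_tensor R P N x y) \<in> linear_maps R P (tensor R P N)"
      using pure_bilinear[OF P N] pure by (simp add: bilinear_map_def)
    have "pure_tensor R P N x y = pure_tensor R P N (\<Oplus>\<^bsub>P\<^esub>b\<in>?S. \<kappa> x b \<odot>\<^bsub>P\<^esub> e b) y"
      using coords_expand[OF P c pure(1)] by (simp add: free_lift_def)
    also have "\<dots> = (\<Oplus>\<^bsub>tensor R P N\<^esub>b\<in>?S. pure_tensor R P N (\<kappa> x b \<odot>\<^bsub>P\<^esub> e b) y)"
      by (rule linear_finsum[OF pl P tensor_module[OF P N]]) (use S pure ce(3,7) in auto)
    also have "\<dots> = (\<Oplus>\<^bsub>tensor R P N\<^esub>b\<in>?S. pure_tensor R P N (e b) (s b (pure_tensor R P N x y)))"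
    proof -
      interpret T: module R "tensor R P N" by (rule tensor_module[OF P N])
      show ?thesis
      proof (rule T.add.finprod_cong')
        show "(\<lambda>b. pure_tensor R P N (e b) (s b (pure_tensor R P N x y))) \<in> ?S \<rightarrow> carrier (tensor R P N)"
          using S pure ce(3) pure_closed[OF P N] linear_closed[OF s(1)] by auto
        show "pure_tensor R P N (\<kappa> x b \<odot>\<^bsub>P\<^esub> e b) y = pure_tensor R P N (e b) (s b (pure_tensor R P N x y))"
          if "b \<in> ?S" for b
        proof -
          have "b \<in> A" using that S by auto
          then show ?thesis
            using pure ce(3)[of b] ce(7)[OF pure(1), of b]
            by (simp add: s(2) pure_smult_left[OF P N] pure_smult_right[OF P N])
        qed
      qed simp
    qed
    finally have eq: "pure_tensor R P N x y = (\<Oplus>\<^bsub>tensor R P N\<^esub>b\<in>?S. pure_tensor R P N (e b) (s b (pure_tensor R P N x y)))" .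
    have "s b (pure_tensor R P N x y) = \<zero>\<^bsub>N\<^esub>" if "b \<notin> ?S" for b
      using that pure by (simp add: s(2))
    then show ?case using S eq by blast
  next
    case (add z w)
    interpret T: module R "tensor R P N" by (rule tensor_module[OF P N])
    obtain S1 where S1: "finite S1" "S1 \<subseteq> A" "\<And>b. b \<notin> S1 \<Longrightarrow> s b z = \<zero>\<^bsub>N\<^esub>"
      "z = (\<Oplus>\<^bsub>tensor R P N\<^esub>b\<in>S1. pure_tensor R P N (e b) (s b z))" using add(3) by blast
    obtain S2 where S2: "finite S2" "S2 \<subseteq> A" "\<And>b. b \<notin> S2 \<Longrightarrow> s b w = \<zero>\<^bsub>N\<^esub>"
      "w = (\<Oplus>\<^bsub>tensor R P N\<^esub>b\<in>S2. pure_tensor R P N (e b) (s b w))" using add(4) by blast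
    let ?S = "S1 \<union> S2"
    have ext: "v = (\<Oplus>\<^bsub>tensor R P N\<^esub>b\<in>?S. pure_tensor R P N (e b) (s b v))"
      if v: "v \<in> carrier (tensor R P N)" "v = (\<Oplus>\<^bsub>tensor R P N\<^esub>b\<in>U. pure_tensor R P N (e b) (s b v))"
        "U \<subseteq> ?S" "\<And>b. b \<notin> U \<Longrightarrow> s b v = \<zero>\<^bsub>N\<^esub>" for v U
    proof -
      have "(\<Oplus>\<^bsub>tensor R P N\<^esub>b\<in>U. pure_tensor R P N (e b) (s b v)) = (\<Oplus>\<^bsub>tensor R P N\<^esub>b\<in>?S. pure_tensor R P N (e b) (s b v))"
      proof (rule T.add.finprod_mono_neutral_cong_left)
        show "pure_tensor R P N (e b) (s b v) = \<zero>\<^bsub>tensor R P N\<^esub>" if "b \<in> ?S - U" for b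
        proof -
          have "e b \<in> carrier P" using that S1(2) S2(2) ce(3) by auto
          then show ?thesis using that v(4)[of b] by (simp add: pure_zero_right[OF P N])
        qed
        show "(\<lambda>b. pure_tensor R P N (e b) (s b v)) \<in> ?S \<rightarrow> carrier (tensor R P N)"
          using S1(2) S2(2) v(1) ce(3) pure_closed[OF P N] linear_closed[OF s(1)] by auto
      qed (use S1(1) S2(1) v(3) in auto)
      then show ?thesis using v(2) by simp
    qed
    have "z \<oplus>\<^bsub>tensor R P N\<^esub> w = (\<Oplus>\<^bsub>tensor R P N\<^esub>b\<in>?S. pure_tensor R P N (e b) (s b z)) \<oplus>\<^bsub>tensor R P N\<^esub>
         (\<Oplus>\<^bsub>tensor R P N\<^esub>b\<in>?S. pure_tensor R P N (e b) (s b w))"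
      using ext[OF add(1) S1(4)] ext[OF add(2) S2(4)] S1(3) S2(3) by auto
    also have "\<dots> = (\<Oplus>\<^bsub>tensor R P N\<^esub>b\<in>?S. pure_tensor R P N (e b) (s b z) \<oplus>\<^bsub>tensor R P N\<^esub> pure_tensor R P N (e b) (s b w))"
      by (rule T.finsum_addf[symmetric])
        (use S1(2) S2(2) add(1,2) ce(3) pure_closed[OF P N] linear_closed[OF s(1)] in auto)
    also have "\<dots> = (\<Oplus>\<^bsub>tensor R P N\<^esub>b\<in>?S. pure_tensor R P N (e b) (s b (z \<oplus>\<^bsub>tensor R P N\<^esub> w)))"
    proof (rule T.add.finprod_cong')
      show "(\<lambda>b. pure_tensor R P N (e b) (s b (z \<oplus>\<^bsub>tensor R P N\<^esub> w))) \<in> ?S \<rightarrow> carrier (tensor R P N)"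
        using S1(2) S2(2) add(1,2) ce(3) pure_closed[OF P N] linear_closed[OF s(1)] by auto
      show "pure_tensor R P N (e b) (s b z) \<oplus>\<^bsub>tensor R P N\<^esub> pure_tensor R P N (e b) (s b w)
        = pure_tensor R P N (e b) (s b (z \<oplus>\<^bsub>tensor R P N\<^esub> w))" if "b \<in> ?S" for b
      proof -
        have "b \<in> A" using that S1 S2 by auto
        then show ?thesis using add(1,2) ce(3)
          by (simp add: linear_add[OF s(1)] pure_add_right[OF P N] linear_closed[OF s(1)])
      qed
    qed simp
    finally have eq: "z \<oplus>\<^bsub>tensor R P N\<^esub> w = (\<Oplus>\<^bsub>tensor R P N\<^esub>b\<in>?S. pure_tensor R P N (e b) (s b (z \<oplus>\<^bsub>tensor R P N\<^esub> w)))" .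
    have "s b (z \<oplus>\<^bsub>tensor R P N\<^esub> w) = \<zero>\<^bsub>N\<^esub>" if "b \<notin> ?S" for b
      using that S1(3)[of b] S2(3)[of b] add(1,2) by (simp add: linear_add[OF s(1)])
    then show ?case using S1(1,2) S2(1,2) eq by (intro exI[of _ ?S]) blast
  qed
qed

text \<open>Flatness of free modules. If \<open>1 \<otimes> \<psi>\<close> kills \<open>z\<close>, then \<open>\<psi>\<close> kills every slice of \<open>z\<close>, so every slice has a
preimage under \<open>\<phi>\<close>, and \<open>z\<close> is reassembled from its slices.\<close>

lemma free_tensor_exact:
  assumes P: "is_free R P" and N1: "module R N1" and N2: "module R N2" and N3: "module R N3"
    and \<phi>: "\<phi> \<in> linear_maps R N1 N2" and \<psi>: "\<psi> \<in> linear_maps R N2 N3"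
    and ex: "\<And>y. y \<in> carrier N2 \<Longrightarrow> \<psi> y = \<zero>\<^bsub>N3\<^esub> \<Longrightarrow> y \<in> \<phi> ` carrier N1"
    and z: "z \<in> carrier (tensor R P N2)"
    and z0: "tensor_map R P N2 P N3 (\<lambda>x. x) \<psi> z = \<zero>\<^bsub>tensor R P N3\<^esub>"
  shows "z \<in> tensor_map R P N1 P N2 (\<lambda>x. x) \<phi> ` carrier (tensor R P N1)"
proof -
  have mP: "module R P" using P by (simp add: is_free_def)
  obtain A \<kappa> where c: "basis_coords R P A \<kappa> (\<lambda>b. b)" using is_free_coords[OF P] .
  note ce = basis_coordsD[OF c]
  obtain s where s: "\<And>b. s b \<in> linear_maps R (tensor R P N2) N2"
    "\<And>b x y. x \<in> carrier P \<Longrightarrow> y \<in> carrier N2 \<Longrightarrow> s b (pure_tensor R P N2 x y) = \<kappa> x b \<odot>\<^bsub>N2\<^esub> y"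
    by (rule tensor_slice[OF mP N2 c]) blast
  obtain t where t: "\<And>b. t b \<in> linear_maps R (tensor R P N3) N3"
    "\<And>b x y. x \<in> carrier P \<Longrightarrow> y \<in> carrier N3 \<Longrightarrow> t b (pure_tensor R P N3 x y) = \<kappa> x b \<odot>\<^bsub>N3\<^esub> y"
    by (rule tensor_slice[OF mP N3 c]) blast
  note tl = tensor_map_linear[OF mP N2 mP N3 linear_id \<psi>]
  have nat: "\<psi> (s b z) = t b (tensor_map R P N2 P N3 (\<lambda>x. x) \<psi> z)" for b
    by (rule linear_tensor_eq[OF mP N2 N3 linear_comp[OF \<psi> s(1)] linear_comp[OF t(1) tl] _ z])
      (simp add: s(2) t(2) tensor_map_pure[OF mP N2 mP N3 linear_id \<psi>] linear_closed[OF \<psi>]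
        linear_smult[OF \<psi>] ce(7))
  have im: "s b z \<in> \<phi> ` carrier N1" for b
    using ex[OF linear_closed[OF s(1) z]] nat[of b] z0 linear_zero[OF t(1) tensor_module[OF mP N3] N3] by simp
  let ?W = "tensor_map R P N1 P N2 (\<lambda>x. x) \<phi> ` carrier (tensor R P N1)"
  interpret T: module R "tensor R P N2" by (rule tensor_module[OF mP N2])
  have W: "submodule ?W R (tensor R P N2)"
    by (rule linear_image_submodule[OF tensor_map_linear[OF mP N1 mP N2 linear_id \<phi>]
          tensor_module[OF mP N1] tensor_module[OF mP N2]])
  obtain S where S: "finite S" "S \<subseteq> A" "z = (\<Oplus>\<^bsub>tensor R P N2\<^esub>b\<in>S. pure_tensor R P N2 b (s b z))"
    using tensor_slice_expand[OF mP N2 c s z] by blast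
  have pW: "pure_tensor R P N2 b (s b z) \<in> ?W" if "b \<in> A" for b
  proof -
    obtain y where y: "y \<in> carrier N1" "s b z = \<phi> y" using im[of b] by blast
    have "pure_tensor R P N2 b (s b z) = tensor_map R P N1 P N2 (\<lambda>x. x) \<phi> (pure_tensor R P N1 b y)"
      using y ce(3)[OF that] by (simp add: tensor_map_pure[OF mP N1 mP N2 linear_id \<phi>])
    then show ?thesis using pure_closed[OF mP N1 ce(3)[OF that] y(1)] by (rule image_eqI)
  qed
  have "(\<Oplus>\<^bsub>tensor R P N2\<^esub>b\<in>U. pure_tensor R P N2 b (s b z)) \<in> ?W" if "finite U" "U \<subseteq> A" for U
    using that
  proof (induction U rule: finite_induct)
    case empty
    then show ?case using subgroup.one_closed[OF submodule.axioms(1)[OF W]] by simp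
  next
    case (insert b U)
    have "(\<lambda>b. pure_tensor R P N2 b (s b z)) \<in> U \<rightarrow> carrier (tensor R P N2)"
      "pure_tensor R P N2 b (s b z) \<in> carrier (tensor R P N2)"
      using insert ce(3) pure_closed[OF mP N2] linear_closed[OF s(1) z] by auto
    then show ?case using insert pW T.submoduleE(5)[OF W] by (simp add: T.finsum_insert)
  qed
  from this[OF S(1,2)] show ?thesis using S(3) by simp
qed

text \<open>The coordinate map comes from the universal property. It has trivial kernel because a tensor is
recovered from its coordinates: this is linear in the tensor, so it suffices to check it on pure
tensors, and then on pure tensors of basis elements, one factor at a time.\<close>

lemma tensor_coords:
  assumes M: "module R M" and N: "module R N"
    and c: "basis_coords R M A \<kappa> e" and c': "basis_coords R N B \<mu> d"
  obtains \<nu> where "basis_coords R (tensor R M N) (A \<times> B) \<nu> (\<lambda>(a, b). pure_tensor R M N (e a) (d b))"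
    "\<And>x y a b. x \<in> carrier M \<Longrightarrow> y \<in> carrier N \<Longrightarrow> \<nu> (pure_tensor R M N x y) (a, b) = \<kappa> x a \<otimes> \<mu> y b"
proof -
  let ?F = "free_module R (A \<times> B)" and ?T = "tensor R M N"
  let ?e = "\<lambda>(a, b). pure_tensor R M N (e a) (d b)"
  note ce = basis_coordsD[OF c] and cd = basis_coordsD[OF c']
  note T = tensor_module[OF M N] and F = free_module_module[of "A \<times> B"]
  let ?\<beta> = "\<lambda>x y. (\<lambda>(a, b). \<kappa> x a \<otimes> \<mu> y b)"
  have bc: "?\<beta> x y \<in> carrier ?F" if "x \<in> carrier M" "y \<in> carrier N" for x y
  proof -
    have "finite ({a. \<kappa> x a \<noteq> \<zero>} \<times> {b. \<mu> y b \<noteq> \<zero>})"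
      using ce(6)[OF that(1)] cd(6)[OF that(2)] by (simp add: free_carrier)
    then have "finite {p. ?\<beta> x y p \<noteq> \<zero>}"
      by (rule rev_finite_subset) (use ce(7)[OF that(1)] cd(7)[OF that(2)] in auto)
    then show ?thesis using ce(6)[OF that(1)] cd(6)[OF that(2)] by (auto simp: free_carrier)
  qed
  have "bilinear_map R M N ?F ?\<beta>"
    unfolding bilinear_map_def
    by (intro conjI ballI linear_mapsI)
      (auto simp: bc ce(7) cd(7) linear_add[OF ce(1)] linear_add[OF cd(1)] linear_smult[OF ce(1)]
        linear_smult[OF cd(1)] free_add free_smult fun_eq_iff l_distr r_distr m_assoc m_lcomm)
  then obtain \<nu> where n: "\<nu> \<in> linear_maps R ?T ?F"
    "\<And>x y. x \<in> carrier M \<Longrightarrow> y \<in> carrier N \<Longrightarrow> \<nu> (pure_tensor R M N x y) = ?\<beta> x y"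
    using tensor_lift[OF M N F] by blast
  have ec: "?e \<in> A \<times> B \<rightarrow> carrier ?T" using ce(3) cd(3) pure_closed[OF M N] by auto
  have ne: "\<nu> (?e p) = free_gen R p" if p: "p \<in> A \<times> B" for p
  proof -
    obtain a b where "p = (a, b)" "a \<in> A" "b \<in> B" using p by blast
    then show ?thesis using ce(3,4)[of a] cd(3,4)[of b] by (simp add: n(2) free_gen_def fun_eq_iff)
  qed
  have pl: "(\<lambda>x. pure_tensor R M N x y) \<in> linear_maps R M ?T" if "y \<in> carrier N" for y
    using pure_bilinear[OF M N] that by (simp add: bilinear_map_def)
  have pr: "pure_tensor R M N x \<in> linear_maps R N ?T" if "x \<in> carrier M" for x
    using pure_bilinear[OF M N] that by (simp add: bilinear_map_def)
  let ?L = "\<lambda>z. free_lift R ?T ?e (\<nu> z)"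
  have Ll: "?L \<in> linear_maps R ?T ?T"
    by (rule linear_comp[OF free_lift_linear[OF T ec] n(1)])
  have L1: "?L (pure_tensor R M N (e a) (d b)) = pure_tensor R M N (e a) (d b)" if "a \<in> A" "b \<in> B" for a b
    using ne[of "(a, b)"] free_lift_gen[OF T ec, of "(a, b)"] that by simp
  have L2: "?L (pure_tensor R M N x (d b)) = pure_tensor R M N x (d b)" if "x \<in> carrier M" "b \<in> B" for x b
    using coords_linear_eq[OF M T c linear_comp[OF Ll pl[OF cd(3)[OF that(2)]]] pl[OF cd(3)[OF that(2)]] _ that(1)]
      L1 that(2) by simp
  have L3: "?L (pure_tensor R M N x y) = pure_tensor R M N x y" if "x \<in> carrier M" "y \<in> carrier N" for x y
    using coords_linear_eq[OF N T c' linear_comp[OF Ll pr[OF that(1)]] pr[OF that(1)] _ that(2)]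
      L2 that(1) by simp
  have L4: "?L z = z" if "z \<in> carrier ?T" for z
    by (rule linear_tensor_eq[OF M N T Ll linear_id L3 that])
  have "basis_coords R ?T (A \<times> B) \<nu> ?e" unfolding basis_coords_def
  proof (intro conjI ballI impI)
    show "x = \<zero>\<^bsub>?T\<^esub>" if "x \<in> carrier ?T" "\<nu> x = (\<lambda>_. \<zero>)" for x
      using L4[OF that(1)] that(2) linear_zero[OF free_lift_linear[OF T ec] F T] by (simp add: free_zero)
  qed (use n(1) ec ne in auto)
  then show ?thesis by (rule that) (simp add: n(2))
qed

section \<open>Tensoring with a free module of rank one\<close>

lemma regular_module_module: "module R (regular_module R)"
proof (rule moduleI)
  show "abelian_group (regular_module R)"
    by (rule abelian_groupI) (auto simp: regular_module_def a_ac intro: l_neg)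
qed (auto simp: regular_module_def l_distr r_distr m_assoc is_cring)

lemma regular_simps [simp]:
  "carrier (regular_module R) = carrier R" "\<zero>\<^bsub>regular_module R\<^esub> = \<zero>"
  "x \<oplus>\<^bsub>regular_module R\<^esub> y = x \<oplus> y" "x \<odot>\<^bsub>regular_module R\<^esub> y = x \<otimes> y"
  by (simp_all add: regular_module_def)

lemma tensor_rank_one:
  assumes M: "module R M" and N: "module R N" and \<psi>: "\<psi> \<in> linear_maps R N (regular_module R)"
  obtains \<rho> where "\<rho> \<in> linear_maps R (tensor R M N) M"
    "\<And>x y. x \<in> carrier M \<Longrightarrow> y \<in> carrier N \<Longrightarrow> \<rho> (pure_tensor R M N x y) = \<psi> y \<odot>\<^bsub>M\<^esub> x"
proof -
  interpret M: module R M by fact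
  have pc: "\<psi> y \<in> carrier R" if "y \<in> carrier N" for y using linear_closed[OF \<psi> that] by simp
  have "bilinear_map R M N M (\<lambda>x y. \<psi> y \<odot>\<^bsub>M\<^esub> x)"
    unfolding bilinear_map_def
    by (auto intro!: linear_mapsI linear_scale[OF M linear_id] simp: pc linear_add[OF \<psi>] linear_smult[OF \<psi>]
        M.smult_l_distr M.smult_assoc1)
  then show ?thesis using tensor_lift[OF M N M] that by blast
qed

text \<open>If \<open>N\<close> is generated by \<open>\<psi> \<one>\<close>, all scalars can be moved to the left factor.\<close>

lemma tensor_rank_one_pure:
  assumes M: "module R M" and N: "module R N" and \<psi>: "\<psi> \<in> linear_isos R (regular_module R) N"
    and z: "z \<in> carrier (tensor R M N)"
  shows "\<exists>x\<in>carrier M. z = pure_tensor R M N x (\<psi> \<one>)"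
proof -
  interpret M: module R M by fact
  have pl: "\<psi> \<in> linear_maps R (regular_module R) N" and ps: "\<psi> ` carrier R = carrier N"
    using \<psi> by (auto simp: linear_isos_def bij_betw_def)
  have p1: "\<psi> \<one> \<in> carrier N" using linear_closed[OF pl, of \<one>] by simp
  show ?thesis using z
  proof (induction rule: tensor_induct[OF M N, consumes 1, case_names pure add])
    case (pure x y)
    then obtain r where r: "r \<in> carrier R" "y = \<psi> r" using ps by blast
    then have "y = r \<odot>\<^bsub>N\<^esub> \<psi> \<one>" using linear_smult[OF pl, of r \<one>] by simp
    then have "pure_tensor R M N x y = pure_tensor R M N (r \<odot>\<^bsub>M\<^esub> x) (\<psi> \<one>)"
      using r pure p1 by (simp add: pure_smult_left[OF M N] pure_smult_right[OF M N])
    then show ?case using r pure by blast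
  next
    case (add z w)
    then obtain x x' where "x \<in> carrier M" "z = pure_tensor R M N x (\<psi> \<one>)"
      "x' \<in> carrier M" "w = pure_tensor R M N x' (\<psi> \<one>)" by blast
    then show ?case using pure_add_left[OF M N _ _ p1, of x x'] by (metis M.a_closed)
  qed
qed

end

section \<open>Free resolutions\<close>

primrec syz_word :: "('a, 'r) ring_scheme \<Rightarrow> ('a \<times> 's) list \<Rightarrow> 's \<Rightarrow> 'a" where
  "syz_word R [] = (\<lambda>_. \<zero>\<^bsub>R\<^esub>)"
| "syz_word R (p # l) = (\<lambda>t. fst p \<otimes>\<^bsub>R\<^esub> free_gen R (snd p) t \<oplus>\<^bsub>R\<^esub> syz_word R l t)"

definition syz_gen_value :: "('a, 'm) module \<Rightarrow> ('a, 'm) syz_name \<Rightarrow> 'm" where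
  "syz_gen_value M s = (case s of Gen x \<Rightarrow> x | Syz l \<Rightarrow> \<zero>\<^bsub>M\<^esub>)"

definition syz_bd_value :: "('a, 'r) ring_scheme \<Rightarrow> ('a, 'm) syz_name \<Rightarrow> ('a, 'm) syz_name \<Rightarrow> 'a" where
  "syz_bd_value R s = (case s of Gen x \<Rightarrow> (\<lambda>_. \<zero>\<^bsub>R\<^esub>) | Syz l \<Rightarrow> syz_word R l)"

definition syz_aug :: "('a, 'r) ring_scheme \<Rightarrow> ('a, 'm) module \<Rightarrow> (('a, 'm) syz_name \<Rightarrow> 'a) \<Rightarrow> 'm" where
  "syz_aug R M = free_lift R M (syz_gen_value M)"

definition syz_bd ::
  "('a, 'r) ring_scheme \<Rightarrow> (('a, 'm) syz_name \<Rightarrow> 'a) \<Rightarrow> ('a, 'm) syz_name \<Rightarrow> 'a" where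
  "syz_bd R = free_lift R (free_module R UNIV) (syz_bd_value R)"

text \<open>A cycle is named by a list that spells it, so there is one name for every spelling of every cycle.
The resolution is wasteful, but its names live in a type that is fixed in advance.\<close>

primrec syz_names :: "('a, 'r) ring_scheme \<Rightarrow> ('a, 'm) module \<Rightarrow> nat \<Rightarrow> ('a, 'm) syz_name set" where
  "syz_names R M 0 = Gen ` carrier M"
| "syz_names R M (Suc n) = {Syz l | l. set l \<subseteq> carrier R \<times> syz_names R M n \<and>
     (if n = 0 then syz_aug R M (syz_word R l) = \<zero>\<^bsub>M\<^esub> else syz_bd R (syz_word R l) = (\<lambda>_. \<zero>\<^bsub>R\<^esub>))}"

text \<open>The differential \<open>syz_bd\<close> does not depend on the degree: it sends a name to the element that the
name spells.\<close>

definition syz_resolution ::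
  "('a, 'r) ring_scheme \<Rightarrow> ('a, 'm) module \<Rightarrow> ('a, ('a, 'm) syz_name \<Rightarrow> 'a) cplx" where
  "syz_resolution R M =
     \<lparr>component = (\<lambda>n. free_module R (if n < 0 then {} else syz_names R M (nat n))),
      bd = (\<lambda>n. if n \<le> 0 then (\<lambda>_ _. \<zero>\<^bsub>R\<^esub>) else syz_bd R)\<rparr>"

context base_ring begin

lemma free_module_is_free:
  assumes "\<one> \<noteq> \<zero>" shows "is_free R (free_module R A)"
proof (rule coords_is_free[OF free_module_module _ assms])
  show "basis_coords R (free_module R A) A (\<lambda>f. f) (free_gen R)"
    by (auto simp: basis_coords_def linear_id free_gen_closed free_zero)
qed

lemma free_module_mono: "A \<subseteq> B \<Longrightarrow> f \<in> carrier (free_module R A) \<Longrightarrow> f \<in> carrier (free_module R B)"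
  by (auto simp: free_carrier)

lemma syz_word_closed:
  "set l \<subseteq> carrier R \<times> A \<Longrightarrow> syz_word R l \<in> carrier (free_module R A)"
proof (induction l)
  case Nil
  then show ?case by (simp add: free_carrier)
next
  case (Cons p l)
  interpret F: module R "free_module R A" by (rule free_module_module)
  have p: "fst p \<in> carrier R" "snd p \<in> A" using Cons.prems by auto
  have "fst p \<odot>\<^bsub>free_module R A\<^esub> free_gen R (snd p) \<oplus>\<^bsub>free_module R A\<^esub> syz_word R l \<in> carrier (free_module R A)"
    using p Cons by (intro F.a_closed F.smult_closed free_gen_closed) auto
  then show ?case by (simp add: free_add free_smult)
qed

lemma syz_word_surj:
  assumes "f \<in> carrier (free_module R A)"
  shows "\<exists>l. set l \<subseteq> carrier R \<times> A \<and> syz_word R l = f"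
  using assms
proof (induction rule: free_induct)
  case zero
  show ?case by (intro exI[of _ "[]"]) simp
next
  case (step f r b)
  then obtain l where "set l \<subseteq> carrier R \<times> A" "syz_word R l = f" by blast
  then show ?case using step by (intro exI[of _ "(r, b) # l"]) (simp add: free_add free_smult)
qed

lemma syz_bd_value_closed:
  assumes "s \<in> syz_names R M (Suc n)"
  shows "syz_bd_value R s \<in> carrier (free_module R (syz_names R M n))"
  using assms by (auto simp: syz_bd_value_def syz_word_closed)

lemma syz_bd_gen:
  assumes "s \<in> syz_names R M (Suc n)" shows "syz_bd R (free_gen R s) = syz_bd_value R s"
  unfolding syz_bd_def
  by (rule free_lift_gen[OF free_module_module _ assms])
    (use syz_bd_value_closed free_module_mono[OF subset_UNIV] in blast)

text \<open>The map \<open>syz_bd\<close> is defined with values in the free module on all names; a name of degree \<open>n + 1\<close>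
is sent to a combination of names of degree \<open>n\<close>, so the values lie where they should.\<close>

lemma syz_bd_linear:
  "syz_bd R \<in> linear_maps R (free_module R (syz_names R M (Suc n))) (free_module R (syz_names R M n))"
proof -
  let ?A = "syz_names R M (Suc n)" and ?B = "syz_names R M n"
  have v: "syz_bd_value R \<in> ?A \<rightarrow> carrier (free_module R UNIV)"
    using syz_bd_value_closed free_module_mono[OF subset_UNIV] by blast
  have l: "syz_bd R \<in> linear_maps R (free_module R ?A) (free_module R UNIV)"
    unfolding syz_bd_def by (rule free_lift_linear[OF free_module_module v])
  interpret A: module R "free_module R ?A" by (rule free_module_module)
  interpret B: module R "free_module R ?B" by (rule free_module_module)
  have "syz_bd R f \<in> carrier (free_module R ?B)" if "f \<in> carrier (free_module R ?A)" for f
    using that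
  proof (induction rule: free_induct)
    case zero
    show ?case using linear_zero[OF l free_module_module free_module_module] by (simp add: free_carrier free_zero)
  next
    case (step f r b)
    have "syz_bd R (r \<odot>\<^bsub>free_module R ?A\<^esub> free_gen R b \<oplus>\<^bsub>free_module R ?A\<^esub> f)
      = r \<odot>\<^bsub>free_module R UNIV\<^esub> syz_bd R (free_gen R b) \<oplus>\<^bsub>free_module R UNIV\<^esub> syz_bd R f"
      using step free_gen_closed[OF step(3)]
      by (simp add: linear_add[OF l] linear_smult[OF l] del: syz_names.simps)
    also have "\<dots> = r \<odot>\<^bsub>free_module R ?B\<^esub> syz_bd_value R b \<oplus>\<^bsub>free_module R ?B\<^esub> syz_bd R f"
      using syz_bd_gen[OF step(3)] by (simp add: free_add free_smult)
    also have "\<dots> \<in> carrier (free_module R ?B)"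
      using step syz_bd_value_closed[OF step(3)] by (intro B.a_closed B.smult_closed)
    finally show ?case .
  qed
  then show ?thesis using l by (auto simp: linear_maps_def hom_def free_add free_smult)
qed

text \<open>Exactness is built into the names: a cycle \<open>f\<close> of degree \<open>n\<close> is spelled by some list \<open>l\<close>, which is
then the name \<open>Syz l\<close> of degree \<open>n + 1\<close>, and the boundary of this generator is \<open>f\<close>. The existence
of a resolution with these names is what gives the choice in \<^const>\<open>Tor\<close> a meaning.\<close>

lemma syz_resolution_is_free_resolution:
  assumes M: "module R M" and one: "\<one> \<noteq> \<zero>"
  shows "free_resolution R (syz_resolution R M) M"
proof -
  let ?F = "syz_resolution R M" and ?N = "syz_names R M"
  interpret M: module R M by fact
  have comp: "component ?F (int n) = free_module R (?N n)" for n by (simp add: syz_resolution_def)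
  have compneg: "component ?F n = free_module R {}" if "n < 0" for n
    using that by (simp add: syz_resolution_def)
  have bdpos: "bd ?F n = syz_bd R" if "n \<ge> 1" for n using that by (simp add: syz_resolution_def)
  have bdneg: "bd ?F n = (\<lambda>_ _. \<zero>)" if "n \<le> 0" for n using that by (simp add: syz_resolution_def)
  have mod: "module R (component ?F n)" for n by (simp add: syz_resolution_def free_module_module)
  have zero: "\<zero>\<^bsub>component ?F n\<^esub> = (\<lambda>_. \<zero>)" for n by (simp add: syz_resolution_def free_zero)
  have nonneg: "\<exists>m. n = int m + 1" if "n \<ge> 1" for n :: int
    using that by (intro exI[of _ "nat (n - 1)"]) simp
  have comp1: "component ?F (int n + 1) = free_module R (?N (Suc n))" for n
    using comp[of "Suc n"] by (simp add: add.commute)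
  have vM: "syz_gen_value M \<in> ?N 0 \<rightarrow> carrier M" by (auto simp: syz_gen_value_def)
  have augl: "syz_aug R M \<in> linear_maps R (free_module R (?N 0)) M"
    unfolding syz_aug_def by (rule free_lift_linear[OF M vM])
  have lin: "bd ?F n \<in> linear_maps R (component ?F n) (component ?F (n - 1))" for n
  proof (cases "n \<ge> 1")
    case True
    then obtain m where m: "n = int m + 1" using nonneg by blast
    show ?thesis using syz_bd_linear[of M m] bdpos[OF True] by (simp add: m comp comp1)
  next
    case False
    then show ?thesis using linear_null[OF mod[of "n - 1"], of "component ?F n"] by (simp add: bdneg zero)
  qed
  have augbd: "syz_aug R M (syz_bd R f) = \<zero>\<^bsub>M\<^esub>" if f: "f \<in> carrier (free_module R (?N (Suc 0)))" for f
  proof (rule linear_free_eq[OF M linear_comp[OF augl syz_bd_linear] linear_null[OF M] _ f])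
    show "syz_aug R M (syz_bd R (free_gen R s)) = \<zero>\<^bsub>M\<^esub>" if "s \<in> ?N (Suc 0)" for s
      using that syz_bd_gen[OF that] by (auto simp: syz_bd_value_def)
  qed
  have bdbd: "syz_bd R (syz_bd R f) = (\<lambda>_. \<zero>)" if f: "f \<in> carrier (free_module R (?N (Suc (Suc n))))" for f n
  proof (rule linear_free_eq[OF free_module_module linear_comp[OF syz_bd_linear syz_bd_linear] _ _ f])
    show "(\<lambda>_ _. \<zero>) \<in> linear_maps R (free_module R (?N (Suc (Suc n)))) (free_module R (?N n))"
      using linear_null[OF free_module_module] by (simp add: free_zero)
    show "syz_bd R (syz_bd R (free_gen R s)) = (\<lambda>_. \<zero>)" if "s \<in> ?N (Suc (Suc n))" for s
      using that syz_bd_gen[OF that] by (auto simp: syz_bd_value_def)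
  qed
  have dd: "bd ?F (n - 1) (bd ?F n x) = \<zero>\<^bsub>component ?F (n - 2)\<^esub>" if "x \<in> carrier (component ?F n)" for n x
  proof (cases "n \<ge> 2")
    case True
    then obtain m where m: "n = int m + 2"
      using that zero_le_imp_eq_int[of "n - 2"] by (metis True diff_ge_0_iff_ge diff_add_cancel)
    have "component ?F n = free_module R (?N (Suc (Suc m)))"
      using comp[of "Suc (Suc m)"] m by (simp add: add.commute)
    then show ?thesis using bdbd[of x m] that True by (simp add: bdpos zero)
  next
    case False then show ?thesis by (simp add: bdneg zero)
  qed
  have cplx: "is_complex R ?F" unfolding is_complex_def using mod lin dd by blast
  have exact: "cycles ?F n = boundaries ?F n" if n: "n \<ge> 1" for n
  proof
    show "boundaries ?F n \<subseteq> cycles ?F n"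
      using dd[of _ "n + 1"] linear_closed[OF lin[of "n + 1"]] by (auto simp: boundaries_def cycles_def)
    show "cycles ?F n \<subseteq> boundaries ?F n"
    proof
      fix f assume f: "f \<in> cycles ?F n"
      obtain m where m: "n = int m + 1" using nonneg[OF n] by blast
      have fc: "f \<in> carrier (free_module R (?N (Suc m)))" using f by (simp add: cycles_def m comp1)
      have f0: "syz_bd R f = (\<lambda>_. \<zero>)" using f by (simp add: cycles_def bdpos[OF n] zero)
      obtain l where l: "set l \<subseteq> carrier R \<times> ?N (Suc m)" "syz_word R l = f" using syz_word_surj[OF fc] by blast
      then have s: "Syz l \<in> ?N (Suc (Suc m))" using f0 by (simp only: syz_names.simps(2)[of R M "Suc m"]) auto
      have "f = bd ?F (n + 1) (free_gen R (Syz l))"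
        using syz_bd_gen[OF s] n l(2) by (simp add: bdpos syz_bd_value_def)
      moreover have "free_gen R (Syz l) \<in> carrier (component ?F (n + 1))"
        using free_gen_closed[OF s] comp[of "Suc (Suc m)"] m by (simp add: add.commute)
      ultimately show "f \<in> boundaries ?F n" unfolding boundaries_def by (rule image_eqI)
    qed
  qed
  have "is_augmentation R ?F M (syz_aug R M)"
    unfolding is_augmentation_def
  proof (intro conjI)
    show "syz_aug R M \<in> linear_maps R (component ?F 0) M" using augl comp[of 0] by simp
    show "syz_aug R M ` carrier (component ?F 0) = carrier M"
    proof
      show "syz_aug R M ` carrier (component ?F 0) \<subseteq> carrier M"
        using linear_closed[OF augl] comp[of 0] by auto
      show "carrier M \<subseteq> syz_aug R M ` carrier (component ?F 0)"
      proof
        fix x assume x: "x \<in> carrier M"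
        then have g: "Gen x \<in> ?N 0" by simp
        have "syz_aug R M (free_gen R (Gen x)) = x"
          unfolding syz_aug_def using free_lift_gen[OF M vM g] by (simp add: syz_gen_value_def)
        then show "x \<in> syz_aug R M ` carrier (component ?F 0)"
          using free_gen_closed[OF g] comp[of 0] by (metis image_eqI of_nat_0)
      qed
    qed
    show "{x \<in> carrier (component ?F 0). syz_aug R M x = \<zero>\<^bsub>M\<^esub>} = boundaries ?F 0"
    proof
      show "boundaries ?F 0 \<subseteq> {x \<in> carrier (component ?F 0). syz_aug R M x = \<zero>\<^bsub>M\<^esub>}"
        using augbd linear_closed[OF syz_bd_linear[of M 0]] comp1[of 0] comp[of 0]
        by (auto simp: boundaries_def bdpos)
      show "{x \<in> carrier (component ?F 0). syz_aug R M x = \<zero>\<^bsub>M\<^esub>} \<subseteq> boundaries ?F 0"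
      proof
        fix f assume "f \<in> {x \<in> carrier (component ?F 0). syz_aug R M x = \<zero>\<^bsub>M\<^esub>}"
        then have f: "f \<in> carrier (free_module R (?N 0))" "syz_aug R M f = \<zero>\<^bsub>M\<^esub>" using comp[of 0] by auto
        obtain l where l: "set l \<subseteq> carrier R \<times> ?N 0" "syz_word R l = f" using syz_word_surj[OF f(1)] by blast
        then have s: "Syz l \<in> ?N (Suc 0)" using f(2) by (simp only: syz_names.simps(2)[of R M 0]) auto
        have "f = bd ?F (0 + 1) (free_gen R (Syz l))"
          using syz_bd_gen[OF s] l(2) by (simp add: bdpos syz_bd_value_def)
        moreover have "free_gen R (Syz l) \<in> carrier (component ?F (0 + 1))"
          using free_gen_closed[OF s] comp1[of 0] by simp
        ultimately show "f \<in> boundaries ?F 0" unfolding boundaries_def by (rule image_eqI)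
      qed
    qed
  qed
  moreover have "\<forall>n. is_free R (component ?F n)"
    by (simp add: syz_resolution_def free_module_is_free[OF one])
  moreover have "\<forall>n<0. carrier (component ?F n) = {\<zero>\<^bsub>component ?F n\<^esub>}"
    by (auto simp: compneg free_zero free_carrier)
  ultimately show ?thesis unfolding free_resolution_def using cplx exact by blast
qed

section \<open>The comparison theorem\<close>

lemma is_complexD:
  assumes "is_complex R C"
  shows "module R (component C n)" "bd C n \<in> linear_maps R (component C n) (component C (n - 1))"
    "x \<in> carrier (component C n) \<Longrightarrow> bd C (n - 1) (bd C n x) = \<zero>\<^bsub>component C (n - 2)\<^esub>"
  using assms by (auto simp: is_complex_def)

lemma complex_bd_up:
  assumes "is_complex R C"
  shows "bd C (n + 1) \<in> linear_maps R (component C (n + 1)) (component C n)"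
    "x \<in> carrier (component C (n + 1)) \<Longrightarrow> bd C n (bd C (n + 1) x) = \<zero>\<^bsub>component C (n - 1)\<^esub>"
  using is_complexD(2)[OF assms, of "n + 1"] is_complexD(3)[OF assms, where n="n + 1"] by simp_all

lemma free_resolutionD:
  assumes "free_resolution R F M"
  shows "is_complex R F" "is_free R (component F n)"
    "n < 0 \<Longrightarrow> carrier (component F n) = {\<zero>\<^bsub>component F n\<^esub>}"
    "n \<ge> 1 \<Longrightarrow> x \<in> carrier (component F n) \<Longrightarrow> bd F n x = \<zero>\<^bsub>component F (n - 1)\<^esub> \<Longrightarrow>
      x \<in> bd F (n + 1) ` carrier (component F (n + 1))"
    "\<exists>\<epsilon>. is_augmentation R F M \<epsilon>"
proof -
  show "is_complex R F" "is_free R (component F n)" "\<exists>\<epsilon>. is_augmentation R F M \<epsilon>"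
    using assms unfolding free_resolution_def by blast+
  show "carrier (component F n) = {\<zero>\<^bsub>component F n\<^esub>}" if "n < 0"
    using assms that unfolding free_resolution_def by blast
  show "x \<in> bd F (n + 1) ` carrier (component F (n + 1))"
    if n: "n \<ge> 1" and "x \<in> carrier (component F n)" "bd F n x = \<zero>\<^bsub>component F (n - 1)\<^esub>"
  proof -
    have "x \<in> cycles F n" using that by (simp add: cycles_def)
    moreover have "cycles F n = boundaries F n" using assms n unfolding free_resolution_def by blast
    ultimately show ?thesis by (simp add: boundaries_def)
  qed
qed

text \<open>The maps are chosen degree by degree. The invariant that keeps the recursion going is that the
map constructed so far sends boundaries to boundaries; the next map then exists because
\<open>component F (n + 1)\<close> is free.\<close>

lemma chain_map_lift:
  assumes M: "module R M"
    and F: "is_complex R F" and freeF: "\<And>n. is_free R (component F n)"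
    and eF: "\<epsilon> \<in> linear_maps R (component F 0) M"
    and eF0: "\<And>x. x \<in> carrier (component F 1) \<Longrightarrow> \<epsilon> (bd F 1 x) = \<zero>\<^bsub>M\<^esub>"
    and E: "free_resolution R E M" and eX: "is_augmentation R E M \<eta>"
  obtains f where
    "\<And>n. f n \<in> linear_maps R (component F (int n)) (component E (int n))"
    "\<And>x. x \<in> carrier (component F 0) \<Longrightarrow> \<eta> (f 0 x) = \<epsilon> x"
    "\<And>n x. x \<in> carrier (component F (int n + 1)) \<Longrightarrow>
       bd E (int n + 1) (f (Suc n) x) = f n (bd F (int n + 1) x)"
proof -
  note cF = is_complexD[OF F] and cF' = complex_bd_up[OF F]
  note rX = free_resolutionD[OF E]
  note cX = is_complexD[OF rX(1)] and cX' = complex_bd_up[OF rX(1)]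
  have eta: "\<eta> \<in> linear_maps R (component E 0) M" "\<eta> ` carrier (component E 0) = carrier M"
    "\<And>x. x \<in> carrier (component E 0) \<Longrightarrow> \<eta> x = \<zero>\<^bsub>M\<^esub> \<Longrightarrow> x \<in> boundaries E 0"
    using eX unfolding is_augmentation_def by auto
  define P where "P n h \<longleftrightarrow> h \<in> linear_maps R (component F (int n)) (component E (int n)) \<and>
     (\<forall>x\<in>carrier (component F (int n + 1)). h (bd F (int n + 1) x) \<in> boundaries E (int n)) \<and>
     (n = 0 \<longrightarrow> (\<forall>x\<in>carrier (component F 0). \<eta> (h x) = \<epsilon> x))" for n h
  define Q where "Q n h h' \<longleftrightarrow> (\<forall>x\<in>carrier (component F (int n + 1)).
       bd E (int n + 1) (h' x) = h (bd F (int n + 1) x))" for n :: nat and h h'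
  have "\<exists>f. \<forall>n. P n (f n) \<and> Q n (f n) (f (Suc n))"
  proof (rule dependent_nat_choice)
    obtain h where h: "h \<in> linear_maps R (component F 0) (component E 0)"
      "\<And>x. x \<in> carrier (component F 0) \<Longrightarrow> \<eta> (h x) = \<epsilon> x"
      using free_projective[OF freeF M cX(1) eF eta(1)] linear_closed[OF eF] eta(2) by blast
    have "h (bd F 1 x) \<in> boundaries E 0" if x: "x \<in> carrier (component F 1)" for x
    proof -
      have b: "bd F 1 x \<in> carrier (component F 0)" using linear_closed[OF cF'(1)[of 0]] x by simp
      show ?thesis using eta(3)[OF linear_closed[OF h(1) b]] h(2)[OF b] eF0[OF x] by simp
    qed
    then show "\<exists>h. P 0 h" using h by (intro exI[of _ h]) (simp add: P_def)
  next
    fix h n assume "P n h"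
    then have h: "h \<in> linear_maps R (component F (int n)) (component E (int n))"
      and hb: "\<And>x. x \<in> carrier (component F (int n + 1)) \<Longrightarrow> h (bd F (int n + 1) x) \<in> boundaries E (int n)"
      by (auto simp: P_def)
    obtain h' where h': "h' \<in> linear_maps R (component F (int n + 1)) (component E (int n + 1))"
      "\<And>x. x \<in> carrier (component F (int n + 1)) \<Longrightarrow> bd E (int n + 1) (h' x) = h (bd F (int n + 1) x)"
      using free_projective[OF freeF cX(1) cX(1) linear_comp[OF h cF'(1)] cX'(1)] hb
      unfolding boundaries_def by blast
    have "h' (bd F (int n + 1 + 1) x) \<in> boundaries E (int n + 1)"
      if x: "x \<in> carrier (component F (int n + 1 + 1))" for x
    proof -
      have b: "bd F (int n + 1 + 1) x \<in> carrier (component F (int n + 1))"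
        by (rule linear_closed[OF cF'(1) x])
      have "bd E (int n + 1) (h' (bd F (int n + 1 + 1) x)) = h (bd F (int n + 1) (bd F (int n + 1 + 1) x))"
        by (rule h'(2)[OF b])
      also have "\<dots> = h \<zero>\<^bsub>component F (int n)\<^esub>" using cF'(2)[OF x] by simp
      also have "\<dots> = \<zero>\<^bsub>component E (int n)\<^esub>" by (rule linear_zero[OF h cF(1) cX(1)])
      finally show ?thesis using rX(4)[of "int n + 1", OF _ linear_closed[OF h'(1) b]]
        unfolding boundaries_def by simp
    qed
    then have "P (Suc n) h'" using h'(1) by (simp add: P_def add.commute)
    moreover have "Q n h h'" using h'(2) by (simp add: Q_def)
    ultimately show "\<exists>h'. P (Suc n) h' \<and> Q n h h'" by blast
  qed
  then obtain f where "\<And>n. P n (f n)" "\<And>n. Q n (f n) (f (Suc n))" by blast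
  then show ?thesis by (intro that[of f]) (auto simp: P_def Q_def)
qed

text \<open>The same recursion as for chain maps. The invariant says that \<open>k - h \<partial>\<close> takes values in the
boundaries, which holds because its values are cycles and \<open>E\<close> is exact.\<close>

lemma chain_null_homotopy:
  assumes M: "module R M"
    and F: "is_complex R F" and freeF: "\<And>n. is_free R (component F n)"
    and E: "free_resolution R E M" and eX: "is_augmentation R E M \<eta>"
    and k: "\<And>n. k n \<in> linear_maps R (component F (int n)) (component E (int n))"
    and k0: "\<And>x. x \<in> carrier (component F 0) \<Longrightarrow> \<eta> (k 0 x) = \<zero>\<^bsub>M\<^esub>"
    and kd: "\<And>n x. x \<in> carrier (component F (int n + 1)) \<Longrightarrow>
       bd E (int n + 1) (k (Suc n) x) = k n (bd F (int n + 1) x)"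
  obtains h where
    "\<And>n. h n \<in> linear_maps R (component F (int n)) (component E (int n + 1))"
    "\<And>n x. x \<in> carrier (component F (int n + 1)) \<Longrightarrow>
       bd E (int n + 2) (h (Suc n) x) = k (Suc n) x \<ominus>\<^bsub>component E (int n + 1)\<^esub> h n (bd F (int n + 1) x)"
proof -
  note cF = is_complexD[OF F] and cF' = complex_bd_up[OF F]
  note rX = free_resolutionD[OF E]
  note cX = is_complexD[OF rX(1)] and cX' = complex_bd_up[OF rX(1)]
  have eta: "\<And>x. x \<in> carrier (component E 0) \<Longrightarrow> \<eta> x = \<zero>\<^bsub>M\<^esub> \<Longrightarrow> x \<in> boundaries E 0"
    using eX unfolding is_augmentation_def by auto
  have k1: "k (Suc n) \<in> linear_maps R (component F (int n + 1)) (component E (int n + 1))" for n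
    using k[of "Suc n"] by (simp add: add.commute)
  define diff where "diff n h x = k (Suc n) x \<ominus>\<^bsub>component E (int n + 1)\<^esub> h (bd F (int n + 1) x)" for n h x
  have diffl: "diff n h \<in> linear_maps R (component F (int n + 1)) (component E (int n + 1))"
    if h: "h \<in> linear_maps R (component F (int n)) (component E (int n + 1))" for n h
    unfolding diff_def[abs_def] a_minus_def
    by (rule linear_sum[OF cX(1) k1 linear_uminus[OF cX(1) linear_comp[OF h cF'(1)]]])
  define P where "P n h \<longleftrightarrow> h \<in> linear_maps R (component F (int n)) (component E (int n + 1)) \<and>
     (\<forall>x\<in>carrier (component F (int n + 1)). diff n h x \<in> boundaries E (int n + 1))" for n h
  define Q where "Q n h h' \<longleftrightarrow> (\<forall>x\<in>carrier (component F (int n + 1)).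
       bd E (int n + 1 + 1) (h' x) = diff n h x)" for n :: nat and h h'
  have step: "diff n h x \<in> boundaries E (int n + 1)"
    if h: "h \<in> linear_maps R (component F (int n)) (component E (int n + 1))"
      and x: "x \<in> carrier (component F (int n + 1))"
      and e: "bd E (int n + 1) (h (bd F (int n + 1) x)) = k n (bd F (int n + 1) x)" for n h x
  proof -
    interpret E: module R "component E (int n)" by (rule cX(1))
    have b: "bd F (int n + 1) x \<in> carrier (component F (int n))" by (rule linear_closed[OF cF'(1) x])
    have "bd E (int n + 1) (diff n h x)
        = bd E (int n + 1) (k (Suc n) x) \<ominus>\<^bsub>component E (int n)\<^esub> bd E (int n + 1) (h (bd F (int n + 1) x))"
      unfolding diff_def
      by (rule linear_minus[OF cX'(1) cX(1) cX(1) linear_closed[OF k1 x] linear_closed[OF h b]])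
    also have "\<dots> = k n (bd F (int n + 1) x) \<ominus>\<^bsub>component E (int n)\<^esub> k n (bd F (int n + 1) x)"
      using kd[OF x] e by simp
    also have "\<dots> = \<zero>\<^bsub>component E (int n)\<^esub>" using linear_closed[OF k b] by (simp add: E.minus_eq E.r_neg)
    finally show ?thesis using rX(4)[of "int n + 1", OF _ linear_closed[OF diffl[OF h] x]]
      unfolding boundaries_def by simp
  qed
  have "\<exists>f. \<forall>n. P n (f n) \<and> Q n (f n) (f (Suc n))"
  proof (rule dependent_nat_choice)
    have im: "k 0 x \<in> bd E (0 + 1) ` carrier (component E (0 + 1))" if "x \<in> carrier (component F 0)" for x
      using eta[of "k 0 x"] k0[OF that] linear_closed[OF k[of 0]] that unfolding boundaries_def by simp
    obtain h where h: "h \<in> linear_maps R (component F 0) (component E (0 + 1))"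
      "\<And>x. x \<in> carrier (component F 0) \<Longrightarrow> bd E (0 + 1) (h x) = k 0 x"
      using free_projective[OF freeF cX(1) cX(1) k[of 0, simplified] cX'(1)[of 0] im] by blast
    have "diff 0 h x \<in> boundaries E (int 0 + 1)" if x: "x \<in> carrier (component F (int 0 + 1))" for x
      using step[of h 0 x] h x linear_closed[OF cF'(1)[of 0], of x] by simp
    then show "\<exists>h. P 0 h" using h(1) by (intro exI[of _ h]) (simp add: P_def)
  next
    fix h n assume "P n h"
    then have h: "h \<in> linear_maps R (component F (int n)) (component E (int n + 1))"
      and hb: "\<And>x. x \<in> carrier (component F (int n + 1)) \<Longrightarrow> diff n h x \<in> boundaries E (int n + 1)"
      by (auto simp: P_def)
    obtain h' where h': "h' \<in> linear_maps R (component F (int n + 1)) (component E (int n + 1 + 1))"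
      "\<And>x. x \<in> carrier (component F (int n + 1)) \<Longrightarrow> bd E (int n + 1 + 1) (h' x) = diff n h x"
      using free_projective[OF freeF cX(1) cX(1) diffl[OF h] cX'(1)] hb
      unfolding boundaries_def by blast
    have "diff (Suc n) h' x \<in> boundaries E (int (Suc n) + 1)"
      if x: "x \<in> carrier (component F (int (Suc n) + 1))" for x
    proof (rule step[OF _ x])
      show "h' \<in> linear_maps R (component F (int (Suc n))) (component E (int (Suc n) + 1))"
        using h'(1) by (simp add: add.commute add.left_commute)
      have x2: "x \<in> carrier (component F (int n + 1 + 1))" using x by (simp add: add.commute add.left_commute)
      have b: "bd F (int n + 1 + 1) x \<in> carrier (component F (int n + 1))"
        by (rule linear_closed[OF cF'(1) x2])
      interpret E: module R "component E (int n + 1)" by (rule cX(1))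
      have "bd E (int n + 1 + 1) (h' (bd F (int n + 1 + 1) x)) = diff n h (bd F (int n + 1 + 1) x)"
        by (rule h'(2)[OF b])
      also have "\<dots> = k (Suc n) (bd F (int n + 1 + 1) x) \<ominus>\<^bsub>component E (int n + 1)\<^esub> h \<zero>\<^bsub>component F (int n)\<^esub>"
        using cF'(2)[OF x2] by (simp add: diff_def)
      also have "\<dots> = k (Suc n) (bd F (int n + 1 + 1) x)"
        using linear_zero[OF h cF(1) cX(1)] linear_closed[OF k1 b] by (simp add: E.minus_eq)
      finally show "bd E (int (Suc n) + 1) (h' (bd F (int (Suc n) + 1) x)) = k (Suc n) (bd F (int (Suc n) + 1) x)"
        by (simp add: add.commute add.left_commute)
    qed
    then have "P (Suc n) h'" using h'(1) by (simp add: P_def add.commute add.left_commute)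
    moreover have "Q n h h'" using h'(2) by (simp add: Q_def)
    ultimately show "\<exists>h'. P (Suc n) h' \<and> Q n h h'" by blast
  qed
  then obtain f where "\<And>n. P n (f n)" "\<And>n. Q n (f n) (f (Suc n))" by blast
  then show ?thesis by (intro that[of f]) (auto simp: P_def Q_def diff_def add.assoc)
qed

section \<open>Independence of Tor from the resolution\<close>

text \<open>Comparison maps \<open>f : F \<rightarrow> E\<close> and \<open>g : E \<rightarrow> F\<close> over the identity of \<open>M\<close> satisfy
\<open>1 = f g + \<partial> h + h \<partial>\<close> for some homotopy \<open>h\<close>. Tensoring this equation with \<open>N\<close> and applying it to
a cycle \<open>z\<close> kills the last term, and \<open>g z\<close> is a boundary by the hypothesis on \<open>F\<close>.\<close>

lemma tensor_exact_transfer: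
  assumes M: "module R M" and N: "module R N"
    and F: "free_resolution R F M" and E: "free_resolution R E M" and n: "n \<ge> 1"
    and ex: "cycles (tensor_cplx_module R F N) n \<subseteq> boundaries (tensor_cplx_module R F N) n"
  shows "cycles (tensor_cplx_module R E N) n \<subseteq> boundaries (tensor_cplx_module R E N) n"
proof
  fix z assume "z \<in> cycles (tensor_cplx_module R E N) n"
  note rF = free_resolutionD[OF F] and rE = free_resolutionD[OF E]
  note cF = is_complexD[OF rF(1)] and cF' = complex_bd_up[OF rF(1)]
  note cE = is_complexD[OF rE(1)] and cE' = complex_bd_up[OF rE(1)]
  obtain \<epsilon> where \<epsilon>: "is_augmentation R F M \<epsilon>" using rF(5) by blast
  obtain \<eta> where \<eta>: "is_augmentation R E M \<eta>" using rE(5) by blast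
  have \<epsilon>l: "\<epsilon> \<in> linear_maps R (component F 0) M" and \<eta>l: "\<eta> \<in> linear_maps R (component E 0) M"
    using \<epsilon> \<eta> by (auto simp: is_augmentation_def)
  have \<epsilon>0: "\<epsilon> (bd F 1 x) = \<zero>\<^bsub>M\<^esub>" if "x \<in> carrier (component F 1)" for x
    using \<epsilon> that unfolding is_augmentation_def boundaries_def by fastforce
  have \<eta>0: "\<eta> (bd E 1 x) = \<zero>\<^bsub>M\<^esub>" if "x \<in> carrier (component E 1)" for x
    using \<eta> that unfolding is_augmentation_def boundaries_def by fastforce
  obtain f where f: "\<And>n. f n \<in> linear_maps R (component F (int n)) (component E (int n))"
    "\<And>x. x \<in> carrier (component F 0) \<Longrightarrow> \<eta> (f 0 x) = \<epsilon> x"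
    "\<And>n x. x \<in> carrier (component F (int n + 1)) \<Longrightarrow> bd E (int n + 1) (f (Suc n) x) = f n (bd F (int n + 1) x)"
    by (rule chain_map_lift[OF M rF(1,2) \<epsilon>l \<epsilon>0 E \<eta>]) blast+
  obtain g where g: "\<And>n. g n \<in> linear_maps R (component E (int n)) (component F (int n))"
    "\<And>x. x \<in> carrier (component E 0) \<Longrightarrow> \<epsilon> (g 0 x) = \<eta> x"
    "\<And>n x. x \<in> carrier (component E (int n + 1)) \<Longrightarrow> bd F (int n + 1) (g (Suc n) x) = g n (bd E (int n + 1) x)"
    by (rule chain_map_lift[OF M rE(1,2) \<eta>l \<eta>0 F \<epsilon>]) blast+
  define k where "k n x = x \<ominus>\<^bsub>component E (int n)\<^esub> f n (g n x)" for n x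
  have kl: "k n \<in> linear_maps R (component E (int n)) (component E (int n))" for n
    unfolding k_def[abs_def] a_minus_def
    by (rule linear_sum[OF cE(1) linear_id linear_uminus[OF cE(1) linear_comp[OF f(1) g(1)]]])
  have k0: "\<eta> (k 0 x) = \<zero>\<^bsub>M\<^esub>" if x: "x \<in> carrier (component E 0)" for x
  proof -
    interpret M: module R M by fact
    have gx: "g 0 x \<in> carrier (component F 0)" using linear_closed[OF g(1)[of 0]] x by simp
    have fg: "f 0 (g 0 x) \<in> carrier (component E 0)" using linear_closed[OF f(1)[of 0]] gx by simp
    have "\<eta> (k 0 x) = \<eta> x \<ominus>\<^bsub>M\<^esub> \<eta> (f 0 (g 0 x))"
      using linear_minus[OF \<eta>l cE(1) M x fg] by (simp add: k_def)
    then show ?thesis using f(2)[OF gx] g(2)[OF x] linear_closed[OF \<eta>l x] by (simp add: M.minus_eq M.r_neg)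
  qed
  have f1: "f (Suc n) \<in> linear_maps R (component F (int n + 1)) (component E (int n + 1))" for n
    using f(1)[of "Suc n"] by (simp add: add.commute)
  have g1: "g (Suc n) \<in> linear_maps R (component E (int n + 1)) (component F (int n + 1))" for n
    using g(1)[of "Suc n"] by (simp add: add.commute)
  have kd: "bd E (int n + 1) (k (Suc n) x) = k n (bd E (int n + 1) x)"
    if x: "x \<in> carrier (component E (int n + 1))" for n x
  proof -
    have gx: "g (Suc n) x \<in> carrier (component F (int n + 1))" by (rule linear_closed[OF g1 x])
    have "bd E (int n + 1) (k (Suc n) x) = bd E (int n + 1) (x \<ominus>\<^bsub>component E (int n + 1)\<^esub> f (Suc n) (g (Suc n) x))"
      by (simp add: k_def add.commute)
    also have "\<dots> = bd E (int n + 1) x \<ominus>\<^bsub>component E (int n)\<^esub> bd E (int n + 1) (f (Suc n) (g (Suc n) x))"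
      by (rule linear_minus[OF cE'(1) cE(1) cE(1) x linear_closed[OF f1 gx]])
    also have "\<dots> = k n (bd E (int n + 1) x)"
      by (simp add: f(3)[OF gx] g(3)[OF x] k_def)
    finally show ?thesis .
  qed
  obtain h where h: "\<And>n. h n \<in> linear_maps R (component E (int n)) (component E (int n + 1))"
    "\<And>n x. x \<in> carrier (component E (int n + 1)) \<Longrightarrow>
       bd E (int n + 2) (h (Suc n) x) = k (Suc n) x \<ominus>\<^bsub>component E (int n + 1)\<^esub> h n (bd E (int n + 1) x)"
    by (rule chain_null_homotopy[OF M rE(1,2) E \<eta> kl k0 kd]) blast+
  obtain m where m: "n = int m + 1" using n zero_le_imp_eq_int[of "n - 1"] by (metis diff_ge_0_iff_ge diff_add_cancel)
  let ?E0 = "component E (int m)" and ?E1 = "component E (int m + 1)" and ?E2 = "component E (int m + 2)"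
  let ?F0 = "component F (int m)" and ?F1 = "component F (int m + 1)" and ?F2 = "component F (int m + 2)"
  let ?T = "\<lambda>M. tensor R M N"
  let ?m = "\<lambda>M M' f. tensor_map R M N M' N f (\<lambda>y. y)"
  have mE: "module R (component E i)" "module R (component F i)" for i by (rule cE(1)) (rule cF(1))
  have fm: "f m \<in> linear_maps R ?F0 ?E0" "f (Suc m) \<in> linear_maps R ?F1 ?E1" "f (Suc (Suc m)) \<in> linear_maps R ?F2 ?E2"
    using f(1) f1 f1[of "Suc m"] by (simp_all add: add.commute add.left_commute)
  have gm: "g m \<in> linear_maps R ?E0 ?F0" "g (Suc m) \<in> linear_maps R ?E1 ?F1"
    using g(1) g1 by simp_all
  have hm: "h m \<in> linear_maps R ?E0 ?E1" "h (Suc m) \<in> linear_maps R ?E1 ?E2"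
    using h(1) h(1)[of "Suc m"] by (simp_all add: add.commute)
  have dE: "bd E (int m + 1) \<in> linear_maps R ?E1 ?E0" "bd E (int m + 2) \<in> linear_maps R ?E2 ?E1"
    using cE'(1)[of "int m"] cE'(1)[of "int m + 1"] by (simp_all add: add.assoc)
  have dF: "bd F (int m + 1) \<in> linear_maps R ?F1 ?F0" "bd F (int m + 2) \<in> linear_maps R ?F2 ?F1"
    using cF'(1)[of "int m"] cF'(1)[of "int m + 1"] by (simp_all add: add.assoc)
  have fd: "bd E (int m + 2) (f (Suc (Suc m)) x) = f (Suc m) (bd F (int m + 2) x)" if "x \<in> carrier ?F2" for x
    using f(3)[of x "Suc m"] that by (simp add: add.commute add.left_commute)
  have gd: "bd F (int m + 1) (g (Suc m) x) = g m (bd E (int m + 1) x)" if "x \<in> carrier ?E1" for x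
    using g(3) that by simp
  have z: "z \<in> carrier (?T ?E1)" "?m ?E1 ?E0 (bd E (int m + 1)) z = \<zero>\<^bsub>?T ?E0\<^esub>"
    using \<open>z \<in> cycles (tensor_cplx_module R E N) n\<close> by (simp_all add: cycles_def tensor_cplx_module_def m)
  interpret T1: module R "?T ?E1" by (rule tensor_module[OF mE(1) N])
  interpret E1: module R ?E1 by (rule mE)
  note tl = tensor_map_linear[OF _ N _ N _ linear_id]
  note tp = tensor_map_pure[OF _ N _ N _ linear_id]
  note tc = tensor_map_comp[OF _ N _ N _ N _ linear_id _ linear_id]
  note tcong = tensor_map_cong[OF _ N _ N _ linear_id _ linear_id]
  have e: "n + 1 = int m + 2" "int m + 2 - 1 = int m + 1" by (simp_all add: m)
  have bndF: "boundaries (tensor_cplx_module R F N) n = ?m ?F2 ?F1 (bd F (int m + 2)) ` carrier (?T ?F2)"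
    by (simp only: boundaries_def tensor_cplx_module_def cplx.simps e)
  have bndE: "boundaries (tensor_cplx_module R E N) n = ?m ?E2 ?E1 (bd E (int m + 2)) ` carrier (?T ?E2)"
    by (simp only: boundaries_def tensor_cplx_module_def cplx.simps e)
  define gz where "gz = ?m ?E1 ?F1 (g (Suc m)) z"
  have gzc: "gz \<in> carrier (?T ?F1)"
    unfolding gz_def by (rule linear_closed[OF tl[OF mE(1) mE(2) gm(2)] z(1)])
  have "?m ?F1 ?F0 (bd F (int m + 1)) gz = ?m ?E1 ?F0 (\<lambda>x. bd F (int m + 1) (g (Suc m) x)) z"
    unfolding gz_def by (rule tc[OF mE(1) mE(2) mE(2) gm(2) dF(1) z(1)])
  also have "\<dots> = ?m ?E1 ?F0 (\<lambda>x. g m (bd E (int m + 1) x)) z"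
    by (rule tcong[OF mE(1) mE(2) linear_comp[OF dF(1) gm(2)] linear_comp[OF gm(1) dE(1)] gd refl z(1)])
  also have "\<dots> = ?m ?E0 ?F0 (g m) (?m ?E1 ?E0 (bd E (int m + 1)) z)"
    by (rule tc[OF mE(1) mE(1) mE(2) dE(1) gm(1) z(1), symmetric])
  also have "\<dots> = \<zero>\<^bsub>?T ?F0\<^esub>"
    unfolding z(2) by (rule linear_zero[OF tl[OF mE(1) mE(2) gm(1)] tensor_module[OF mE(1) N] tensor_module[OF mE(2) N]])
  finally have "gz \<in> cycles (tensor_cplx_module R F N) n"
    using gzc by (simp add: cycles_def tensor_cplx_module_def m)
  then have "gz \<in> boundaries (tensor_cplx_module R F N) n" using ex by blast
  then obtain w where w: "w \<in> carrier (?T ?F2)" "gz = ?m ?F2 ?F1 (bd F (int m + 2)) w"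
    unfolding bndF by blast
  have "?m ?F1 ?E1 (f (Suc m)) gz = ?m ?F2 ?E1 (\<lambda>x. f (Suc m) (bd F (int m + 2) x)) w"
    unfolding w(2) by (rule tc[OF mE(2) mE(2) mE(1) dF(2) fm(2) w(1)])
  also have "\<dots> = ?m ?F2 ?E1 (\<lambda>x. bd E (int m + 2) (f (Suc (Suc m)) x)) w"
    by (rule tcong[OF mE(2) mE(1) linear_comp[OF fm(2) dF(2)] linear_comp[OF dE(2) fm(3)] fd[symmetric] refl w(1)])
  also have "\<dots> = ?m ?E2 ?E1 (bd E (int m + 2)) (?m ?F2 ?E2 (f (Suc (Suc m))) w)"
    by (rule tc[OF mE(2) mE(1) mE(1) fm(3) dE(2) w(1), symmetric])
  finally have fgz: "?m ?F1 ?E1 (f (Suc m)) gz = ?m ?E2 ?E1 (bd E (int m + 2)) (?m ?F2 ?E2 (f (Suc (Suc m))) w)" .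
  let ?d = "?m ?E2 ?E1 (bd E (int m + 2))"
  have homot: "f (Suc m) (g (Suc m) x) \<oplus>\<^bsub>?E1\<^esub> (bd E (int m + 2) (h (Suc m) x) \<oplus>\<^bsub>?E1\<^esub> h m (bd E (int m + 1) x)) = x"
    if x: "x \<in> carrier ?E1" for x
  proof -
    have fg: "f (Suc m) (g (Suc m) x) \<in> carrier ?E1"
      by (rule linear_closed[OF fm(2) linear_closed[OF gm(2) x]])
    have hd: "h m (bd E (int m + 1) x) \<in> carrier ?E1"
      by (rule linear_closed[OF hm(1) linear_closed[OF dE(1) x]])
    have kk: "k (Suc m) x = x \<ominus>\<^bsub>?E1\<^esub> f (Suc m) (g (Suc m) x)" by (simp add: k_def add.commute)
    have kc: "k (Suc m) x \<in> carrier ?E1" using kk x fg by simp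
    have "bd E (int m + 2) (h (Suc m) x) \<oplus>\<^bsub>?E1\<^esub> h m (bd E (int m + 1) x) = k (Suc m) x"
      using h(2)[OF x] kc hd by (simp add: E1.minus_eq E1.a_assoc E1.l_neg)
    then show ?thesis using kk x fg by (simp add: E1.minus_eq E1.a_comm[of x] E1.a_assoc[symmetric] E1.r_neg)
  qed
  have "?m ?F1 ?E1 (f (Suc m)) (?m ?E1 ?F1 (g (Suc m)) z) \<oplus>\<^bsub>?T ?E1\<^esub>
      (?d (?m ?E1 ?E2 (h (Suc m)) z) \<oplus>\<^bsub>?T ?E1\<^esub> ?m ?E0 ?E1 (h m) (?m ?E1 ?E0 (bd E (int m + 1)) z)) = z"
  proof (rule linear_tensor_eq[OF mE(1) N tensor_module[OF mE(1) N] _ linear_id _ z(1)])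
    show "(\<lambda>z. ?m ?F1 ?E1 (f (Suc m)) (?m ?E1 ?F1 (g (Suc m)) z) \<oplus>\<^bsub>?T ?E1\<^esub>
      (?d (?m ?E1 ?E2 (h (Suc m)) z) \<oplus>\<^bsub>?T ?E1\<^esub> ?m ?E0 ?E1 (h m) (?m ?E1 ?E0 (bd E (int m + 1)) z)))
      \<in> linear_maps R (?T ?E1) (?T ?E1)"
      by (intro linear_sum[OF T1.module_axioms] linear_comp[OF tl[OF mE(2) mE(1) fm(2)] tl[OF mE(1) mE(2) gm(2)]]
          linear_comp[OF tl[OF mE(1) mE(1) dE(2)] tl[OF mE(1) mE(1) hm(2)]]
          linear_comp[OF tl[OF mE(1) mE(1) hm(1)] tl[OF mE(1) mE(1) dE(1)]])
  next
    fix x y assume xy: "x \<in> carrier ?E1" "y \<in> carrier N"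
    note c = linear_closed[OF gm(2) xy(1)] linear_closed[OF hm(2) xy(1)] linear_closed[OF dE(1) xy(1)]
    note c2 = linear_closed[OF fm(2) c(1)] linear_closed[OF dE(2) c(2)] linear_closed[OF hm(1) c(3)]
    have "?m ?F1 ?E1 (f (Suc m)) (?m ?E1 ?F1 (g (Suc m)) (pure_tensor R ?E1 N x y)) \<oplus>\<^bsub>?T ?E1\<^esub>
      (?d (?m ?E1 ?E2 (h (Suc m)) (pure_tensor R ?E1 N x y)) \<oplus>\<^bsub>?T ?E1\<^esub> ?m ?E0 ?E1 (h m) (?m ?E1 ?E0 (bd E (int m + 1)) (pure_tensor R ?E1 N x y)))
      = pure_tensor R ?E1 N (f (Suc m) (g (Suc m) x)) y \<oplus>\<^bsub>?T ?E1\<^esub>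
       (pure_tensor R ?E1 N (bd E (int m + 2) (h (Suc m) x)) y \<oplus>\<^bsub>?T ?E1\<^esub> pure_tensor R ?E1 N (h m (bd E (int m + 1) x)) y)"
      using xy c by (simp add: tp[OF mE(2) mE(1) fm(2)] tp[OF mE(1) mE(2) gm(2)] tp[OF mE(1) mE(1) dE(2)]
          tp[OF mE(1) mE(1) hm(2)] tp[OF mE(1) mE(1) hm(1)] tp[OF mE(1) mE(1) dE(1)])
    also have "\<dots> = pure_tensor R ?E1 N x y"
      using xy c2 homot[OF xy(1)] by (simp add: pure_add_left[OF mE(1) N, symmetric])
    finally show "?m ?F1 ?E1 (f (Suc m)) (?m ?E1 ?F1 (g (Suc m)) (pure_tensor R ?E1 N x y)) \<oplus>\<^bsub>?T ?E1\<^esub>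
      (?d (?m ?E1 ?E2 (h (Suc m)) (pure_tensor R ?E1 N x y)) \<oplus>\<^bsub>?T ?E1\<^esub> ?m ?E0 ?E1 (h m) (?m ?E1 ?E0 (bd E (int m + 1)) (pure_tensor R ?E1 N x y)))
      = pure_tensor R ?E1 N x y" .
  qed
  moreover have "?m ?E0 ?E1 (h m) (?m ?E1 ?E0 (bd E (int m + 1)) z) = \<zero>\<^bsub>?T ?E1\<^esub>"
    unfolding z(2) by (rule linear_zero[OF tl[OF mE(1) mE(1) hm(1)] tensor_module[OF mE(1) N] tensor_module[OF mE(1) N]])
  moreover have hz: "?m ?E1 ?E2 (h (Suc m)) z \<in> carrier (?T ?E2)"
    by (rule linear_closed[OF tl[OF mE(1) mE(1) hm(2)] z(1)])
  moreover have fw: "?m ?F2 ?E2 (f (Suc (Suc m))) w \<in> carrier (?T ?E2)"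
    by (rule linear_closed[OF tl[OF mE(2) mE(1) fm(3)] w(1)])
  ultimately have "z = ?d (?m ?F2 ?E2 (f (Suc (Suc m))) w \<oplus>\<^bsub>?T ?E2\<^esub> ?m ?E1 ?E2 (h (Suc m)) z)"
    using fgz unfolding gz_def
    by (simp add: linear_add[OF tl[OF mE(1) mE(1) dE(2)]] linear_closed[OF tl[OF mE(1) mE(1) dE(2)]])
  moreover have "?m ?F2 ?E2 (f (Suc (Suc m))) w \<oplus>\<^bsub>?T ?E2\<^esub> ?m ?E1 ?E2 (h (Suc m)) z \<in> carrier (?T ?E2)"
  proof -
    interpret T2: module R "?T ?E2" by (rule tensor_module[OF mE(1) N])
    show ?thesis using hz fw by simp
  qed
  ultimately show "z \<in> boundaries (tensor_cplx_module R E N) n"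
    unfolding bndE by (rule image_eqI)
qed

text \<open>The homology is a set of cosets, and its zero is the set of boundaries itself. A cycle lies in its
own coset, hence in the set of boundaries if there is no other coset.\<close>

lemma homology_trivial_exact:
  assumes m: "module R (component C n)" and z: "\<zero>\<^bsub>component C n\<^esub> \<in> boundaries C n"
    and h: "carrier (homology C n) = {\<zero>\<^bsub>homology C n\<^esub>}"
  shows "cycles C n \<subseteq> boundaries C n"
proof
  interpret M: module R "component C n" by fact
  fix c assume c: "c \<in> cycles C n"
  let ?Z = "component C n\<lparr>carrier := cycles C n\<rparr>"
  have "boundaries C n +>\<^bsub>?Z\<^esub> c \<in> a_rcosets\<^bsub>?Z\<^esub> (boundaries C n)"
    using c by (auto simp: A_RCOSETS_def')
  then have "boundaries C n +>\<^bsub>?Z\<^esub> c = boundaries C n"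
    using h by (simp add: homology_def quot_module_def)
  moreover have "c \<in> boundaries C n +>\<^bsub>?Z\<^esub> c"
    unfolding mem_a_r_coset using z c by (intro bexI[of _ "\<zero>\<^bsub>component C n\<^esub>"]) (auto simp: cycles_def)
  ultimately show "c \<in> boundaries C n" by simp
qed

lemma ideal_submodule:
  assumes "ideal I R" shows "submodule I R (regular_module R)"
proof -
  interpret I: ideal I R by fact
  interpret M: module R "regular_module R" by (rule regular_module_module)
  show ?thesis
  proof (rule M.submoduleI)
    show "\<ominus>\<^bsub>regular_module R\<^esub> a \<in> I" if a: "a \<in> I" for a
    proof -
      have "a \<in> carrier R" using a by simp
      then have "\<ominus>\<^bsub>regular_module R\<^esub> a = (\<ominus> \<one>) \<otimes> a"
        using module_neg_eq[OF regular_module_module, of a] by simp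
      then show ?thesis using a by (simp add: I.I_l_closed)
    qed
  qed (auto simp: I.I_l_closed)
qed

lemma cyclic_module_module:
  assumes "ideal I R" shows "module R (cyclic_module R I)"
  unfolding cyclic_module_def by (rule quot_module_module[OF regular_module_module ideal_submodule[OF assms]])

text \<open>Tor-independence speaks about one chosen resolution. As some resolution exists with the names
over which the choice ranges, the chosen one is a resolution, and exactness is transferred from
it to \<open>E\<close>.\<close>

lemma Tor_independent_exact:
  assumes I: "ideal I R" and J: "ideal J R" and one: "\<one> \<noteq> \<zero>" and tor: "Tor_independent R I J"
    and E: "free_resolution R E (cyclic_module R I)" and n: "n \<ge> 1"
  shows "cycles (tensor_cplx_module R E (cyclic_module R J)) n
    \<subseteq> boundaries (tensor_cplx_module R E (cyclic_module R J)) n"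
proof -
  let ?M = "cyclic_module R I" and ?N = "cyclic_module R J"
  note M = cyclic_module_module[OF I] and N = cyclic_module_module[OF J]
  let ?F = "some_free_resolution R ?M"
  have F: "free_resolution R ?F ?M"
    unfolding some_free_resolution_def by (rule someI, rule syz_resolution_is_free_resolution[OF M one])
  let ?C = "tensor_cplx_module R ?F ?N"
  note cF = is_complexD[OF free_resolutionD(1)[OF F]] and cF' = complex_bd_up[OF free_resolutionD(1)[OF F]]
  have bl: "bd ?C (n + 1) \<in> linear_maps R (component ?C (n + 1)) (component ?C n)"
    using tensor_map_linear[OF cF(1) N cF(1) N cF'(1) linear_id] by (simp add: tensor_cplx_module_def)
  have mC: "module R (component ?C i)" for i
    using tensor_module[OF cF(1) N] by (simp add: tensor_cplx_module_def)
  interpret C1: module R "component ?C (n + 1)" by (rule mC)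
  have "\<zero>\<^bsub>component ?C n\<^esub> \<in> boundaries ?C n"
    unfolding boundaries_def using linear_zero[OF bl mC mC] C1.zero_closed by (metis image_eqI)
  then have "cycles ?C n \<subseteq> boundaries ?C n"
    using tor n by (intro homology_trivial_exact[OF mC]) (auto simp: Tor_independent_def Tor_def)
  then show ?thesis by (rule tensor_exact_transfer[OF M N F E n])
qed

end

section \<open>Direct sums\<close>

definition sum_inj :: "'i set \<Rightarrow> ('i \<Rightarrow> ('a, 'm) module) \<Rightarrow> 'i \<Rightarrow> 'm \<Rightarrow> 'i \<Rightarrow> 'm" where
  "sum_inj A M i x = (\<lambda>j\<in>A. if j = i then x else \<zero>\<^bsub>M j\<^esub>)"

lemma direct_sum_carrier: "u \<in> carrier (direct_sum A M) \<longleftrightarrow>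
    (\<forall>i\<in>A. u i \<in> carrier (M i)) \<and> u \<in> extensional A \<and> finite {i \<in> A. u i \<noteq> \<zero>\<^bsub>M i\<^esub>}"
  by (auto simp: direct_sum_def PiE_def)

lemma direct_sum_zero: "\<zero>\<^bsub>direct_sum A M\<^esub> = (\<lambda>i\<in>A. \<zero>\<^bsub>M i\<^esub>)"
  and direct_sum_add: "u \<oplus>\<^bsub>direct_sum A M\<^esub> v = (\<lambda>i\<in>A. u i \<oplus>\<^bsub>M i\<^esub> v i)"
  and direct_sum_smult: "r \<odot>\<^bsub>direct_sum A M\<^esub> u = (\<lambda>i\<in>A. r \<odot>\<^bsub>M i\<^esub> u i)"
  by (simp_all add: direct_sum_def)

lemma direct_sum_eqI:
  assumes "u \<in> carrier (direct_sum A M)" "v \<in> carrier (direct_sum A M)" "\<And>i. i \<in> A \<Longrightarrow> u i = v i"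
  shows "u = v"
  by (rule extensionalityI[of _ A]) (use assms in \<open>auto simp: direct_sum_carrier\<close>)

context base_ring begin

context
  fixes A :: "'i set" and M :: "'i \<Rightarrow> ('a, 'm) module"
  assumes M: "\<And>i. i \<in> A \<Longrightarrow> module R (M i)"
begin

lemma direct_sum_module: "module R (direct_sum A M)"
proof -
  let ?S = "direct_sum A M"
  have ag: "abelian_group (M i)" if "i \<in> A" for i using M[OF that] by (simp add: module_def)
  have c: "u \<oplus>\<^bsub>?S\<^esub> v \<in> carrier ?S" if uv: "u \<in> carrier ?S" "v \<in> carrier ?S" for u v
  proof -
    have z: "u i \<oplus>\<^bsub>M i\<^esub> v i = \<zero>\<^bsub>M i\<^esub>" if i: "i \<in> A" and "u i = \<zero>\<^bsub>M i\<^esub>" "v i = \<zero>\<^bsub>M i\<^esub>" for i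
    proof -
      interpret M: module R "M i" by (rule M[OF i])
      show ?thesis using that by simp
    qed
    have "u i \<oplus>\<^bsub>M i\<^esub> v i \<in> carrier (M i)" if i: "i \<in> A" for i
    proof -
      interpret M: module R "M i" by (rule M[OF i])
      show ?thesis using uv i by (simp add: direct_sum_carrier)
    qed
    moreover have "finite {i \<in> A. (u \<oplus>\<^bsub>?S\<^esub> v) i \<noteq> \<zero>\<^bsub>M i\<^esub>}"
      by (rule finite_subset[of _ "{i \<in> A. u i \<noteq> \<zero>\<^bsub>M i\<^esub>} \<union> {i \<in> A. v i \<noteq> \<zero>\<^bsub>M i\<^esub>}"])
        (use uv z in \<open>auto simp: direct_sum_carrier direct_sum_add\<close>)
    ultimately show ?thesis by (simp add: direct_sum_carrier direct_sum_add)
  qed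
  have z: "\<zero>\<^bsub>?S\<^esub> \<in> carrier ?S"
    using ag abelian_group.axioms(1) abelian_monoid.zero_closed
    by (fastforce simp: direct_sum_carrier direct_sum_zero)
  have s: "r \<odot>\<^bsub>?S\<^esub> u \<in> carrier ?S" if r: "r \<in> carrier R" and u: "u \<in> carrier ?S" for r u
  proof -
    have *: "r \<odot>\<^bsub>M i\<^esub> u i \<in> carrier (M i)" "u i = \<zero>\<^bsub>M i\<^esub> \<Longrightarrow> r \<odot>\<^bsub>M i\<^esub> u i = \<zero>\<^bsub>M i\<^esub>" if i: "i \<in> A" for i
    proof -
      interpret M: module R "M i" by (rule M[OF i])
      show "r \<odot>\<^bsub>M i\<^esub> u i \<in> carrier (M i)" using u r i by (simp add: direct_sum_carrier)
      show "r \<odot>\<^bsub>M i\<^esub> u i = \<zero>\<^bsub>M i\<^esub>" if "u i = \<zero>\<^bsub>M i\<^esub>" using that r by simp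
    qed
    have "{i \<in> A. (r \<odot>\<^bsub>?S\<^esub> u) i \<noteq> \<zero>\<^bsub>M i\<^esub>} \<subseteq> {i \<in> A. u i \<noteq> \<zero>\<^bsub>M i\<^esub>}"
      using *(2) by (auto simp: direct_sum_smult)
    moreover have "finite {i \<in> A. u i \<noteq> \<zero>\<^bsub>M i\<^esub>}" using u by (simp add: direct_sum_carrier)
    ultimately have "finite {i \<in> A. (r \<odot>\<^bsub>?S\<^esub> u) i \<noteq> \<zero>\<^bsub>M i\<^esub>}" by (rule finite_subset)
    then show ?thesis using *(1) by (simp add: direct_sum_carrier direct_sum_smult)
  qed
  have uc: "u i \<in> carrier (M i)" if "u \<in> carrier ?S" "i \<in> A" for u i using that by (simp add: direct_sum_carrier)
  have E: "u = v" if "u \<in> extensional A" "v \<in> extensional A" "\<And>i. i \<in> A \<Longrightarrow> module R (M i) \<Longrightarrow> u i = v i" for u v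
    by (rule extensionalityI[OF that(1,2)]) (use that(3) M in auto)
  show ?thesis
  proof (rule moduleI)
    show "cring R" by (rule is_cring)
    show "abelian_group ?S"
    proof (rule abelian_groupI)
      fix u assume u: "u \<in> carrier ?S"
      show "\<exists>v\<in>carrier ?S. v \<oplus>\<^bsub>?S\<^esub> u = \<zero>\<^bsub>?S\<^esub>"
      proof (rule bexI)
        show "((\<ominus> \<one>) \<odot>\<^bsub>?S\<^esub> u) \<in> carrier ?S" by (rule s[OF _ u]) simp
        have "((\<ominus> \<one>) \<odot>\<^bsub>M i\<^esub> u i) \<oplus>\<^bsub>M i\<^esub> u i = \<zero>\<^bsub>M i\<^esub>" if i: "i \<in> A" for i
        proof -
          interpret M: module R "M i" by (rule M[OF i])
          show ?thesis using uc[OF u i] by (simp add: M.smult_l_minus M.l_neg)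
        qed
        then show "((\<ominus> \<one>) \<odot>\<^bsub>?S\<^esub> u) \<oplus>\<^bsub>?S\<^esub> u = \<zero>\<^bsub>?S\<^esub>"
          by (auto simp: direct_sum_add direct_sum_smult direct_sum_zero)
      qed
      show "\<zero>\<^bsub>?S\<^esub> \<oplus>\<^bsub>?S\<^esub> u = u"
        by (rule E)
          (use u in \<open>auto simp: direct_sum_add direct_sum_zero direct_sum_carrier module_def
            abelian_group_def abelian_monoid.l_zero\<close>)
      fix v assume v: "v \<in> carrier ?S"
      show "u \<oplus>\<^bsub>?S\<^esub> v = v \<oplus>\<^bsub>?S\<^esub> u"
        by (rule E) (use uc[OF u] uc[OF v] in \<open>auto simp: direct_sum_add module_def
            abelian_group_def abelian_monoid.a_comm\<close>)
      fix w assume w: "w \<in> carrier ?S"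
      show "u \<oplus>\<^bsub>?S\<^esub> v \<oplus>\<^bsub>?S\<^esub> w = u \<oplus>\<^bsub>?S\<^esub> (v \<oplus>\<^bsub>?S\<^esub> w)"
        by (rule E) (use uc[OF u] uc[OF v] uc[OF w] in \<open>auto simp: direct_sum_add module_def
            abelian_group_def abelian_monoid.a_assoc\<close>)
    qed (rule c z; assumption?)+
    fix a b u v assume ab: "a \<in> carrier R" "b \<in> carrier R" and u: "u \<in> carrier ?S"
    show "(a \<oplus> b) \<odot>\<^bsub>?S\<^esub> u = a \<odot>\<^bsub>?S\<^esub> u \<oplus>\<^bsub>?S\<^esub> b \<odot>\<^bsub>?S\<^esub> u"
      by (rule E) (use ab uc[OF u] in \<open>auto simp: direct_sum_add direct_sum_smult module.smult_l_distr\<close>)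
    show "a \<otimes> b \<odot>\<^bsub>?S\<^esub> u = a \<odot>\<^bsub>?S\<^esub> (b \<odot>\<^bsub>?S\<^esub> u)"
      by (rule E) (use ab uc[OF u] in \<open>auto simp: direct_sum_smult module.smult_assoc1\<close>)
  next
    fix u assume u: "u \<in> carrier ?S"
    show "\<one> \<odot>\<^bsub>?S\<^esub> u = u"
      by (rule E) (use u in \<open>auto simp: direct_sum_smult direct_sum_carrier module.smult_one\<close>)
  next
    fix a u v assume a: "a \<in> carrier R" and u: "u \<in> carrier ?S" and v: "v \<in> carrier ?S"
    show "a \<odot>\<^bsub>?S\<^esub> (u \<oplus>\<^bsub>?S\<^esub> v) = a \<odot>\<^bsub>?S\<^esub> u \<oplus>\<^bsub>?S\<^esub> a \<odot>\<^bsub>?S\<^esub> v"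
      by (rule E) (use a uc[OF u] uc[OF v] in \<open>auto simp: direct_sum_add direct_sum_smult module.smult_r_distr\<close>)
  qed (rule s)
qed

lemma direct_sum_proj_linear: "i \<in> A \<Longrightarrow> (\<lambda>u. u i) \<in> linear_maps R (direct_sum A M) (M i)"
  by (rule linear_mapsI) (auto simp: direct_sum_carrier direct_sum_add direct_sum_smult)

lemma sum_inj_linear:
  assumes i: "i \<in> A" shows "sum_inj A M i \<in> linear_maps R (M i) (direct_sum A M)"
proof (rule linear_mapsI)
  have z: "\<zero>\<^bsub>M j\<^esub> \<in> carrier (M j)" if "j \<in> A" for j
  proof -
    interpret M: module R "M j" by (rule M[OF that])
    show ?thesis by simp
  qed
  have za: "\<zero>\<^bsub>M j\<^esub> \<oplus>\<^bsub>M j\<^esub> \<zero>\<^bsub>M j\<^esub> = \<zero>\<^bsub>M j\<^esub>" if "j \<in> A" for j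
  proof -
    interpret M: module R "M j" by (rule M[OF that])
    show ?thesis by simp
  qed
  have zs: "r \<odot>\<^bsub>M j\<^esub> \<zero>\<^bsub>M j\<^esub> = \<zero>\<^bsub>M j\<^esub>" if "j \<in> A" "r \<in> carrier R" for j r
  proof -
    interpret M: module R "M j" by (rule M[OF that(1)])
    show ?thesis using that by simp
  qed
  fix x assume x: "x \<in> carrier (M i)"
  have "finite {j \<in> A. sum_inj A M i x j \<noteq> \<zero>\<^bsub>M j\<^esub>}"
    by (rule finite_subset[of _ "{i}"]) (auto simp: sum_inj_def)
  moreover have "sum_inj A M i x j \<in> carrier (M j)" if "j \<in> A" for j
    using x z[OF that] that by (simp add: sum_inj_def)
  ultimately show "sum_inj A M i x \<in> carrier (direct_sum A M)"
    by (simp add: direct_sum_carrier) (simp add: sum_inj_def)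
  show "sum_inj A M i (r \<odot>\<^bsub>M i\<^esub> x) = r \<odot>\<^bsub>direct_sum A M\<^esub> sum_inj A M i x" if r: "r \<in> carrier R" for r
    unfolding sum_inj_def direct_sum_smult by (rule restrict_ext) (simp add: zs r)
  show "sum_inj A M i (x \<oplus>\<^bsub>M i\<^esub> y) = sum_inj A M i x \<oplus>\<^bsub>direct_sum A M\<^esub> sum_inj A M i y"
    if "y \<in> carrier (M i)" for y
    unfolding sum_inj_def direct_sum_add by (rule restrict_ext) (simp add: za)
qed

text \<open>An element of a direct sum is the finite sum of the images of its components.\<close>

lemma direct_sum_in_submodule:
  assumes N: "submodule N R (direct_sum A M)" and u: "u \<in> carrier (direct_sum A M)"
    and ui: "\<And>i. i \<in> A \<Longrightarrow> sum_inj A M i (u i) \<in> N"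
  shows "u \<in> N"
proof -
  interpret S: module R "direct_sum A M" by (rule direct_sum_module)
  define cut where "cut S = (\<lambda>j\<in>A. if j \<in> S then u j else \<zero>\<^bsub>M j\<^esub>)" for S
  have "cut S \<in> N" if "finite S" "S \<subseteq> A" for S
    using that
  proof (induction S rule: finite_induct)
    case empty
    have "cut {} = \<zero>\<^bsub>direct_sum A M\<^esub>" by (auto simp: cut_def direct_sum_zero)
    then show ?case using subgroup.one_closed[OF submodule.axioms(1)[OF N]] by simp
  next
    case (insert i S)
    have "cut (insert i S) = sum_inj A M i (u i) \<oplus>\<^bsub>direct_sum A M\<^esub> cut S"
    proof
      fix j
      show "cut (insert i S) j = (sum_inj A M i (u i) \<oplus>\<^bsub>direct_sum A M\<^esub> cut S) j"
      proof (cases "j \<in> A")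
        case True
        interpret M: module R "M j" by (rule M[OF True])
        have "u j \<in> carrier (M j)" using u True by (simp add: direct_sum_carrier)
        then show ?thesis using insert.hyps(2) True
          by (cases "i = j") (simp_all add: cut_def sum_inj_def direct_sum_add)
      next
        case False then show ?thesis by (simp add: cut_def direct_sum_add)
      qed
    qed
    then show ?case using insert ui S.submoduleE(5)[OF N] by simp
  qed
  moreover have "cut {i \<in> A. u i \<noteq> \<zero>\<^bsub>M i\<^esub>} = u"
    by (rule extensionalityI[of _ A]) (use u in \<open>auto simp: cut_def direct_sum_carrier\<close>)
  moreover have "finite {i \<in> A. u i \<noteq> \<zero>\<^bsub>M i\<^esub>}" using u by (simp add: direct_sum_carrier)
  ultimately show ?thesis by (metis (no_types, lifting) mem_Collect_eq subsetI)
qed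

lemma direct_sum_coords:
  assumes c: "\<And>i. i \<in> A \<Longrightarrow> basis_coords R (M i) (B i) (\<kappa> i) (e i)"
  shows "basis_coords R (direct_sum A M) (Sigma A B)
    (\<lambda>u (i, b). if i \<in> A then \<kappa> i (u i) b else \<zero>) (\<lambda>(i, b). sum_inj A M i (e i b))"
proof -
  let ?k = "\<lambda>u (i, b). if i \<in> A then \<kappa> i (u i) b else \<zero>"
  note cD = basis_coordsD[OF c]
  have kz: "\<kappa> i \<zero>\<^bsub>M i\<^esub> = (\<lambda>_. \<zero>)" if "i \<in> A" for i
    using linear_zero[OF cD(1)[OF that] M[OF that] free_module_module] by (simp add: free_zero)
  show ?thesis unfolding basis_coords_def
  proof (intro conjI ballI impI)
    show "?k \<in> linear_maps R (direct_sum A M) (free_module R (Sigma A B))"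
    proof (rule linear_mapsI)
      fix u assume u: "u \<in> carrier (direct_sum A M)"
      then have uc: "u i \<in> carrier (M i)" if "i \<in> A" for i using that by (simp add: direct_sum_carrier)
      let ?S = "SIGMA i:{i \<in> A. u i \<noteq> \<zero>\<^bsub>M i\<^esub>}. {b. \<kappa> i (u i) b \<noteq> \<zero>}"
      have fs: "finite ?S"
        using u cD(6)[OF _ uc] by (intro finite_SigmaI) (auto simp: direct_sum_carrier free_carrier)
      have "{p. ?k u p \<noteq> \<zero>} \<subseteq> ?S" using kz by (auto split: if_splits)
      then have "finite {p. ?k u p \<noteq> \<zero>}" using fs by (rule finite_subset)
      moreover have "?k u p \<in> carrier R" for p using cD(7)[OF _ uc] by (cases p) simp
      moreover have "?k u p = \<zero>" if "p \<notin> Sigma A B" for p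
        using that cD(6)[OF _ uc] by (cases p) (auto simp: free_carrier)
      ultimately show "?k u \<in> carrier (free_module R (Sigma A B))" by (simp add: free_carrier)
      show "?k (r \<odot>\<^bsub>direct_sum A M\<^esub> u) = r \<odot>\<^bsub>free_module R (Sigma A B)\<^esub> ?k u" if r: "r \<in> carrier R" for r
        using r uc linear_smult[OF cD(1) r uc] by (auto simp: direct_sum_smult free_smult fun_eq_iff)
      fix v assume v: "v \<in> carrier (direct_sum A M)"
      then have vc: "v i \<in> carrier (M i)" if "i \<in> A" for i using that by (simp add: direct_sum_carrier)
      show "?k (u \<oplus>\<^bsub>direct_sum A M\<^esub> v) = ?k u \<oplus>\<^bsub>free_module R (Sigma A B)\<^esub> ?k v"
        using linear_add[OF cD(1) uc vc] by (auto simp: direct_sum_add free_add fun_eq_iff)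
    qed
    show "(\<lambda>(i, b). sum_inj A M i (e i b)) \<in> Sigma A B \<rightarrow> carrier (direct_sum A M)"
      using linear_closed[OF sum_inj_linear] cD(3) by auto
    show "?k ((\<lambda>(i, b). sum_inj A M i (e i b)) p) = free_gen R p" if p: "p \<in> Sigma A B" for p
    proof -
      obtain i b where ib: "p = (i, b)" "i \<in> A" "b \<in> B i" using p by blast
      show ?thesis unfolding ib
        using ib cD(4)[OF ib(2,3)] kz by (auto simp: sum_inj_def free_gen_def fun_eq_iff)
    qed
    show "u = \<zero>\<^bsub>direct_sum A M\<^esub>" if u: "u \<in> carrier (direct_sum A M)" and 0: "?k u = (\<lambda>_. \<zero>)" for u
    proof (rule extensionalityI[of _ A])
      show "u \<in> extensional A" using u by (simp add: direct_sum_carrier)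
      show "\<zero>\<^bsub>direct_sum A M\<^esub> \<in> extensional A" by (simp add: direct_sum_zero)
      fix i assume i: "i \<in> A"
      have "\<kappa> i (u i) = (\<lambda>_. \<zero>)" using fun_cong[OF 0, of "(i, _)"] i by (simp add: fun_eq_iff)
      then show "u i = \<zero>\<^bsub>direct_sum A M\<^esub> i"
        using cD(5)[OF i, of "u i"] u i by (simp add: direct_sum_carrier direct_sum_zero)
    qed
  qed
qed

end

lemma zero_submodule_module:
  assumes "module R M" shows "module R (zero_submodule M)"
proof -
  interpret M: module R M by fact
  have "submodule {\<zero>\<^bsub>M\<^esub>} R M" by (rule M.submoduleI) auto
  then show ?thesis unfolding zero_submodule_def by (rule submodule.submodule_is_module[OF _ assms])
qed

lemma zero_submodule_simps [simp]: "carrier (zero_submodule M) = {\<zero>\<^bsub>M\<^esub>}" "\<zero>\<^bsub>zero_submodule M\<^esub> = \<zero>\<^bsub>M\<^esub>"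
  by (simp_all add: zero_submodule_def)

lemma zero_module_coords:
  assumes "module R M" "carrier M = {\<zero>\<^bsub>M\<^esub>}" shows "basis_coords R M {} (\<lambda>_ _. \<zero>) e"
proof -
  have "(\<lambda>_ _. \<zero>) \<in> linear_maps R M (free_module R {})"
    using linear_null[OF free_module_module] by (simp add: free_zero)
  then show ?thesis using assms(2) by (auto simp: basis_coords_def)
qed

end

section \<open>Double complexes\<close>

definition sign_twist :: "int \<Rightarrow> ('a, 'm) module \<Rightarrow> 'm \<Rightarrow> 'm" where
  "sign_twist p M x = (if even p then x else \<ominus>\<^bsub>M\<^esub> x)"

definition total_complex ::
  "(int \<times> int \<Rightarrow> ('a, 't) module) \<Rightarrow> (int \<Rightarrow> int \<Rightarrow> 't \<Rightarrow> 't) \<Rightarrow> (int \<Rightarrow> int \<Rightarrow> 't \<Rightarrow> 't)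
   \<Rightarrow> ('a, int \<times> int \<Rightarrow> 't) cplx" where
  "total_complex D dh dv =
     \<lparr>component = (\<lambda>n. direct_sum (bidegrees n) D),
      bd = (\<lambda>n u. restrict (\<lambda>(p, q). dh p q (u (p + 1, q)) \<oplus>\<^bsub>D (p, q)\<^esub>
              sign_twist p (D (p, q)) (dv p q (u (p, q + 1)))) (bidegrees (n - 1)))\<rparr>"

context base_ring begin

lemma sign_twist_linear: "module R M \<Longrightarrow> sign_twist p M \<in> linear_maps R M M"
  unfolding sign_twist_def[abs_def] using linear_id linear_uminus[OF _ linear_id] by (cases "even p") auto

lemma sign_twist_props:
  assumes "module R M" "x \<in> carrier M"
  shows "sign_twist p M x \<in> carrier M" "sign_twist p M (sign_twist p M x) = x"
    "sign_twist (p + 1) M x = \<ominus>\<^bsub>M\<^esub> sign_twist p M x"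
proof -
  interpret M: module R M by fact
  show "sign_twist p M x \<in> carrier M" "sign_twist p M (sign_twist p M x) = x"
    "sign_twist (p + 1) M x = \<ominus>\<^bsub>M\<^esub> sign_twist p M x"
    using assms by (simp_all add: sign_twist_def)
qed

lemma linear_sign_twist:
  assumes "h \<in> linear_maps R M N" "module R M" "module R N" "x \<in> carrier M"
  shows "h (sign_twist p M x) = sign_twist p N (h x)"
  using linear_neg[OF assms] by (simp add: sign_twist_def)

lemma linear_eq_if_diff:
  assumes "module R M" "x \<in> carrier M" "y \<in> carrier M" "x \<ominus>\<^bsub>M\<^esub> y = \<zero>\<^bsub>M\<^esub>"
  shows "x = y"
proof -
  interpret M: module R M by fact
  have "(x \<ominus>\<^bsub>M\<^esub> y) \<oplus>\<^bsub>M\<^esub> y = x" using assms(2,3) by (simp add: M.minus_eq M.a_assoc M.l_neg)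
  then show ?thesis using assms(3,4) by simp
qed

end

text \<open>The two differentials commute; the signs are introduced in the total complex. As in the tensor
product of complexes, \<open>dh p q\<close> and \<open>dv p q\<close> are indexed by the bidegree of their target.\<close>

locale double_complex = base_ring R for R :: "('a, 'r) ring_scheme" (structure) +
  fixes D :: "int \<times> int \<Rightarrow> ('a, 't) module" and dh dv :: "int \<Rightarrow> int \<Rightarrow> 't \<Rightarrow> 't"
  assumes D_module: "module R (D pq)"
    and dh_linear: "dh p q \<in> linear_maps R (D (p + 1, q)) (D (p, q))"
    and dv_linear: "dv p q \<in> linear_maps R (D (p, q + 1)) (D (p, q))"
    and dh_dh: "z \<in> carrier (D (p + 1 + 1, q)) \<Longrightarrow> dh p q (dh (p + 1) q z) = \<zero>\<^bsub>D (p, q)\<^esub>"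
    and dv_dv: "z \<in> carrier (D (p, q + 1 + 1)) \<Longrightarrow> dv p q (dv p (q + 1) z) = \<zero>\<^bsub>D (p, q)\<^esub>"
    and dh_dv: "z \<in> carrier (D (p + 1, q + 1)) \<Longrightarrow> dh p q (dv (p + 1) q z) = dv p q (dh p (q + 1) z)"
begin

abbreviation "Tot \<equiv> total_complex D dh dv"

definition tot_bd :: "(int \<times> int \<Rightarrow> 't) \<Rightarrow> int \<Rightarrow> int \<Rightarrow> 't" where
  "tot_bd u p q = dh p q (u (p + 1, q)) \<oplus>\<^bsub>D (p, q)\<^esub> sign_twist p (D (p, q)) (dv p q (u (p, q + 1)))"

lemma Tot_component: "component Tot n = direct_sum (bidegrees n) D"
  by (simp add: total_complex_def)

lemma Tot_bd: "bd Tot n u = restrict (\<lambda>(p, q). tot_bd u p q) (bidegrees (n - 1))"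
  by (simp add: total_complex_def tot_bd_def)

lemma Tot_component_module: "module R (component Tot n)"
  unfolding Tot_component by (rule direct_sum_module[OF D_module])

lemma Tot_closed: "u \<in> carrier (component Tot n) \<Longrightarrow> p + q = n \<Longrightarrow> u (p, q) \<in> carrier (D (p, q))"
  by (auto simp: Tot_component direct_sum_carrier bidegrees_def)

lemma tot_bd_closed:
  assumes "u \<in> carrier (component Tot n)" "p + q = n - 1" shows "tot_bd u p q \<in> carrier (D (p, q))"
proof -
  interpret D: module R "D (p, q)" by (rule D_module)
  show ?thesis unfolding tot_bd_def
    using assms by (intro D.a_closed sign_twist_props(1)[OF D_module] linear_closed[OF dh_linear]
        linear_closed[OF dv_linear] Tot_closed[OF assms(1)]) auto
qed

lemma tot_bd_add:
  assumes u: "u \<in> carrier (component Tot n)" and v: "v \<in> carrier (component Tot n)" and pq: "p + q = n - 1"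
  shows "tot_bd (u \<oplus>\<^bsub>component Tot n\<^esub> v) p q = tot_bd u p q \<oplus>\<^bsub>D (p, q)\<^esub> tot_bd v p q"
proof -
  interpret D: module R "D (p, q)" by (rule D_module)
  have pq': "p + 1 + q = n" "p + (q + 1) = n" using pq by auto
  note uc = Tot_closed[OF u pq'(1)] Tot_closed[OF u pq'(2)] and vc = Tot_closed[OF v pq'(1)] Tot_closed[OF v pq'(2)]
  have b: "(p + 1, q) \<in> bidegrees n" "(p, q + 1) \<in> bidegrees n" using pq' by (auto simp: bidegrees_def)
  show ?thesis
    using uc vc b by (simp add: tot_bd_def Tot_component direct_sum_add linear_add[OF dh_linear] linear_add[OF dv_linear]
        linear_add[OF sign_twist_linear[OF D_module]] linear_closed[OF dv_linear] linear_closed[OF dh_linear]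
        sign_twist_props(1)[OF D_module] D.a_ac)
qed

lemma tot_bd_smult:
  assumes u: "u \<in> carrier (component Tot n)" and r: "r \<in> carrier R" and pq: "p + q = n - 1"
  shows "tot_bd (r \<odot>\<^bsub>component Tot n\<^esub> u) p q = r \<odot>\<^bsub>D (p, q)\<^esub> tot_bd u p q"
proof -
  interpret D: module R "D (p, q)" by (rule D_module)
  have pq': "p + 1 + q = n" "p + (q + 1) = n" using pq by auto
  note uc = Tot_closed[OF u pq'(1)] Tot_closed[OF u pq'(2)]
  have b: "(p + 1, q) \<in> bidegrees n" "(p, q + 1) \<in> bidegrees n" using pq' by (auto simp: bidegrees_def)
  show ?thesis
    using uc b r by (simp add: tot_bd_def Tot_component direct_sum_smult linear_smult[OF dh_linear] linear_smult[OF dv_linear]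
        linear_smult[OF sign_twist_linear[OF D_module]] linear_closed[OF dv_linear] linear_closed[OF dh_linear]
        sign_twist_props(1)[OF D_module] D.smult_r_distr)
qed

lemma Tot_bd_linear: "bd Tot n \<in> linear_maps R (component Tot n) (component Tot (n - 1))"
proof (rule linear_mapsI)
  fix u assume u: "u \<in> carrier (component Tot n)"
  let ?S = "{pq \<in> bidegrees n. u pq \<noteq> \<zero>\<^bsub>D pq\<^esub>}"
  have "finite ?S" using u by (simp add: Tot_component direct_sum_carrier)
  then have fin: "finite ((\<lambda>(p, q). (p - 1, q)) ` ?S \<union> (\<lambda>(p, q). (p, q - 1)) ` ?S)" by simp
  have "tot_bd u p q = \<zero>\<^bsub>D (p, q)\<^esub>"
    if pq: "p + q = n - 1" and z: "u (p + 1, q) = \<zero>\<^bsub>D (p + 1, q)\<^esub>" "u (p, q + 1) = \<zero>\<^bsub>D (p, q + 1)\<^esub>" for p q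
  proof -
    interpret D: module R "D (p, q)" by (rule D_module)
    show ?thesis
      by (simp add: tot_bd_def z linear_zero[OF dh_linear D_module D_module] linear_zero[OF dv_linear D_module D_module]
          linear_zero[OF sign_twist_linear D_module D_module] D_module)
  qed
  then have sub: "{pq \<in> bidegrees (n - 1). bd Tot n u pq \<noteq> \<zero>\<^bsub>D pq\<^esub>}
      \<subseteq> (\<lambda>(p, q). (p - 1, q)) ` ?S \<union> (\<lambda>(p, q). (p, q - 1)) ` ?S"
  proof -
    have "(p, q) \<in> (\<lambda>(p, q). (p - 1, q)) ` ?S \<union> (\<lambda>(p, q). (p, q - 1)) ` ?S"
      if pq: "p + q = n - 1" and nz: "tot_bd u p q \<noteq> \<zero>\<^bsub>D (p, q)\<^esub>" for p q
    proof (cases "u (p + 1, q) = \<zero>\<^bsub>D (p + 1, q)\<^esub>")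
      case True
      then have "u (p, q + 1) \<noteq> \<zero>\<^bsub>D (p, q + 1)\<^esub>"
        using nz \<open>\<And>q p. \<lbrakk>p + q = n - 1; u (p + 1, q) = \<zero>\<^bsub>D (p + 1, q)\<^esub>; u (p, q + 1) = \<zero>\<^bsub>D (p, q + 1)\<^esub>\<rbrakk> \<Longrightarrow> tot_bd u p q = \<zero>\<^bsub>D (p, q)\<^esub>\<close> pq by blast
      then have "(p, q + 1) \<in> ?S" using pq by (simp add: bidegrees_def)
      then have "(p, q) \<in> (\<lambda>(p, q). (p, q - 1)) ` ?S" by (rule rev_image_eqI) simp
      then show ?thesis by blast
    next
      case False
      then have "(p + 1, q) \<in> ?S" using pq by (simp add: bidegrees_def)
      then have "(p, q) \<in> (\<lambda>(p, q). (p - 1, q)) ` ?S" by (rule rev_image_eqI) simp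
      then show ?thesis by blast
    qed
    then show ?thesis by (auto simp: Tot_bd bidegrees_def)
  qed
  show "bd Tot n u \<in> carrier (component Tot (n - 1))"
    using finite_subset[OF sub fin] tot_bd_closed[OF u]
    by (auto simp: Tot_component direct_sum_carrier Tot_bd bidegrees_def)
  show "bd Tot n (r \<odot>\<^bsub>component Tot n\<^esub> u) = r \<odot>\<^bsub>component Tot (n - 1)\<^esub> bd Tot n u" if "r \<in> carrier R" for r
    using tot_bd_smult[OF u that]
    by (auto simp: Tot_bd Tot_component[of "n - 1"] direct_sum_smult bidegrees_def)
  show "bd Tot n (u \<oplus>\<^bsub>component Tot n\<^esub> v) = bd Tot n u \<oplus>\<^bsub>component Tot (n - 1)\<^esub> bd Tot n v"
    if "v \<in> carrier (component Tot n)" for v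
    using tot_bd_add[OF u that]
    by (auto simp: Tot_bd Tot_component[of "n - 1"] direct_sum_add bidegrees_def)
qed

text \<open>The two mixed terms of the square of the differential carry the signs of the first degrees \<open>p + 1\<close> and \<open>p\<close> and cancel.\<close>

lemma Tot_complex: "is_complex R Tot"
  unfolding is_complex_def
proof (intro conjI allI ballI Tot_component_module Tot_bd_linear)
  fix n u assume u: "u \<in> carrier (component Tot n)"
  let ?U = "bd Tot n u"
  have "tot_bd ?U p q = \<zero>\<^bsub>D (p, q)\<^esub>" if pq: "p + q = n - 2" for p q
  proof -
    interpret D: module R "D (p, q)" by (rule D_module)
    interpret D1: module R "D (p + 1, q)" by (rule D_module)
    interpret D2: module R "D (p, q + 1)" by (rule D_module)
    let ?a = "u (p + 1 + 1, q)" and ?b = "u (p + 1, q + 1)" and ?c = "u (p, q + 1 + 1)"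
    have a: "?a \<in> carrier (D (p + 1 + 1, q))" and b: "?b \<in> carrier (D (p + 1, q + 1))"
      and c: "?c \<in> carrier (D (p, q + 1 + 1))" using pq by (auto intro!: Tot_closed[OF u])
    have U1: "?U (p + 1, q) = dh (p + 1) q ?a \<oplus>\<^bsub>D (p + 1, q)\<^esub> sign_twist (p + 1) (D (p + 1, q)) (dv (p + 1) q ?b)"
      and U2: "?U (p, q + 1) = dh p (q + 1) ?b \<oplus>\<^bsub>D (p, q + 1)\<^esub> sign_twist p (D (p, q + 1)) (dv p (q + 1) ?c)"
      using pq by (simp_all add: Tot_bd bidegrees_def tot_bd_def)
    let ?x = "dh p q (dv (p + 1) q ?b)"
    have bv: "dv (p + 1) q ?b \<in> carrier (D (p + 1, q))" by (rule linear_closed[OF dv_linear b])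
    have cv: "dv p (q + 1) ?c \<in> carrier (D (p, q + 1))" by (rule linear_closed[OF dv_linear c])
    have ah: "dh (p + 1) q ?a \<in> carrier (D (p + 1, q))" by (rule linear_closed[OF dh_linear a])
    have bh: "dh p (q + 1) ?b \<in> carrier (D (p, q + 1))" by (rule linear_closed[OF dh_linear b])
    have x: "?x \<in> carrier (D (p, q))" by (rule linear_closed[OF dh_linear bv])
    have s: "sign_twist i (D j) y \<in> carrier (D j)" if "y \<in> carrier (D j)" for i j y
      by (rule sign_twist_props(1)[OF D_module that])
    have 1: "dh p q (?U (p + 1, q)) = \<ominus>\<^bsub>D (p, q)\<^esub> sign_twist p (D (p, q)) ?x"
      unfolding U1 linear_add[OF dh_linear ah s[OF bv]] dh_dh[OF a]
        linear_sign_twist[OF dh_linear D_module D_module bv] sign_twist_props(3)[OF D_module x]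
      using s[OF x] by simp
    have 2: "dv p q (?U (p, q + 1)) = ?x"
      unfolding U2 linear_add[OF dv_linear bh s[OF cv]] linear_sign_twist[OF dv_linear D_module D_module cv]
        dv_dv[OF c] linear_zero[OF sign_twist_linear[OF D_module] D_module D_module] dh_dv[OF b, symmetric]
      using x by simp
    show ?thesis unfolding tot_bd_def 1 2 using s[OF x] by (simp add: D.l_neg)
  qed
  then show "bd Tot (n - 1) ?U = \<zero>\<^bsub>component Tot (n - 2)\<^esub>"
    by (auto simp: Tot_bd[of "n - 1"] Tot_component direct_sum_zero bidegrees_def)
qed

text \<open>A zigzag through the double complex. Let \<open>u\<close> be a cycle of total degree \<open>n\<close>, and suppose that its
component in bidegree \<open>(n - 1, 1)\<close> is already the component of a boundary, of the elements \<open>s\<close> in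
bidegree \<open>(n, 1)\<close> and \<open>r\<close> in bidegree \<open>(n - 1, 2)\<close>. If \<open>x\<close> and \<open>y\<close> solve the equation in
bidegree \<open>(p + 1, q)\<close>, then the cycle condition in bidegree \<open>(p, q)\<close> says that \<open>dv\<close> kills
\<open>u (p, q + 1) - dh y\<close>; by exactness of the column this difference is \<open>dv\<close> of an
element, which together with \<open>y\<close> solves the equation in bidegree \<open>(p, q + 1)\<close>. The first degree
falls along the way, so the elements found vanish after finitely many steps and form an
element of the total complex.\<close>

lemma Tot_zigzag:
  assumes zero: "\<And>p q. p < 1 \<or> q < 1 \<Longrightarrow> carrier (D (p, q)) = {\<zero>\<^bsub>D (p, q)\<^esub>}"
    and exact: "\<And>p q z. q \<ge> 2 \<Longrightarrow> z \<in> carrier (D (p, q)) \<Longrightarrow> dv p (q - 1) z = \<zero>\<^bsub>D (p, q - 1)\<^esub>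
      \<Longrightarrow> \<exists>w\<in>carrier (D (p, q + 1)). dv p q w = z"
    and u: "u \<in> carrier (component Tot n)" and u0: "bd Tot n u = \<zero>\<^bsub>component Tot (n - 1)\<^esub>"
    and s: "s \<in> carrier (D (n, 1))" and r: "r \<in> carrier (D (n - 1, 2))"
    and start: "u (n - 1, 1) = dh (n - 1) 1 s \<oplus>\<^bsub>D (n - 1, 1)\<^esub> sign_twist (n - 1) (D (n - 1, 1)) (dv (n - 1) 1 r)"
  shows "\<exists>w\<in>carrier (component Tot (n + 1)). bd Tot (n + 1) w = u"
proof -
  define solves where "solves k x y \<longleftrightarrow>
     u (n - 1 - int k, int k + 1) = dh (n - 1 - int k) (int k + 1) x \<oplus>\<^bsub>D (n - 1 - int k, int k + 1)\<^esub>
       sign_twist (n - 1 - int k) (D (n - 1 - int k, int k + 1)) (dv (n - 1 - int k) (int k + 1) y)" for k x y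
  define P where "P k x \<longleftrightarrow> x \<in> carrier (D (n - int k, int k + 1)) \<and>
     (\<exists>y\<in>carrier (D (n - 1 - int k, int k + 1 + 1)). solves k x y)" for k x
  have "\<exists>f. \<forall>k. P k (f k) \<and> solves k (f k) (f (Suc k))"
  proof (rule dependent_nat_choice)
    show "\<exists>x. P 0 x" using s r start by (intro exI[of _ s]) (auto simp: P_def solves_def)
  next
    fix x k assume "P k x"
    define p where "p = n - 2 - int k"
    define q where "q = int k + 1"
    have pq: "n - 1 - int k = p + 1" "n - int k = p + 1 + 1" "int (Suc k) = q" "n - 1 - q = p"
      "n - q = p + 1" by (auto simp: p_def q_def)
    obtain y where x: "x \<in> carrier (D (p + 1 + 1, q))" and y: "y \<in> carrier (D (p + 1, q + 1))"
      and sol: "solves k x y"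
      using \<open>P k x\<close> unfolding P_def pq q_def[symmetric] by blast
    interpret D: module R "D (p, q)" by (rule D_module)
    interpret D1: module R "D (p, q + 1)" by (rule D_module)
    have qk: "q \<ge> 1" by (simp add: q_def)
    let ?v = "u (p, q + 1)" and ?h = "dh p (q + 1) y"
    have sum: "p + q + 1 = n" by (simp add: p_def q_def)
    have v: "?v \<in> carrier (D (p, q + 1))" using sum by (intro Tot_closed[OF u]) simp
    have h: "?h \<in> carrier (D (p, q + 1))" by (rule linear_closed[OF dh_linear y])
    have eq: "u (p + 1, q) = dh (p + 1) q x \<oplus>\<^bsub>D (p + 1, q)\<^esub> sign_twist (p + 1) (D (p + 1, q)) (dv (p + 1) q y)"
      using sol unfolding solves_def pq q_def[symmetric] .
    have s: "sign_twist i (D j) z \<in> carrier (D j)" if "z \<in> carrier (D j)" for i j z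
      by (rule sign_twist_props(1)[OF D_module that])
    have yv: "dv (p + 1) q y \<in> carrier (D (p + 1, q))" by (rule linear_closed[OF dv_linear y])
    have xh: "dh (p + 1) q x \<in> carrier (D (p + 1, q))" by (rule linear_closed[OF dh_linear x])
    let ?a = "dv p q ?h" and ?b = "dv p q ?v"
    have a: "?a \<in> carrier (D (p, q))" and b: "?b \<in> carrier (D (p, q))"
      by (rule linear_closed[OF dv_linear h], rule linear_closed[OF dv_linear v])
    have 1: "dh p q (u (p + 1, q)) = \<ominus>\<^bsub>D (p, q)\<^esub> sign_twist p (D (p, q)) ?a"
      unfolding eq linear_add[OF dh_linear xh s[OF yv]] dh_dh[OF x]
        linear_sign_twist[OF dh_linear D_module D_module yv] dh_dv[OF y] sign_twist_props(3)[OF D_module a]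
      using s[OF a] by simp
    have "tot_bd u p q = \<zero>\<^bsub>D (p, q)\<^esub>"
      using fun_cong[OF u0, of "(p, q)"] sum by (simp add: Tot_bd Tot_component direct_sum_zero bidegrees_def split: if_splits)
    then have 2: "\<ominus>\<^bsub>D (p, q)\<^esub> sign_twist p (D (p, q)) ?a \<oplus>\<^bsub>D (p, q)\<^esub> sign_twist p (D (p, q)) ?b = \<zero>\<^bsub>D (p, q)\<^esub>"
      unfolding tot_bd_def 1 .
    have "sign_twist p (D (p, q)) ?b = sign_twist p (D (p, q)) ?a"
      by (rule linear_eq_if_diff[OF D_module s[OF b] s[OF a]])
        (use 2 s[OF a] s[OF b] in \<open>simp add: D.minus_eq D.a_comm\<close>)
    then have ab: "?b = ?a" using sign_twist_props(2)[OF D_module a, of p] sign_twist_props(2)[OF D_module b, of p] by metis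
    have "dv p q (?v \<ominus>\<^bsub>D (p, q + 1)\<^esub> ?h) = \<zero>\<^bsub>D (p, q)\<^esub>"
      unfolding linear_minus[OF dv_linear D_module D_module v h] ab using a by (simp add: D.minus_eq D.r_neg)
    moreover have vh: "?v \<ominus>\<^bsub>D (p, q + 1)\<^esub> ?h \<in> carrier (D (p, q + 1))" using v h by simp
    ultimately obtain w where w: "w \<in> carrier (D (p, q + 1 + 1))" "dv p (q + 1) w = ?v \<ominus>\<^bsub>D (p, q + 1)\<^esub> ?h"
      using exact[of "q + 1" "?v \<ominus>\<^bsub>D (p, q + 1)\<^esub> ?h" p] qk by auto
    let ?w = "sign_twist p (D (p, q + 1 + 1)) w"
    have "sign_twist p (D (p, q + 1)) (dv p (q + 1) ?w) = ?v \<ominus>\<^bsub>D (p, q + 1)\<^esub> ?h"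
      unfolding linear_sign_twist[OF dv_linear D_module D_module w(1)]
        sign_twist_props(2)[OF D_module linear_closed[OF dv_linear w(1)]] by (rule w(2))
    then have "solves (Suc k) y ?w"
      using v h unfolding solves_def pq by (simp add: D1.minus_eq D1.a_comm[of ?h] D1.a_assoc D1.l_neg)
    then have "P (Suc k) y" using y s[OF w(1)] unfolding P_def pq by blast
    moreover have "solves k x y" by (rule sol)
    ultimately show "\<exists>y. P (Suc k) y \<and> solves k x y" by blast
  qed
  then obtain f where fP: "\<And>k. P k (f k)" and fS: "\<And>k. solves k (f k) (f (Suc k))" by blast
  \<comment> \<open>The \<open>k\<close>-th element of the zigzag lies in bidegree \<open>(n - k, k + 1)\<close>.\<close>
  define w where "w = restrict (\<lambda>(p, q). if q \<ge> 1 then f (nat (q - 1)) else \<zero>\<^bsub>D (p, q)\<^esub>) (bidegrees (n + 1))"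
  have wc: "w (p, q) \<in> carrier (D (p, q))" if "p + q = n + 1" for p q
  proof (cases "q \<ge> 1")
    case True
    define k where "k = nat (q - 1)"
    have k: "q = int k + 1" "p = n - int k" using True that by (auto simp: k_def)
    have "w (p, q) = f k" using True that by (simp add: w_def bidegrees_def k_def)
    moreover have "f k \<in> carrier (D (n - int k, int k + 1))" using fP[of k] unfolding P_def by blast
    ultimately show ?thesis unfolding k by simp
  next
    case False
    interpret D: module R "D (p, q)" by (rule D_module)
    show ?thesis using False that by (simp add: w_def bidegrees_def)
  qed
  have fin: "finite {pq \<in> bidegrees (n + 1). w pq \<noteq> \<zero>\<^bsub>D pq\<^esub>}"
  proof (rule finite_subset)
    show "{pq \<in> bidegrees (n + 1). w pq \<noteq> \<zero>\<^bsub>D pq\<^esub>} \<subseteq> {1..n} \<times> {1..n}"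
    proof
      fix pq assume pq: "pq \<in> {pq \<in> bidegrees (n + 1). w pq \<noteq> \<zero>\<^bsub>D pq\<^esub>}"
      obtain p q where e: "pq = (p, q)" by (cases pq)
      have sum: "p + q = n + 1" and nz: "w (p, q) \<noteq> \<zero>\<^bsub>D (p, q)\<^esub>" using pq by (simp_all add: e bidegrees_def)
      have "\<not> (p < 1 \<or> q < 1)" using zero[of p q] wc[OF sum] nz by blast
      then show "pq \<in> {1..n} \<times> {1..n}" using sum e by auto
    qed
  qed simp
  have wT: "w \<in> carrier (component Tot (n + 1))"
    using wc fin by (auto simp: Tot_component direct_sum_carrier bidegrees_def) (auto simp: w_def bidegrees_def)
  have "bd Tot (n + 1) w = u"
  proof (rule direct_sum_eqI)
    show "bd Tot (n + 1) w \<in> carrier (direct_sum (bidegrees n) D)"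
      using linear_closed[OF Tot_bd_linear wT] by (simp add: Tot_component)
    show "u \<in> carrier (direct_sum (bidegrees n) D)" using u by (simp add: Tot_component)
    fix pq assume "pq \<in> bidegrees n"
    then obtain p q where pq: "pq = (p, q)" "p + q = n" by (auto simp: bidegrees_def)
    have bw: "bd Tot (n + 1) w pq = tot_bd w p q" using pq by (simp add: Tot_bd bidegrees_def)
    show "bd Tot (n + 1) w pq = u pq"
    proof (cases "q \<ge> 1")
      case True
      define k where "k = nat (q - 1)"
      have k: "q = int k + 1" "p = n - 1 - int k" using True pq by (auto simp: k_def)
      have "w (p + 1, q) = f k" using pq True by (simp add: w_def bidegrees_def k_def)
      moreover have "w (p, q + 1) = f (Suc k)" using pq True by (simp add: w_def bidegrees_def k_def nat_diff_distrib' Suc_nat_eq_nat_zadd1)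
      ultimately show ?thesis using fS[of k] unfolding bw unfolding tot_bd_def pq(1) solves_def k(2)[symmetric] k(1)[symmetric] by simp
    next
      case False
      then have "carrier (D (p, q)) = {\<zero>\<^bsub>D (p, q)\<^esub>}" using zero by simp
      then show ?thesis
        using tot_bd_closed[OF wT, of p q] Tot_closed[OF u pq(2)] pq bw by simp
    qed
  qed
  then show ?thesis using wT by blast
qed

end

context base_ring begin

section \<open>The star product as a complex\<close>

lemma tensor_cplx_total:
  "tensor_cplx R A B = total_complex (\<lambda>(p, q). tensor R (component A p) (component B q))
    (\<lambda>p q. tensor_map R (component A (p + 1)) (component B q) (component A p) (component B q) (bd A (p + 1)) (\<lambda>y. y))
    (\<lambda>p q. tensor_map R (component A p) (component B (q + 1)) (component A p) (component B q) (\<lambda>x. x) (bd B (q + 1)))"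
  unfolding tensor_cplx_def total_complex_def by (simp add: Let_def sign_twist_def)

lemma tensor_double_complex:
  assumes A: "is_complex R A" and B: "is_complex R B"
  shows "double_complex R (\<lambda>(p, q). tensor R (component A p) (component B q))
    (\<lambda>p q. tensor_map R (component A (p + 1)) (component B q) (component A p) (component B q) (bd A (p + 1)) (\<lambda>y. y))
    (\<lambda>p q. tensor_map R (component A p) (component B (q + 1)) (component A p) (component B q) (\<lambda>x. x) (bd B (q + 1)))"
proof -
  note mA = is_complexD(1)[OF A] and mB = is_complexD(1)[OF B]
  note dA = complex_bd_up[OF A] and dB = complex_bd_up[OF B]
  show ?thesis
  proof (intro double_complex.intro double_complex_axioms.intro base_ring_axioms, goal_cases)
    case (1 pq) then show ?case by (cases pq) (simp add: tensor_module[OF mA mB])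
  next
    case (2 p q) then show ?case using tensor_map_linear[OF mA mB mA mB dA(1) linear_id] by simp
  next
    case (3 p q) then show ?case using tensor_map_linear[OF mA mB mA mB linear_id dB(1)] by simp
  next
    case (4 z p q)
    then have z: "z \<in> carrier (tensor R (component A (p + 1 + 1)) (component B q))" by simp
    show ?case
      using tensor_map_comp[OF mA mB mA mB mA mB dA(1) linear_id dA(1) linear_id z]
        tensor_map_zero[OF mA mB mA mB linear_comp[OF dA(1) dA(1)] linear_id _ z] dA(2)[where n="p + 1"] by simp
  next
    case (5 z p q)
    then have z: "z \<in> carrier (tensor R (component A p) (component B (q + 1 + 1)))" by simp
    show ?case
      using tensor_map_comp[OF mA mB mA mB mA mB linear_id dB(1) linear_id dB(1) z]
        tensor_map_zero[OF mA mB mA mB linear_id linear_comp[OF dB(1) dB(1)] _ z] dB(2)[where n="q + 1"] by simp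
  next
    case (6 z p q)
    then have z: "z \<in> carrier (tensor R (component A (p + 1)) (component B (q + 1)))" by simp
    show ?case
      using tensor_map_comp[OF mA mB mA mB mA mB linear_id dB(1) dA(1) linear_id z]
        tensor_map_comp[OF mA mB mA mB mA mB dA(1) linear_id linear_id dB(1) z] by simp
  qed
qed

lemma trunc_simps:
  "q \<ge> 1 \<Longrightarrow> component (trunc_ge1 C) q = component C q"
  "q < 1 \<Longrightarrow> component (trunc_ge1 C) q = zero_submodule (component C q)"
  "q > 1 \<Longrightarrow> bd (trunc_ge1 C) q = bd C q"
  "q \<le> 1 \<Longrightarrow> bd (trunc_ge1 C) q = (\<lambda>_. \<zero>\<^bsub>component C (q - 1)\<^esub>)"
  by (auto simp: trunc_ge1_def)

lemma trunc_zero: "\<zero>\<^bsub>component (trunc_ge1 C) q\<^esub> = \<zero>\<^bsub>component C q\<^esub>"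
  by (cases "q \<ge> 1") (auto simp: trunc_simps)

lemma trunc_module:
  assumes "is_complex R C" shows "module R (component (trunc_ge1 C) q)"
  using is_complexD(1)[OF assms] zero_submodule_module by (cases "q \<ge> 1") (auto simp: trunc_simps)

lemma trunc_complex:
  assumes C: "is_complex R C" shows "is_complex R (trunc_ge1 C)"
  unfolding is_complex_def
proof (intro conjI allI ballI trunc_module[OF C])
  show "bd (trunc_ge1 C) n \<in> linear_maps R (component (trunc_ge1 C) n) (component (trunc_ge1 C) (n - 1))" for n
  proof (cases "n > 1")
    case True then show ?thesis using is_complexD(2)[OF C, of n] by (simp add: trunc_simps)
  next
    case False
    then show ?thesis
      using linear_null[OF trunc_module[OF C, of "n - 1"], of "component (trunc_ge1 C) n"]
      by (simp add: trunc_simps(4) trunc_zero)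
  qed
  fix n x assume x: "x \<in> carrier (component (trunc_ge1 C) n)"
  show "bd (trunc_ge1 C) (n - 1) (bd (trunc_ge1 C) n x) = \<zero>\<^bsub>component (trunc_ge1 C) (n - 2)\<^esub>"
  proof (cases "n > 2")
    case True then show ?thesis using is_complexD(3)[OF C, where n=n and x=x] x by (simp add: trunc_simps)
  next
    case False
    then show ?thesis by (simp add: trunc_simps(4) trunc_zero)
  qed
qed

lemma tensor_trivial:
  assumes M: "module R M" and N: "module R N"
    and 0: "carrier M = {\<zero>\<^bsub>M\<^esub>} \<or> carrier N = {\<zero>\<^bsub>N\<^esub>}"
  shows "carrier (tensor R M N) = {\<zero>\<^bsub>tensor R M N\<^esub>}"
proof -
  interpret TT: module R "tensor R M N" by (rule tensor_module[OF M N])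
  have "z = \<zero>\<^bsub>tensor R M N\<^esub>" if "z \<in> carrier (tensor R M N)" for z
    using that
  proof (induction rule: tensor_induct[OF M N, consumes 1, case_names pure add])
    case (pure x y)
    then have "x = \<zero>\<^bsub>M\<^esub> \<or> y = \<zero>\<^bsub>N\<^esub>" using 0 by blast
    then show ?case using pure by (auto simp: pure_zero_left[OF M N] pure_zero_right[OF M N])
  qed simp
  then show ?thesis by auto
qed

context
  fixes E :: "('a, 'm) cplx" and B :: "('a, 'n) cplx"
  assumes E: "is_complex R E" and B: "is_complex R B"
begin

private abbreviation "TT \<equiv> tensor_cplx R (trunc_ge1 E) (trunc_ge1 B)"
private abbreviation "SS \<equiv> star_product R E B"
private abbreviation "DD \<equiv> (\<lambda>(p, q). tensor R (component (trunc_ge1 E) p) (component (trunc_ge1 B) q))"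
private abbreviation "DH \<equiv> (\<lambda>p q. tensor_map R (component (trunc_ge1 E) (p + 1)) (component (trunc_ge1 B) q)
   (component (trunc_ge1 E) p) (component (trunc_ge1 B) q) (bd (trunc_ge1 E) (p + 1)) (\<lambda>y. y))"
private abbreviation "DV \<equiv> (\<lambda>p q. tensor_map R (component (trunc_ge1 E) p) (component (trunc_ge1 B) (q + 1))
   (component (trunc_ge1 E) p) (component (trunc_ge1 B) q) (\<lambda>x. x) (bd (trunc_ge1 B) (q + 1)))"

private lemma T_eq: "TT = total_complex DD DH DV"
  by (rule tensor_cplx_total)

interpretation DC: double_complex R DD DH DV
  by (rule tensor_double_complex[OF trunc_complex[OF E] trunc_complex[OF B]])

private lemmas mE = is_complexD(1)[OF E] and mB = is_complexD(1)[OF B]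
private lemmas dE = complex_bd_up[OF E] and dB = complex_bd_up[OF B]

lemma star_component:
  "n \<ge> 1 \<Longrightarrow> component SS n = component TT (n + 1)"
  "component SS 0 = direct_sum {(0, 0)} (\<lambda>_. tensor R (component E 0) (component B 0))"
  "n < 0 \<Longrightarrow> component SS n = zero_submodule (component TT (n + 1))"
  by (auto simp: star_product_def Let_def)

lemma star_bd:
  "n \<ge> 2 \<Longrightarrow> bd SS n = bd TT (n + 1)"
  "bd SS 1 u = (\<lambda>_\<in>{(0, 0)}. tensor_map R (component E 1) (component B 1) (component E 0) (component B 0)
     (bd E 1) (bd B 1) (u (1, 1)))"
  "n \<le> 0 \<Longrightarrow> bd SS n u = \<zero>\<^bsub>component SS (n - 1)\<^esub>"
  by (auto simp: star_product_def Let_def)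

lemma star_summand_module: "module R (DD pq)"
  by (rule DC.D_module)

lemma tensor_trunc_component: "component TT n = direct_sum (bidegrees n) DD"
  unfolding T_eq by (rule DC.Tot_component)

lemma star_component_module: "module R (component SS n)"
proof -
  consider "n \<ge> 1" | "n = 0" | "n < 0" by linarith
  then show ?thesis
  proof cases
    case 1 then show ?thesis using DC.Tot_component_module T_eq by (simp add: star_component(1))
  next
    case 2 then show ?thesis by (simp add: star_component(2) direct_sum_module tensor_module[OF mE mB])
  next
    case 3 then show ?thesis
      using zero_submodule_module[OF DC.Tot_component_module] T_eq by (simp add: star_component(3))
  qed
qed

lemma summand_pos: "p \<ge> 1 \<Longrightarrow> q \<ge> 1 \<Longrightarrow> DD (p, q) = tensor R (component E p) (component B q)"
  by (simp add: trunc_simps)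

lemma summand_zero:
  assumes "p < 1 \<or> q < 1" shows "carrier (DD (p, q)) = {\<zero>\<^bsub>DD (p, q)\<^esub>}"
  using tensor_trivial[OF trunc_module[OF E] trunc_module[OF B], of p q] assms
  by (auto simp: trunc_simps(2) trunc_zero)

lemma star_bd_1_linear: "bd SS 1 \<in> linear_maps R (component SS 1) (component SS 0)"
proof -
  let ?M = "tensor R (component E 0) (component B 0)"
  let ?m = "tensor_map R (component E 1) (component B 1) (component E 0) (component B 0) (bd E 1) (bd B 1)"
  have p: "(\<lambda>u. u (1, 1)) \<in> linear_maps R (component SS 1) (DD (1, 1))"
    unfolding star_component(1)[of 1, simplified] tensor_trunc_component
    by (rule direct_sum_proj_linear[OF star_summand_module]) (simp add: bidegrees_def)
  have m: "?m \<in> linear_maps R (DD (1, 1)) ?M"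
    using tensor_map_linear[OF mE mB mE mB dE(1)[of 0] dB(1)[of 0]] by (simp add: summand_pos[of 1 1, simplified] trunc_simps)
  have i: "sum_inj {(0, 0)} (\<lambda>_. ?M) (0, 0) \<in> linear_maps R ?M (component SS 0)"
    unfolding star_component(2)
    by (rule sum_inj_linear[OF tensor_module[OF mE mB]]) simp
  have "(\<lambda>u. sum_inj {(0, 0)} (\<lambda>_. ?M) (0, 0) (?m (u (1, 1)))) \<in> linear_maps R (component SS 1) (component SS 0)"
    by (rule linear_comp[OF i linear_comp[OF m p]])
  then show ?thesis
  proof (rule linear_cong[OF _ star_component_module])
    show "sum_inj {(0, 0)} (\<lambda>_. ?M) (0, 0) (?m (u (1, 1))) = bd SS 1 u" for u
      unfolding sum_inj_def star_bd(2) by (rule restrict_ext) simp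
  qed
qed

lemma star_bd_linear: "bd SS n \<in> linear_maps R (component SS n) (component SS (n - 1))"
proof -
  consider "n \<ge> 2" | "n = 1" | "n \<le> 0" by linarith
  then show ?thesis
  proof cases
    case 1 then show ?thesis using DC.Tot_bd_linear[of "n + 1"] T_eq by (simp add: star_component(1) star_bd(1))
  next
    case 2 then show ?thesis using star_bd_1_linear by simp
  next
    case 3
    then have "bd SS n = (\<lambda>u. \<zero>\<^bsub>component SS (n - 1)\<^esub>)" using star_bd(3) by blast
    then show ?thesis using linear_null[OF star_component_module] by simp
  qed
qed

lemma tensor_trunc_bd_at:
  assumes u: "p + q = n - 1"
  shows "bd TT n u (p, q) = DH p q (u (p + 1, q)) \<oplus>\<^bsub>DD (p, q)\<^esub> sign_twist p (DD (p, q)) (DV p q (u (p, q + 1)))"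
  using u unfolding T_eq by (simp add: DC.Tot_bd bidegrees_def DC.tot_bd_def)

lemma star_summand_closed:
  "u \<in> carrier (component TT n) \<Longrightarrow> p + q = n \<Longrightarrow> u (p, q) \<in> carrier (DD (p, q))"
  unfolding T_eq by (rule DC.Tot_closed)

lemma star_bd_1_2:
  assumes u: "u \<in> carrier (component SS 2)" shows "bd SS 1 (bd SS 2 u) = \<zero>\<^bsub>component SS 0\<^esub>"
proof -
  let ?A = "component E" and ?C = "component B"
  let ?m = "tensor_map R (?A 1) (?C 1) (?A 0) (?C 0) (bd E 1) (bd B 1)"
  let ?M = "tensor R (?A 0) (?C 0)" and ?N = "tensor R (?A 1) (?C 1)"
  have uT: "u \<in> carrier (component TT 3)" using u star_component(1)[of 2] by simp
  have a: "u (2, 1) \<in> carrier (tensor R (?A 2) (?C 1))" and b: "u (1, 2) \<in> carrier (tensor R (?A 1) (?C 2))"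
    using star_summand_closed[OF uT, of 2 1] star_summand_closed[OF uT, of 1 2] by (simp_all add: trunc_simps)
  have d2E: "bd E 2 \<in> linear_maps R (?A 2) (?A 1)" and d2B: "bd B 2 \<in> linear_maps R (?C 2) (?C 1)"
    and d1E: "bd E 1 \<in> linear_maps R (?A 1) (?A 0)" and d1B: "bd B 1 \<in> linear_maps R (?C 1) (?C 0)"
    using dE(1)[of 1] dB(1)[of 1] dE(1)[of 0] dB(1)[of 0] by simp_all
  let ?a = "tensor_map R (?A 2) (?C 1) (?A 1) (?C 1) (bd E 2) (\<lambda>y. y)"
  let ?b = "tensor_map R (?A 1) (?C 2) (?A 1) (?C 1) (\<lambda>x. x) (bd B 2)"
  note ml = tensor_map_linear[OF mE mB mE mB d1E d1B]
  have ac: "?a (u (2, 1)) \<in> carrier ?N" and bc: "?b (u (1, 2)) \<in> carrier ?N"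
    by (rule linear_closed[OF tensor_map_linear[OF mE mB mE mB d2E linear_id] a],
        rule linear_closed[OF tensor_map_linear[OF mE mB mE mB linear_id d2B] b])
  have dd: "bd E 1 (bd E 2 x) = \<zero>\<^bsub>?A 0\<^esub>" if "x \<in> carrier (?A 2)" for x using dE(2)[where n=1 and x=x] that by simp
  have dd': "bd B 1 (bd B 2 x) = \<zero>\<^bsub>?C 0\<^esub>" if "x \<in> carrier (?C 2)" for x using dB(2)[where n=1 and x=x] that by simp
  have ma: "?m (?a (u (2, 1))) = \<zero>\<^bsub>?M\<^esub>"
    using tensor_map_comp[OF mE mB mE mB mE mB d2E linear_id d1E d1B a]
      tensor_map_zero[OF mE mB mE mB linear_comp[OF d1E d2E] linear_comp[OF d1B linear_id] _ a] dd by simp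
  have mb: "?m (?b (u (1, 2))) = \<zero>\<^bsub>?M\<^esub>"
    using tensor_map_comp[OF mE mB mE mB mE mB linear_id d2B d1E d1B b]
      tensor_map_zero[OF mE mB mE mB linear_comp[OF d1E linear_id] linear_comp[OF d1B d2B] _ b] dd' by simp
  have v: "bd SS 2 u (1, 1) = ?a (u (2, 1)) \<oplus>\<^bsub>?N\<^esub> sign_twist 1 ?N (?b (u (1, 2)))"
    using tensor_trunc_bd_at[of 1 1 3 u] star_bd(1)[of 2] by (simp add: trunc_simps)
  interpret M: module R ?M by (rule tensor_module[OF mE mB])
  have "?m (bd SS 2 u (1, 1)) = \<zero>\<^bsub>?M\<^esub>"
    unfolding v linear_add[OF ml ac sign_twist_props(1)[OF tensor_module[OF mE mB] bc]]
      linear_sign_twist[OF ml tensor_module[OF mE mB] tensor_module[OF mE mB] bc] ma mb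
      linear_zero[OF sign_twist_linear[OF tensor_module[OF mE mB]] tensor_module[OF mE mB] tensor_module[OF mE mB]]
    by simp
  then show ?thesis by (simp add: star_bd(2) star_component(2) direct_sum_zero)
qed

lemma star_complex: "is_complex R SS"
  unfolding is_complex_def
proof (intro conjI allI ballI star_component_module star_bd_linear)
  fix n u assume u: "u \<in> carrier (component SS n)"
  consider "n \<ge> 3" | "n = 2" | "n = 1" | "n \<le> 0" by linarith
  then show "bd SS (n - 1) (bd SS n u) = \<zero>\<^bsub>component SS (n - 2)\<^esub>"
  proof cases
    case 1
    then show ?thesis
      using is_complexD(3)[OF DC.Tot_complex[folded T_eq], where n="n + 1" and x=u] u
      by (simp add: star_component(1) star_bd(1))
  next
    case 2 then show ?thesis using star_bd_1_2 u by simp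
  next
    case 3
    then show ?thesis by (simp add: star_bd(3))
  next
    case 4 then show ?thesis by (simp add: star_bd(3))
  qed
qed

section \<open>Exactness of the star product\<close>

text \<open>This is where vanishing of the homology of \<open>E \<otimes> N\<close> enters; \<open>N\<close> is the module resolved by
\<open>B\<close>. The element \<open>v = (1 \<otimes> \<partial>) a\<close> of \<open>E\<^sub>n \<otimes> B\<^sub>0\<close> is a cycle of \<open>E \<otimes> B\<^sub>0\<close>. Since \<open>B\<^sub>0\<close> is free of rank
one, this complex is exact, and \<open>v = (\<partial> \<otimes> 1) w\<close>. The image of \<open>w\<close> in \<open>E\<^bsub>n+1\<^esub> \<otimes> N\<close> is a cycle because
\<open>v\<close> has image zero in \<open>E\<^sub>n \<otimes> N\<close>; hence it is a boundary, and \<open>w\<close> may be corrected by a boundary of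
\<open>E \<otimes> B\<^sub>0\<close> so that it comes from an element \<open>s\<close> of \<open>E\<^bsub>n+1\<^esub> \<otimes> B\<^sub>1\<close>. Then \<open>1 \<otimes> \<partial>\<close> kills
\<open>a - (\<partial> \<otimes> 1) s\<close>, and tensoring with the free module \<open>E\<^sub>n\<close> keeps \<open>B\<close> exact in degree one.\<close>

lemma star_corner_step:
  assumes fE: "\<And>n. is_free R (component E n)" and N: "module R N"
    and exE: "\<And>n x. n \<ge> 1 \<Longrightarrow> x \<in> carrier (component E n) \<Longrightarrow> bd E n x = \<zero>\<^bsub>component E (n - 1)\<^esub> \<Longrightarrow>
      x \<in> bd E (n + 1) ` carrier (component E (n + 1))"
    and exB: "\<And>n x. n \<ge> 1 \<Longrightarrow> x \<in> carrier (component B n) \<Longrightarrow> bd B n x = \<zero>\<^bsub>component B (n - 1)\<^esub> \<Longrightarrow>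
      x \<in> bd B (n + 1) ` carrier (component B (n + 1))"
    and \<eta>: "is_augmentation R B N \<eta>"
    and \<psi>: "\<psi> \<in> linear_isos R (regular_module R) (component B 0)"
    and tor: "\<And>n. n \<ge> 1 \<Longrightarrow> cycles (tensor_cplx_module R E N) n \<subseteq> boundaries (tensor_cplx_module R E N) n"
    and n: "n \<ge> 1"
    and a: "a \<in> carrier (tensor R (component E n) (component B 1))"
    and a0: "tensor_map R (component E n) (component B 1) (component E (n - 1)) (component B 0) (bd E n) (bd B 1) a
      = \<zero>\<^bsub>tensor R (component E (n - 1)) (component B 0)\<^esub>"
  shows "\<exists>s\<in>carrier (tensor R (component E (n + 1)) (component B 1)).
         \<exists>r\<in>carrier (tensor R (component E n) (component B 2)).
      a = tensor_map R (component E (n + 1)) (component B 1) (component E n) (component B 1) (bd E (n + 1)) (\<lambda>y. y) s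
        \<oplus>\<^bsub>tensor R (component E n) (component B 1)\<^esub>
        tensor_map R (component E n) (component B 2) (component E n) (component B 1) (\<lambda>x. x) (bd B 2) r"
proof -
  let ?A = "component E" and ?C = "component B" and ?t = "tensor_map R"
  have \<eta>l: "\<eta> \<in> linear_maps R (?C 0) N" and \<eta>s: "\<eta> ` carrier (?C 0) = carrier N"
    and \<eta>k: "\<And>y. y \<in> carrier (?C 0) \<Longrightarrow> \<eta> y = \<zero>\<^bsub>N\<^esub> \<longleftrightarrow> y \<in> bd B 1 ` carrier (?C 1)"
    using \<eta> unfolding is_augmentation_def boundaries_def by auto
  have d0: "bd E n \<in> linear_maps R (?A n) (?A (n - 1))" using dE(1)[of "n - 1"] by simp
  have d1: "bd E (n + 1) \<in> linear_maps R (?A (n + 1)) (?A n)" by (rule dE(1))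
  have d2: "bd E (n + 2) \<in> linear_maps R (?A (n + 2)) (?A (n + 1))" using dE(1)[of "n + 1"] by (simp add: add.assoc)
  have b1: "bd B 1 \<in> linear_maps R (?C 1) (?C 0)" using dB(1)[of 0] by simp
  have b2: "bd B 2 \<in> linear_maps R (?C 2) (?C 1)" using dB(1)[of 1] by simp
  have dd1: "bd E n (bd E (n + 1) x) = \<zero>\<^bsub>?A (n - 1)\<^esub>" if "x \<in> carrier (?A (n + 1))" for x using dE(2) that by blast
  have dd2: "bd E (n + 1) (bd E (n + 2) x) = \<zero>\<^bsub>?A n\<^esub>" if "x \<in> carrier (?A (n + 2))" for x
    using dE(2)[where n="n + 1" and x=x] that by (simp add: add.assoc)
  have tm: "module R (tensor R (?A i) (?C j))" for i j by (rule tensor_module[OF mE mB])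
  have tN: "module R (tensor R (?A i) N)" for i by (rule tensor_module[OF mE N])
  define v where "v = ?t (?A n) (?C 1) (?A n) (?C 0) (\<lambda>x. x) (bd B 1) a"
  have vc: "v \<in> carrier (tensor R (?A n) (?C 0))"
    unfolding v_def by (rule linear_closed[OF tensor_map_linear[OF mE mB mE mB linear_id b1] a])
  have v0: "?t (?A n) (?C 0) (?A (n - 1)) (?C 0) (bd E n) (\<lambda>y. y) v = \<zero>\<^bsub>tensor R (?A (n - 1)) (?C 0)\<^esub>"
    unfolding v_def using tensor_map_comp[OF mE mB mE mB mE mB linear_id b1 d0 linear_id a] a0 by simp
  \<comment> \<open>As \<open>B\<^sub>0\<close> has rank one, tensoring with it does not change \<open>E\<close>, so \<open>v\<close> lifts along \<open>\<partial> \<otimes> 1\<close>.\<close>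
  have \<psi>l: "\<psi> \<in> linear_maps R (regular_module R) (?C 0)" using \<psi> by (simp add: linear_isos_def)
  obtain \<psi>' where \<psi>': "\<psi>' \<in> linear_isos R (?C 0) (regular_module R)"
    "\<And>x. x \<in> carrier (regular_module R) \<Longrightarrow> \<psi>' (\<psi> x) = x"
    by (rule linear_iso_inverse[OF \<psi> regular_module_module mB]) blast
  have \<psi>'l: "\<psi>' \<in> linear_maps R (?C 0) (regular_module R)" using \<psi>'(1) by (simp add: linear_isos_def)
  let ?e = "\<psi> \<one>"
  have e: "?e \<in> carrier (?C 0)" using linear_closed[OF \<psi>l, of \<one>] by simp
  have pe: "\<psi>' ?e = \<one>" using \<psi>'(2)[of \<one>] by simp
  obtain x where x: "x \<in> carrier (?A n)" "v = pure_tensor R (?A n) (?C 0) x ?e"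
    using tensor_rank_one_pure[OF mE mB \<psi> vc] by blast
  obtain \<rho> where \<rho>: "\<rho> \<in> linear_maps R (tensor R (?A (n - 1)) (?C 0)) (?A (n - 1))"
    "\<And>x y. x \<in> carrier (?A (n - 1)) \<Longrightarrow> y \<in> carrier (?C 0) \<Longrightarrow>
      \<rho> (pure_tensor R (?A (n - 1)) (?C 0) x y) = \<psi>' y \<odot>\<^bsub>?A (n - 1)\<^esub> x"
    by (rule tensor_rank_one[OF mE mB \<psi>'l]) blast
  have dx: "bd E n x \<in> carrier (?A (n - 1))" by (rule linear_closed[OF d0 x(1)])
  have "pure_tensor R (?A (n - 1)) (?C 0) (bd E n x) ?e = \<zero>\<^bsub>tensor R (?A (n - 1)) (?C 0)\<^esub>"
    using v0 x e by (simp add: tensor_map_pure[OF mE mB mE mB d0 linear_id])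
  then have "\<psi>' ?e \<odot>\<^bsub>?A (n - 1)\<^esub> bd E n x = \<zero>\<^bsub>?A (n - 1)\<^esub>"
    using \<rho>(2)[OF dx e] linear_zero[OF \<rho>(1) tm mE] by simp
  then have "bd E n x = \<zero>\<^bsub>?A (n - 1)\<^esub>" using module.smult_one[OF mE dx] by (simp add: pe)
  then obtain x' where x': "x' \<in> carrier (?A (n + 1))" "x = bd E (n + 1) x'"
    using exE[OF n x(1)] by blast
  define w where "w = pure_tensor R (?A (n + 1)) (?C 0) x' ?e"
  have wc: "w \<in> carrier (tensor R (?A (n + 1)) (?C 0))" unfolding w_def by (rule pure_closed[OF mE mB x'(1) e])
  have wv: "?t (?A (n + 1)) (?C 0) (?A n) (?C 0) (bd E (n + 1)) (\<lambda>y. y) w = v"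
    unfolding w_def x(2) x'(2) by (rule tensor_map_pure[OF mE mB mE mB d1 linear_id x'(1) e])
  \<comment> \<open>The image of \<open>w\<close> in \<open>E \<otimes> N\<close> is a cycle, because \<open>\<eta> \<partial> = 0\<close>.\<close>
  define wb where "wb = ?t (?A (n + 1)) (?C 0) (?A (n + 1)) N (\<lambda>x. x) \<eta> w"
  have wbc: "wb \<in> carrier (tensor R (?A (n + 1)) N)"
    unfolding wb_def by (rule linear_closed[OF tensor_map_linear[OF mE mB mE N linear_id \<eta>l] wc])
  have "?t (?A (n + 1)) N (?A n) N (bd E (n + 1)) (\<lambda>y. y) wb
      = ?t (?A n) (?C 0) (?A n) N (\<lambda>x. x) \<eta> (?t (?A (n + 1)) (?C 0) (?A n) (?C 0) (bd E (n + 1)) (\<lambda>y. y) w)"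
    unfolding wb_def
    using tensor_map_comp[OF mE mB mE N mE N linear_id \<eta>l d1 linear_id wc]
      tensor_map_comp[OF mE mB mE mB mE N d1 linear_id linear_id \<eta>l wc] by simp
  also have "\<dots> = \<zero>\<^bsub>tensor R (?A n) N\<^esub>"
    unfolding wv v_def
    using tensor_map_comp[OF mE mB mE mB mE N linear_id b1 linear_id \<eta>l a]
      tensor_map_zero[OF mE mB mE N linear_id linear_comp[OF \<eta>l b1] _ a] \<eta>k linear_closed[OF b1] by auto
  finally have "wb \<in> cycles (tensor_cplx_module R E N) (n + 1)"
    using wbc by (simp add: cycles_def tensor_cplx_module_def)
  then have "wb \<in> boundaries (tensor_cplx_module R E N) (n + 1)" using tor[of "n + 1"] n by auto
  moreover have "boundaries (tensor_cplx_module R E N) (n + 1)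
      = ?t (?A (n + 2)) N (?A (n + 1)) N (bd E (n + 2)) (\<lambda>y. y) ` carrier (tensor R (?A (n + 2)) N)"
  proof -
    have e: "n + 1 + 1 = n + 2" "n + 2 - 1 = n + 1" by simp_all
    show ?thesis by (simp only: boundaries_def tensor_cplx_module_def cplx.simps e)
  qed
  ultimately obtain tb where tb: "tb \<in> carrier (tensor R (?A (n + 2)) N)"
    "wb = ?t (?A (n + 2)) N (?A (n + 1)) N (bd E (n + 2)) (\<lambda>y. y) tb" by blast
  obtain t where t: "t \<in> carrier (tensor R (?A (n + 2)) (?C 0))"
    "tb = ?t (?A (n + 2)) (?C 0) (?A (n + 2)) N (\<lambda>x. x) \<eta> t"
    using tensor_map_surj[OF mE mB mE N linear_id \<eta>l _ \<eta>s tb(1)] by auto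
  let ?dt = "?t (?A (n + 2)) (?C 0) (?A (n + 1)) (?C 0) (bd E (n + 2)) (\<lambda>y. y) t"
  have dtc: "?dt \<in> carrier (tensor R (?A (n + 1)) (?C 0))"
    by (rule linear_closed[OF tensor_map_linear[OF mE mB mE mB d2 linear_id] t(1)])
  interpret W: module R "tensor R (?A (n + 1)) (?C 0)" by (rule tm)
  interpret WN: module R "tensor R (?A (n + 1)) N" by (rule tN)
  have "?t (?A (n + 1)) (?C 0) (?A (n + 1)) N (\<lambda>x. x) \<eta> ?dt = wb"
    unfolding tb(2) t(2)
    using tensor_map_comp[OF mE mB mE mB mE N d2 linear_id linear_id \<eta>l t(1)]
      tensor_map_comp[OF mE mB mE N mE N linear_id \<eta>l d2 linear_id t(1)] by simp
  then have "?t (?A (n + 1)) (?C 0) (?A (n + 1)) N (\<lambda>x. x) \<eta> (w \<ominus>\<^bsub>tensor R (?A (n + 1)) (?C 0)\<^esub> ?dt)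
      = \<zero>\<^bsub>tensor R (?A (n + 1)) N\<^esub>"
    using linear_minus[OF tensor_map_linear[OF mE mB mE N linear_id \<eta>l] tm tN wc dtc] wbc
    by (simp add: wb_def[symmetric] WN.minus_eq WN.r_neg)
  then have "w \<ominus>\<^bsub>tensor R (?A (n + 1)) (?C 0)\<^esub> ?dt
      \<in> ?t (?A (n + 1)) (?C 1) (?A (n + 1)) (?C 0) (\<lambda>x. x) (bd B 1) ` carrier (tensor R (?A (n + 1)) (?C 1))"
    by (intro free_tensor_exact[OF fE mB mB N b1 \<eta>l]) (use \<eta>k wc dtc in auto)
  then obtain s where s: "s \<in> carrier (tensor R (?A (n + 1)) (?C 1))"
    "w \<ominus>\<^bsub>tensor R (?A (n + 1)) (?C 0)\<^esub> ?dt = ?t (?A (n + 1)) (?C 1) (?A (n + 1)) (?C 0) (\<lambda>x. x) (bd B 1) s"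
    by blast
  \<comment> \<open>The correction by \<open>?dt\<close> is invisible after \<open>\<partial> \<otimes> 1\<close>, so \<open>v\<close> is also the image of \<open>(\<partial> \<otimes> 1) s\<close>.\<close>
  let ?DD = "?t (?A (n + 1)) (?C 0) (?A n) (?C 0) (bd E (n + 1)) (\<lambda>y. y)"
  interpret V: module R "tensor R (?A n) (?C 0)" by (rule tm)
  have "?DD ?dt = \<zero>\<^bsub>tensor R (?A n) (?C 0)\<^esub>"
    using tensor_map_comp[OF mE mB mE mB mE mB d2 linear_id d1 linear_id t(1)]
      tensor_map_zero[OF mE mB mE mB linear_comp[OF d1 d2] linear_id _ t(1)] dd2 by simp
  then have "?DD (w \<ominus>\<^bsub>tensor R (?A (n + 1)) (?C 0)\<^esub> ?dt) = v"
    using linear_minus[OF tensor_map_linear[OF mE mB mE mB d1 linear_id] tm tm wc dtc] wv vc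
    by (simp add: V.minus_eq)
  then have vs: "v = ?t (?A n) (?C 1) (?A n) (?C 0) (\<lambda>x. x) (bd B 1)
      (?t (?A (n + 1)) (?C 1) (?A n) (?C 1) (bd E (n + 1)) (\<lambda>y. y) s)"
    unfolding s(2)
    using tensor_map_comp[OF mE mB mE mB mE mB linear_id b1 d1 linear_id s(1)]
      tensor_map_comp[OF mE mB mE mB mE mB d1 linear_id linear_id b1 s(1)] by simp
  let ?ds = "?t (?A (n + 1)) (?C 1) (?A n) (?C 1) (bd E (n + 1)) (\<lambda>y. y) s"
  have dsc: "?ds \<in> carrier (tensor R (?A n) (?C 1))"
    by (rule linear_closed[OF tensor_map_linear[OF mE mB mE mB d1 linear_id] s(1)])
  interpret U: module R "tensor R (?A n) (?C 1)" by (rule tm)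
  have "?t (?A n) (?C 1) (?A n) (?C 0) (\<lambda>x. x) (bd B 1) (a \<ominus>\<^bsub>tensor R (?A n) (?C 1)\<^esub> ?ds)
      = \<zero>\<^bsub>tensor R (?A n) (?C 0)\<^esub>"
    using linear_minus[OF tensor_map_linear[OF mE mB mE mB linear_id b1] tm tm a dsc] vs vc
    by (simp add: v_def[symmetric] V.minus_eq V.r_neg)
  then have "a \<ominus>\<^bsub>tensor R (?A n) (?C 1)\<^esub> ?ds
      \<in> ?t (?A n) (?C 2) (?A n) (?C 1) (\<lambda>x. x) (bd B 2) ` carrier (tensor R (?A n) (?C 2))"
    by (intro free_tensor_exact[OF fE mB mB mB b2 b1]) (use exB[of 1] a dsc in auto)
  then obtain r where r: "r \<in> carrier (tensor R (?A n) (?C 2))"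
    "a \<ominus>\<^bsub>tensor R (?A n) (?C 1)\<^esub> ?ds = ?t (?A n) (?C 2) (?A n) (?C 1) (\<lambda>x. x) (bd B 2) r" by blast
  have "a = ?ds \<oplus>\<^bsub>tensor R (?A n) (?C 1)\<^esub> ?t (?A n) (?C 2) (?A n) (?C 1) (\<lambda>x. x) (bd B 2) r"
    unfolding r(2)[symmetric] using a dsc by (simp add: U.minus_eq U.a_comm[of ?ds] U.a_assoc U.l_neg)
  then show ?thesis using s(1) r(1) by blast
qed

text \<open>The zigzag starts in bidegree \<open>(n, 1)\<close>, where the previous lemma applies. Its hypothesis that
\<open>\<partial> \<otimes> \<partial>\<close> kills the corner component is the cycle condition of the star product if \<open>n = 1\<close>. If
\<open>n \<ge> 2\<close>, it follows from the cycle condition in bidegree \<open>(n - 1, 1)\<close> by applying \<open>1 \<otimes> \<partial>\<close>.\<close>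

lemma star_exact:
  assumes fE: "\<And>n. is_free R (component E n)" and N: "module R N"
    and exE: "\<And>n x. n \<ge> 1 \<Longrightarrow> x \<in> carrier (component E n) \<Longrightarrow> bd E n x = \<zero>\<^bsub>component E (n - 1)\<^esub> \<Longrightarrow>
      x \<in> bd E (n + 1) ` carrier (component E (n + 1))"
    and exB: "\<And>n x. n \<ge> 1 \<Longrightarrow> x \<in> carrier (component B n) \<Longrightarrow> bd B n x = \<zero>\<^bsub>component B (n - 1)\<^esub> \<Longrightarrow>
      x \<in> bd B (n + 1) ` carrier (component B (n + 1))"
    and \<eta>: "is_augmentation R B N \<eta>"
    and \<psi>: "\<psi> \<in> linear_isos R (regular_module R) (component B 0)"
    and tor: "\<And>n. n \<ge> 1 \<Longrightarrow> cycles (tensor_cplx_module R E N) n \<subseteq> boundaries (tensor_cplx_module R E N) n"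
    and n: "n \<ge> 1"
  shows "cycles SS n = boundaries SS n"
proof
  show "boundaries SS n \<subseteq> cycles SS n"
    using complex_bd_up[OF star_complex] linear_closed[OF complex_bd_up(1)[OF star_complex]]
    by (auto simp: boundaries_def cycles_def)
  show "cycles SS n \<subseteq> boundaries SS n"
  proof
    fix u assume cyc: "u \<in> cycles SS n"
    let ?A = "component E" and ?C = "component B" and ?t = "tensor_map R"
    have u: "u \<in> carrier (component TT (n + 1))"
      using cyc n by (simp add: cycles_def star_component(1))
    have a: "u (n, 1) \<in> carrier (tensor R (?A n) (?C 1))"
      using star_summand_closed[OF u, of n 1] n by (simp add: trunc_simps)
    have b1: "bd B 1 \<in> linear_maps R (?C 1) (?C 0)" using dB(1)[of 0] by simp
    have b2: "bd B 2 \<in> linear_maps R (?C 2) (?C 1)" using dB(1)[of 1] by simp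
    have d0: "bd E n \<in> linear_maps R (?A n) (?A (n - 1))" using dE(1)[of "n - 1"] by simp
    have ubd: "bd TT (n + 1) u = \<zero>\<^bsub>component TT n\<^esub> \<and>
       ?t (?A n) (?C 1) (?A (n - 1)) (?C 0) (bd E n) (bd B 1) (u (n, 1)) = \<zero>\<^bsub>tensor R (?A (n - 1)) (?C 0)\<^esub>"
    proof (cases "n = 1")
      case True
      have "bd SS 1 u = \<zero>\<^bsub>component SS 0\<^esub>" using cyc True by (simp add: cycles_def)
      from fun_cong[OF this, of "(0, 0)"]
      have 1: "?t (?A 1) (?C 1) (?A 0) (?C 0) (bd E 1) (bd B 1) (u (1, 1)) = \<zero>\<^bsub>tensor R (?A 0) (?C 0)\<^esub>"
        by (simp add: star_bd(2) star_component(2) direct_sum_zero)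
      have "bd TT 2 u = \<zero>\<^bsub>component TT 1\<^esub>"
      proof (rule direct_sum_eqI)
        show "bd TT 2 u \<in> carrier (direct_sum (bidegrees 1) DD)"
          using linear_closed[OF DC.Tot_bd_linear[of 2], folded T_eq] u True by (simp add: tensor_trunc_component)
        interpret T1: module R "component TT 1" unfolding T_eq by (rule DC.Tot_component_module)
        show "\<zero>\<^bsub>component TT 1\<^esub> \<in> carrier (direct_sum (bidegrees 1) DD)"
          using T1.zero_closed by (simp add: tensor_trunc_component)
        fix pq assume pq: "pq \<in> bidegrees 1"
        obtain p q where e: "pq = (p, q)" "p + q = 1" using pq by (auto simp: bidegrees_def)
        have "carrier (DD pq) = {\<zero>\<^bsub>DD pq\<^esub>}" unfolding e(1) by (rule summand_zero) (use e in auto)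
        moreover have "bd TT 2 u pq \<in> carrier (DD pq)"
          using \<open>bd TT 2 u \<in> carrier (direct_sum (bidegrees 1) DD)\<close> pq by (simp add: direct_sum_carrier)
        moreover have "\<zero>\<^bsub>component TT 1\<^esub> pq = \<zero>\<^bsub>DD pq\<^esub>" using pq by (simp add: tensor_trunc_component direct_sum_zero)
        ultimately show "bd TT 2 u pq = \<zero>\<^bsub>component TT 1\<^esub> pq" by simp
      qed
      then show ?thesis using 1 True by simp
    next
      case False
      then have n2: "n \<ge> 2" using n by simp
      have T0: "bd TT (n + 1) u = \<zero>\<^bsub>component TT n\<^esub>"
        using cyc n2 by (simp add: cycles_def star_component(1) star_bd(1))
      let ?P = "tensor R (?A (n - 1)) (?C 1)" and ?Q = "tensor R (?A (n - 1)) (?C 0)"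
      let ?h = "?t (?A n) (?C 1) (?A (n - 1)) (?C 1) (bd E n) (\<lambda>y. y) (u (n, 1))"
      let ?v = "?t (?A (n - 1)) (?C 2) (?A (n - 1)) (?C 1) (\<lambda>x. x) (bd B 2) (u (n - 1, 2))"
      let ?d = "?t (?A (n - 1)) (?C 1) (?A (n - 1)) (?C 0) (\<lambda>x. x) (bd B 1)"
      have u2: "u (n - 1, 2) \<in> carrier (tensor R (?A (n - 1)) (?C 2))"
        using star_summand_closed[OF u, of "n - 1" 2] n2 by (simp add: trunc_simps)
      have hc: "?h \<in> carrier ?P" by (rule linear_closed[OF tensor_map_linear[OF mE mB mE mB d0 linear_id] a])
      have vc: "?v \<in> carrier ?P" by (rule linear_closed[OF tensor_map_linear[OF mE mB mE mB linear_id b2] u2])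
      have P: "module R ?P" and Q: "module R ?Q" by (rule tensor_module[OF mE mB])+
      interpret P: module R ?P by (rule P)
      interpret Q: module R ?Q by (rule Q)
      have "bd TT (n + 1) u (n - 1, 1) = \<zero>\<^bsub>?P\<^esub>"
        using n2 by (simp add: T0 tensor_trunc_component direct_sum_zero bidegrees_def trunc_simps)
      then have "?h \<oplus>\<^bsub>?P\<^esub> sign_twist (n - 1) ?P ?v = \<zero>\<^bsub>?P\<^esub>"
        using tensor_trunc_bd_at[of "n - 1" 1 "n + 1" u] n2 by (simp add: trunc_simps)
      then have "?d (?h \<oplus>\<^bsub>?P\<^esub> sign_twist (n - 1) ?P ?v) = \<zero>\<^bsub>?Q\<^esub>"
        using linear_zero[OF tensor_map_linear[OF mE mB mE mB linear_id b1] P Q] by simp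
      moreover have "?d ?v = \<zero>\<^bsub>?Q\<^esub>"
        using tensor_map_comp[OF mE mB mE mB mE mB linear_id b2 linear_id b1 u2]
          tensor_map_zero[OF mE mB mE mB linear_id linear_comp[OF b1 b2] _ u2] dB(2)[where n=1] by simp
      moreover have "?d (?h \<oplus>\<^bsub>?P\<^esub> sign_twist (n - 1) ?P ?v) = ?d ?h \<oplus>\<^bsub>?Q\<^esub> sign_twist (n - 1) ?Q (?d ?v)"
        using linear_add[OF tensor_map_linear[OF mE mB mE mB linear_id b1] hc sign_twist_props(1)[OF P vc]]
          linear_sign_twist[OF tensor_map_linear[OF mE mB mE mB linear_id b1] P Q vc] by simp
      moreover have dhc: "?d ?h \<in> carrier ?Q" by (rule linear_closed[OF tensor_map_linear[OF mE mB mE mB linear_id b1] hc])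
      ultimately have "?d ?h = \<zero>\<^bsub>?Q\<^esub>"
        using linear_zero[OF sign_twist_linear[OF Q, of "n - 1"] Q Q] by simp
      then show ?thesis using T0 tensor_map_comp[OF mE mB mE mB mE mB d0 linear_id linear_id b1 a] by simp
    qed
    obtain s r where s: "s \<in> carrier (tensor R (?A (n + 1)) (?C 1))" and r: "r \<in> carrier (tensor R (?A n) (?C 2))"
      and start: "u (n, 1) = ?t (?A (n + 1)) (?C 1) (?A n) (?C 1) (bd E (n + 1)) (\<lambda>y. y) s
        \<oplus>\<^bsub>tensor R (?A n) (?C 1)\<^esub> ?t (?A n) (?C 2) (?A n) (?C 1) (\<lambda>x. x) (bd B 2) r"
      using star_corner_step[OF fE N exE exB \<eta> \<psi> tor n a conjunct2[OF ubd]] by blast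
    have m1: "module R (tensor R (?A n) (?C i))" for i by (rule tensor_module[OF mE mB])
    \<comment> \<open>The differential of the total complex twists the second summand, so \<open>r\<close> is twisted in advance.\<close>
    let ?r = "sign_twist n (tensor R (?A n) (?C 2)) r"
    have "\<exists>w\<in>carrier (component (total_complex DD DH DV) (n + 1 + 1)). bd (total_complex DD DH DV) (n + 1 + 1) w = u"
    proof (rule DC.Tot_zigzag[where s=s and r="?r"])
      show "carrier (DD (p, q)) = {\<zero>\<^bsub>DD (p, q)\<^esub>}" if "p < 1 \<or> q < 1" for p q by (rule summand_zero[OF that])
      show "u \<in> carrier (component (total_complex DD DH DV) (n + 1))" using u T_eq by simp
      show "bd (total_complex DD DH DV) (n + 1) u = \<zero>\<^bsub>component (total_complex DD DH DV) (n + 1 - 1)\<^esub>"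
        using ubd T_eq by simp
      show "s \<in> carrier (DD (n + 1, 1))" using s n by (simp add: trunc_simps)
      show "?r \<in> carrier (DD (n + 1 - 1, 2))" using sign_twist_props(1)[OF m1 r] n by (simp add: trunc_simps)
      have "sign_twist n (tensor R (?A n) (?C 1)) (?t (?A n) (?C 2) (?A n) (?C 1) (\<lambda>x. x) (bd B 2) ?r)
          = ?t (?A n) (?C 2) (?A n) (?C 1) (\<lambda>x. x) (bd B 2) r"
        using linear_sign_twist[OF tensor_map_linear[OF mE mB mE mB linear_id b2] m1 m1 r, of n]
          sign_twist_props(2)[OF m1 linear_closed[OF tensor_map_linear[OF mE mB mE mB linear_id b2] r]] by simp
      then show "u (n + 1 - 1, 1) = DH (n + 1 - 1) 1 s \<oplus>\<^bsub>DD (n + 1 - 1, 1)\<^esub>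
          sign_twist (n + 1 - 1) (DD (n + 1 - 1, 1)) (DV (n + 1 - 1) 1 ?r)"
        using start n by (simp add: trunc_simps)
      show "\<exists>w\<in>carrier (DD (p, q + 1)). DV p q w = z"
        if q: "q \<ge> 2" and z: "z \<in> carrier (DD (p, q))" and z0: "DV p (q - 1) z = \<zero>\<^bsub>DD (p, q - 1)\<^esub>" for p q z
      proof (cases "p \<ge> 1")
        case True
        have bq: "bd B (q + 1) \<in> linear_maps R (?C (q + 1)) (?C q)" by (rule dB(1))
        have bq1: "bd B q \<in> linear_maps R (?C q) (?C (q - 1))" using dB(1)[of "q - 1"] by simp
        have "z \<in> ?t (?A p) (?C (q + 1)) (?A p) (?C q) (\<lambda>x. x) (bd B (q + 1)) ` carrier (tensor R (?A p) (?C (q + 1)))"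
          by (rule free_tensor_exact[OF fE mB mB mB bq bq1 exB])
            (use q z z0 True in \<open>auto simp: trunc_simps\<close>)
        then show ?thesis using q True by (auto simp: trunc_simps)
      next
        case False
        then have "z = \<zero>\<^bsub>DD (p, q)\<^esub>" using summand_zero[of p q] z by auto
        moreover have "DV p q \<zero>\<^bsub>DD (p, q + 1)\<^esub> = \<zero>\<^bsub>DD (p, q)\<^esub>"
          by (rule linear_zero[OF DC.dv_linear star_summand_module star_summand_module])
        moreover have "\<zero>\<^bsub>DD (p, q + 1)\<^esub> \<in> carrier (DD (p, q + 1))"
          using summand_zero[of p "q + 1"] False by auto
        ultimately show ?thesis by blast
      qed
    qed
    then show "u \<in> boundaries SS n"
      using n T_eq by (auto simp: boundaries_def star_component(1) star_bd(1))
  qed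
qed

end

end

section \<open>Freeness of tensor products and direct sums\<close>

context base_ring begin

lemma tensor_is_free:
  assumes M: "is_free R M" and N: "is_free R N" and one: "\<one> \<noteq> \<zero>"
  shows "is_free R (tensor R M N)"
proof -
  have mM: "module R M" and mN: "module R N" using M N by (auto simp: is_free_def)
  obtain A \<kappa> where c: "basis_coords R M A \<kappa> (\<lambda>b. b)" using is_free_coords[OF M] .
  obtain B \<mu> where d: "basis_coords R N B \<mu> (\<lambda>b. b)" using is_free_coords[OF N] .
  show ?thesis
    by (rule tensor_coords[OF mM mN c d], rule coords_is_free[OF tensor_module[OF mM mN] _ one])
qed

lemma direct_sum_is_free:
  assumes M: "\<And>i. i \<in> A \<Longrightarrow> is_free R (M i)" and one: "\<one> \<noteq> \<zero>"
  shows "is_free R (direct_sum A M)"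
proof -
  have m: "module R (M i)" if "i \<in> A" for i using M[OF that] by (simp add: is_free_def)
  have "\<forall>i\<in>A. \<exists>B \<kappa>. basis_coords R (M i) B \<kappa> (\<lambda>b. b)" using is_free_coords[OF M] by metis
  then obtain B \<kappa> where c: "\<And>i. i \<in> A \<Longrightarrow> basis_coords R (M i) (B i) (\<kappa> i) (\<lambda>b. b)" by metis
  show ?thesis by (rule coords_is_free[OF direct_sum_module[OF m] direct_sum_coords[OF m c] one])
qed

lemma zero_submodule_is_free:
  assumes "module R M" "\<one> \<noteq> \<zero>" shows "is_free R (zero_submodule M)"
  by (rule coords_is_free[OF zero_submodule_module[OF assms(1)] zero_module_coords[OF zero_submodule_module[OF assms(1)]] assms(2)])
    simp

lemma star_is_free:
  assumes E: "is_complex R E" and B: "is_complex R B"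
    and fE: "\<And>n. is_free R (component E n)" and fB: "\<And>n. is_free R (component B n)" and one: "\<one> \<noteq> \<zero>"
  shows "is_free R (component (star_product R E B) n)"
proof -
  have t: "is_free R (component (trunc_ge1 C) q)"
    if "is_complex R C" "\<And>n. is_free R (component C n)" for C :: "('a, 'z) cplx" and q
    using that zero_submodule_is_free[OF is_complexD(1) one] by (cases "q \<ge> 1") (auto simp: trunc_simps)
  have s: "is_free R (component (tensor_cplx R (trunc_ge1 E) (trunc_ge1 B)) n)" for n
    unfolding tensor_trunc_component[OF E B]
    by (rule direct_sum_is_free[OF _ one]) (auto intro!: tensor_is_free[OF _ _ one] t E B fE fB)
  consider "n \<ge> 1" | "n = 0" | "n < 0" by linarith
  then show ?thesis
  proof cases
    case 1 then show ?thesis using s by (simp add: star_component[OF E B])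
  next
    case 2 then show ?thesis
      by (simp add: star_component[OF E B] direct_sum_is_free[OF tensor_is_free[OF fE fB one] one])
  next
    case 3 then show ?thesis
      using s[of "n + 1"] zero_submodule_is_free[OF _ one] unfolding star_component(3)[OF E B 3] is_free_def
      by blast
  qed
qed

end

section \<open>Graded free modules\<close>

definition homogeneous_sum ::
  "('a, 'm) module \<Rightarrow> (int \<Rightarrow> 'm set) \<Rightarrow> (int \<Rightarrow> 'm) \<Rightarrow> 'm \<Rightarrow> bool" where
  "homogeneous_sum M H c x \<longleftrightarrow> (\<forall>d. c d \<in> H d) \<and> finite {d. c d \<noteq> \<zero>\<^bsub>M\<^esub>} \<and>
     x = (\<Oplus>\<^bsub>M\<^esub>d\<in>{d. c d \<noteq> \<zero>\<^bsub>M\<^esub>}. c d)"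

text \<open>The consequences of a standard grading that the theory of graded free modules uses.\<close>

locale graded_base_ring = base_ring R for R :: "('a, 'r) ring_scheme" (structure) +
  fixes G :: "int \<Rightarrow> 'a set"
  assumes grading: "graded_module R G (regular_module R) G"
    and one_degree: "\<one> \<in> G 0" and one_not_zero: "\<one> \<noteq> \<zero>"
begin

lemma homogeneous_sum_superset:
  assumes M: "module R M" and c: "\<And>d. c d \<in> carrier M" and S: "finite S" "{d. c d \<noteq> \<zero>\<^bsub>M\<^esub>} \<subseteq> S"
  shows "(\<Oplus>\<^bsub>M\<^esub>d\<in>{d. c d \<noteq> \<zero>\<^bsub>M\<^esub>}. c d) = (\<Oplus>\<^bsub>M\<^esub>d\<in>S. c d)"
proof -
  interpret M: module R M by fact
  show ?thesis by (rule M.add.finprod_mono_neutral_cong_left) (use S c in auto)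
qed

lemma homogeneous_sumI:
  assumes M: "module R M" and sub: "\<And>d. H d \<subseteq> carrier M"
    and c: "\<And>d. c d \<in> H d" and S: "finite S" "{d. c d \<noteq> \<zero>\<^bsub>M\<^esub>} \<subseteq> S" and x: "x = (\<Oplus>\<^bsub>M\<^esub>d\<in>S. c d)"
  shows "homogeneous_sum M H c x"
proof -
  have "c d \<in> carrier M" for d using c sub by blast
  then show ?thesis
    using homogeneous_sum_superset[OF M _ S] c finite_subset[OF S(2,1)] x by (simp add: homogeneous_sum_def)
qed

lemma homogeneous_sum_add:
  assumes M: "module R M" and sub: "\<And>d. H d \<subseteq> carrier M"
    and add: "\<And>d x y. x \<in> H d \<Longrightarrow> y \<in> H d \<Longrightarrow> x \<oplus>\<^bsub>M\<^esub> y \<in> H d"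
    and x: "homogeneous_sum M H c x" and y: "homogeneous_sum M H c' y"
  shows "homogeneous_sum M H (\<lambda>d. c d \<oplus>\<^bsub>M\<^esub> c' d) (x \<oplus>\<^bsub>M\<^esub> y)"
proof -
  interpret M: module R M by fact
  let ?S = "{d. c d \<noteq> \<zero>\<^bsub>M\<^esub>} \<union> {d. c' d \<noteq> \<zero>\<^bsub>M\<^esub>}"
  have cH: "c d \<in> H d" "c' d \<in> H d" for d using x y by (auto simp: homogeneous_sum_def)
  have cc: "c d \<in> carrier M" "c' d \<in> carrier M" for d using cH[of d] sub[of d] by auto
  have S: "finite ?S" using x y by (simp add: homogeneous_sum_def)
  have "x = (\<Oplus>\<^bsub>M\<^esub>d\<in>?S. c d)" "y = (\<Oplus>\<^bsub>M\<^esub>d\<in>?S. c' d)"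
    using x y homogeneous_sum_superset[OF M cc(1) S] homogeneous_sum_superset[OF M cc(2) S]
    by (auto simp: homogeneous_sum_def)
  then have xy: "x \<oplus>\<^bsub>M\<^esub> y = (\<Oplus>\<^bsub>M\<^esub>d\<in>?S. c d \<oplus>\<^bsub>M\<^esub> c' d)"
    using cc by (simp add: M.finsum_addf)
  show ?thesis by (rule homogeneous_sumI[OF M sub _ S _ xy]) (use add cH in auto)
qed

text \<open>A linear map that shifts degrees by \<open>k\<close> transports decompositions. It is applied to the
multiples of a homogeneous basis element and to the coordinate functions.\<close>

lemma homogeneous_sum_linear:
  assumes M: "module R M" and N: "module R N" and h: "h \<in> linear_maps R M N"
    and sub: "\<And>d. H d \<subseteq> carrier M" and sub': "\<And>d. H' d \<subseteq> carrier N"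
    and hH: "\<And>d x. x \<in> H d \<Longrightarrow> h x \<in> H' (d + k)"
    and x: "homogeneous_sum M H c x"
  shows "homogeneous_sum N H' (\<lambda>d. h (c (d - k))) (h x)"
proof -
  interpret N: module R N by fact
  let ?S = "{d. c d \<noteq> \<zero>\<^bsub>M\<^esub>}"
  have cH: "c d \<in> H d" for d using x by (simp add: homogeneous_sum_def)
  have cc: "c d \<in> carrier M" for d using cH[of d] sub[of d] by auto
  have hc: "h (c d) \<in> carrier N" for d by (rule linear_closed[OF h cc])
  have fin: "finite ?S" and xe: "x = (\<Oplus>\<^bsub>M\<^esub>d\<in>?S. c d)" using x by (auto simp: homogeneous_sum_def)
  have "h x = (\<Oplus>\<^bsub>N\<^esub>d\<in>?S. h (c d))"
    unfolding xe by (rule linear_finsum[OF h M N cc])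
  also have "\<dots> = (\<Oplus>\<^bsub>N\<^esub>d\<in>?S. h (c ((d + k) - k)))" by simp
  also have "\<dots> = (\<Oplus>\<^bsub>N\<^esub>d\<in>(\<lambda>d. d + k) ` ?S. h (c (d - k)))"
    by (rule N.finsum_reindex[symmetric]) (use hc in \<open>auto simp: inj_on_def\<close>)
  finally have e: "h x = (\<Oplus>\<^bsub>N\<^esub>d\<in>(\<lambda>d. d + k) ` ?S. h (c (d - k)))" .
  show ?thesis
  proof (rule homogeneous_sumI[OF N sub' _ _ _ e])
    show "h (c (d - k)) \<in> H' d" for d using hH[OF cH[of "d - k"]] by simp
    show "finite ((\<lambda>d. d + k) ` ?S)" using fin by simp
    show "{d. h (c (d - k)) \<noteq> \<zero>\<^bsub>N\<^esub>} \<subseteq> (\<lambda>d. d + k) ` ?S"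
    proof
      fix d assume "d \<in> {d. h (c (d - k)) \<noteq> \<zero>\<^bsub>N\<^esub>}"
      then have "c (d - k) \<noteq> \<zero>\<^bsub>M\<^esub>" using linear_zero[OF h M N] by auto
      then show "d \<in> (\<lambda>d. d + k) ` ?S" by (intro image_eqI[of _ _ "d - k"]) auto
    qed
  qed
qed

lemma graded_module_iff: "graded_module R G M H \<longleftrightarrow>
     module R M \<and> (\<forall>d. subgroup (H d) (add_monoid M)) \<and>
     (\<forall>i d. \<forall>r \<in> G i. \<forall>x \<in> H d. r \<odot>\<^bsub>M\<^esub> x \<in> H (i + d)) \<and>
     (\<forall>x \<in> carrier M. \<exists>!c. homogeneous_sum M H c x)"
  by (simp add: graded_module_def homogeneous_sum_def)

lemma graded_moduleD:
  assumes "graded_module R G M H"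
  shows "module R M" "H d \<subseteq> carrier M" "\<zero>\<^bsub>M\<^esub> \<in> H d"
    "x \<in> H d \<Longrightarrow> y \<in> H d \<Longrightarrow> x \<oplus>\<^bsub>M\<^esub> y \<in> H d"
    "r \<in> G i \<Longrightarrow> x \<in> H j \<Longrightarrow> i + j = d \<Longrightarrow> r \<odot>\<^bsub>M\<^esub> x \<in> H d"
    "x \<in> carrier M \<Longrightarrow> \<exists>!c. homogeneous_sum M H c x"
proof -
  note g = assms[unfolded graded_module_iff]
  show "module R M" using g by blast
  have s: "subgroup (H d) (add_monoid M)" using g by blast
  show "H d \<subseteq> carrier M" "\<zero>\<^bsub>M\<^esub> \<in> H d" using subgroup.subset[OF s] subgroup.one_closed[OF s] by auto
  show "x \<oplus>\<^bsub>M\<^esub> y \<in> H d" if "x \<in> H d" "y \<in> H d" using subgroup.m_closed[OF s that] by simp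
  show "r \<odot>\<^bsub>M\<^esub> x \<in> H d" if "r \<in> G i" "x \<in> H j" "i + j = d" using g that by blast
  show "\<exists>!c. homogeneous_sum M H c x" if "x \<in> carrier M" using g that by blast
qed

lemma G_sub: "G d \<subseteq> carrier R" and G_zero: "\<zero> \<in> G d"
  and G_add: "x \<in> G d \<Longrightarrow> y \<in> G d \<Longrightarrow> x \<oplus> y \<in> G d"
  and G_mult: "r \<in> G i \<Longrightarrow> x \<in> G j \<Longrightarrow> i + j = d \<Longrightarrow> r \<otimes> x \<in> G d"
  using graded_moduleD[OF grading] by auto

lemma G_decomp: "r \<in> carrier R \<Longrightarrow> \<exists>!c. homogeneous_sum (regular_module R) G c r"
  using graded_moduleD(6)[OF grading] by simp

text \<open>The grading of a free module in which the basis element with index \<open>b\<close> has degree \<open>wt b\<close>. Every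
graded free module has this form, which turns statements about homogeneous components into
statements about coordinates.\<close>

definition coord_grading ::
  "('a, 'm) module \<Rightarrow> 'i set \<Rightarrow> ('m \<Rightarrow> 'i \<Rightarrow> 'a) \<Rightarrow> ('i \<Rightarrow> int) \<Rightarrow> int \<Rightarrow> 'm set" where
  "coord_grading M A \<kappa> wt d = {x \<in> carrier M. \<forall>b\<in>A. \<kappa> x b \<in> G (d - wt b)}"

lemma coord_grading_props:
  assumes M: "module R M" and c: "basis_coords R M A \<kappa> e"
  shows "coord_grading M A \<kappa> wt d \<subseteq> carrier M" "\<zero>\<^bsub>M\<^esub> \<in> coord_grading M A \<kappa> wt d"
    "x \<in> coord_grading M A \<kappa> wt d \<Longrightarrow> y \<in> coord_grading M A \<kappa> wt d \<Longrightarrow> x \<oplus>\<^bsub>M\<^esub> y \<in> coord_grading M A \<kappa> wt d"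
    "r \<in> G i \<Longrightarrow> x \<in> coord_grading M A \<kappa> wt j \<Longrightarrow> i + j = d \<Longrightarrow> r \<odot>\<^bsub>M\<^esub> x \<in> coord_grading M A \<kappa> wt d"
    "b \<in> A \<Longrightarrow> e b \<in> coord_grading M A \<kappa> wt (wt b)"
proof -
  interpret M: module R M by fact
  note cD = basis_coordsD[OF c]
  show "coord_grading M A \<kappa> wt d \<subseteq> carrier M" by (auto simp: coord_grading_def)
  show "\<zero>\<^bsub>M\<^esub> \<in> coord_grading M A \<kappa> wt d"
    using linear_zero[OF cD(1) M free_module_module] by (simp add: coord_grading_def free_zero G_zero)
  show "x \<oplus>\<^bsub>M\<^esub> y \<in> coord_grading M A \<kappa> wt d" if "x \<in> coord_grading M A \<kappa> wt d" "y \<in> coord_grading M A \<kappa> wt d"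
    using that linear_add[OF cD(1)] by (simp add: coord_grading_def free_add G_add)
  show "r \<odot>\<^bsub>M\<^esub> x \<in> coord_grading M A \<kappa> wt d" if r: "r \<in> G i" and x: "x \<in> coord_grading M A \<kappa> wt j" and ij: "i + j = d"
  proof -
    have rc: "r \<in> carrier R" using r G_sub by blast
    have xc: "x \<in> carrier M" using x by (simp add: coord_grading_def)
    have "r \<otimes> \<kappa> x b \<in> G (d - wt b)" if "b \<in> A" for b
      by (rule G_mult[OF r, where j="j - wt b"]) (use x that ij in \<open>auto simp: coord_grading_def\<close>)
    then show ?thesis using rc xc linear_smult[OF cD(1) rc xc] by (simp add: coord_grading_def free_smult)
  qed
  show "e b \<in> coord_grading M A \<kappa> wt (wt b)" if b: "b \<in> A"
    using cD(3,4)[OF b] by (simp add: coord_grading_def free_gen_def one_degree G_zero)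
qed

lemma coord_grading_decomp:
  assumes M: "module R M" and c: "basis_coords R M A \<kappa> e" and x: "x \<in> carrier M"
  shows "\<exists>a. homogeneous_sum M (coord_grading M A \<kappa> wt) a x"
proof -
  interpret M: module R M by fact
  note cD = basis_coordsD[OF c] and p = coord_grading_props[OF M c]
  let ?H = "coord_grading M A \<kappa> wt"
  note l = free_lift_linear[OF M cD(2)]
  have "\<exists>a. homogeneous_sum M ?H a (free_lift R M e f)" if "f \<in> carrier (free_module R A)" for f
    using that
  proof (induction rule: free_induct)
    case zero
    have "homogeneous_sum M ?H (\<lambda>_. \<zero>\<^bsub>M\<^esub>) \<zero>\<^bsub>M\<^esub>"
      by (rule homogeneous_sumI[OF M p(1) p(2), where S="{}"]) auto
    then show ?case using linear_zero[OF l free_module_module M] by (auto simp: free_zero)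
  next
    case (step f r b)
    interpret F: module R "free_module R A" by (rule free_module_module)
    obtain a where a: "homogeneous_sum M ?H a (free_lift R M e f)" using step(4) by blast
    obtain q where q: "homogeneous_sum (regular_module R) G q r" using G_decomp[OF step(2)] by blast
    have eb: "e b \<in> carrier M" by (rule cD(3)[OF step(3)])
    have h: "(\<lambda>r. r \<odot>\<^bsub>M\<^esub> e b) \<in> linear_maps R (regular_module R) M"
      by (rule linear_mapsI) (use eb in \<open>simp_all add: M.smult_l_distr M.smult_assoc1\<close>)
    have "homogeneous_sum M ?H (\<lambda>d. q (d - wt b) \<odot>\<^bsub>M\<^esub> e b) (r \<odot>\<^bsub>M\<^esub> e b)"
      by (rule homogeneous_sum_linear[OF regular_module_module M h _ p(1) _ q])
        (use G_sub p(4)[OF _ p(5)[OF step(3)]] in auto)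
    from homogeneous_sum_add[OF M p(1) p(3) this a]
    have "\<exists>a. homogeneous_sum M ?H a (r \<odot>\<^bsub>M\<^esub> e b \<oplus>\<^bsub>M\<^esub> free_lift R M e f)" by blast
    moreover have "free_lift R M e (r \<odot>\<^bsub>free_module R A\<^esub> free_gen R b \<oplus>\<^bsub>free_module R A\<^esub> f)
        = r \<odot>\<^bsub>M\<^esub> e b \<oplus>\<^bsub>M\<^esub> free_lift R M e f"
      using step(1-3) free_gen_closed[OF step(3)] free_lift_gen[OF M cD(2) step(3)]
      by (simp add: linear_add[OF l] linear_smult[OF l])
    ultimately show ?case by simp
  qed
  from this[OF cD(6)[OF x]] show ?thesis by (simp add: coords_expand[OF M c x])
qed

text \<open>Uniqueness of homogeneous components is inherited from the ring, one coordinate at a time: the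
coordinates at \<open>b\<close> of the components of \<open>x\<close> are, after a shift by \<open>wt b\<close>, the components of the
coordinate of \<open>x\<close> at \<open>b\<close>.\<close>

lemma coord_grading_graded_free:
  assumes M: "module R M" and c: "basis_coords R M A \<kappa> e"
  shows "graded_free R G M (coord_grading M A \<kappa> wt)"
proof -
  interpret M: module R M by fact
  note cD = basis_coordsD[OF c] and p = coord_grading_props[OF M c]
  let ?H = "coord_grading M A \<kappa> wt"
  have kb: "(\<lambda>x. \<kappa> x b) \<in> linear_maps R M (regular_module R)" for b
    by (rule linear_mapsI) (simp_all add: cD(7) linear_add[OF cD(1)] linear_smult[OF cD(1)] free_add free_smult)
  have uniq: "a = a'" if a: "homogeneous_sum M ?H a x" and a': "homogeneous_sum M ?H a' x" and x: "x \<in> carrier M" for a a' x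
  proof
    fix d
    have "\<kappa> (a d) = \<kappa> (a' d)"
    proof
      fix b
      have ac: "a d \<in> carrier M" "a' d \<in> carrier M" using a a' by (auto simp: homogeneous_sum_def intro: subsetD[OF p(1)])
      show "\<kappa> (a d) b = \<kappa> (a' d) b"
      proof (cases "b \<in> A")
        case True
        have hs: "homogeneous_sum (regular_module R) G (\<lambda>i. \<kappa> (w (i - (- wt b))) b) (\<kappa> x b)"
          if "homogeneous_sum M ?H w x" for w
          by (rule homogeneous_sum_linear[OF M regular_module_module kb p(1) _ _ that])
            (use G_sub True in \<open>auto simp: coord_grading_def\<close>)
        have "(\<lambda>i. \<kappa> (a (i - (- wt b))) b) = (\<lambda>i. \<kappa> (a' (i - (- wt b))) b)"
          using G_decomp[OF cD(7)[OF x, of b]] hs[OF a] hs[OF a'] by blast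
        from fun_cong[OF this, of "d - wt b"] show ?thesis by simp
      next
        case False
        then show ?thesis using cD(6)[OF ac(1)] cD(6)[OF ac(2)] by (simp add: free_carrier)
      qed
    qed
    moreover have "a d \<in> carrier M" "a' d \<in> carrier M" using a a' by (auto simp: homogeneous_sum_def intro: subsetD[OF p(1)])
    ultimately show "a d = a' d" using coords_inj[OF M c] by blast
  qed
  have sg: "subgroup (?H d) (add_monoid M)" for d
  proof (rule M.add.subgroupI)
    show "?H d \<subseteq> carrier M" by (rule p(1))
    show "?H d \<noteq> {}" using p(2) by blast
    show "\<ominus>\<^bsub>M\<^esub> x \<in> ?H d" if x: "x \<in> ?H d" for x
    proof -
      have "\<ominus> \<one> \<in> G 0"
      proof -
        have "subgroup (G 0) (add_monoid (regular_module R))" using grading by (simp add: graded_module_def)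
        from subgroup.m_inv_closed[OF this one_degree]
        have "\<ominus>\<^bsub>regular_module R\<^esub> \<one> \<in> G 0" by (simp add: a_inv_def)
        then show ?thesis using module_neg_eq[OF regular_module_module, of \<one>] by simp
      qed
      then have "(\<ominus> \<one>) \<odot>\<^bsub>M\<^esub> x \<in> ?H d" using p(4)[OF _ x] by simp
      moreover have "x \<in> carrier M" using x p(1) by blast
      ultimately show ?thesis using module_neg_eq[OF M, of x] by simp
    qed
    show "x \<oplus>\<^bsub>M\<^esub> y \<in> ?H d" if "x \<in> ?H d" "y \<in> ?H d" for x y
      by (rule p(3)[OF that])
  qed
  have "graded_module R G M ?H"
    unfolding graded_module_iff
  proof (intro conjI allI ballI)
    show "module R M" by fact
    show "subgroup (?H d) (add_monoid M)" for d by (rule sg)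
    show "r \<odot>\<^bsub>M\<^esub> x \<in> ?H (i + d)" if "r \<in> G i" "x \<in> ?H d" for i d r x by (rule p(4)[OF that refl])
    show "\<exists>!a. homogeneous_sum M ?H a x" if x: "x \<in> carrier M" for x
      using coord_grading_decomp[OF M c x] uniq[OF _ _ x] by blast
  qed
  moreover have "e ` A \<subseteq> (\<Union>d. ?H d)" using p(5) by blast
  ultimately show ?thesis
    unfolding graded_free_def using coords_is_basis[OF M c one_not_zero] by blast
qed

text \<open>For a homogeneous basis, the grading by coordinates is contained in the given one. Both admit
decompositions, and those of the given grading are unique, so the two gradings coincide.\<close>

lemma graded_free_coords:
  assumes "graded_free R G M H"
  obtains A \<kappa> wt where "basis_coords R M A \<kappa> (\<lambda>b. b)" "\<And>d. H d = coord_grading M A \<kappa> wt d"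
proof -
  have gm: "graded_module R G M H" using assms by (simp add: graded_free_def)
  note g = graded_moduleD[OF gm] and M = graded_moduleD(1)[OF gm]
  obtain A where A: "is_basis R M A" "A \<subseteq> (\<Union>d. H d)" using assms by (auto simp: graded_free_def)
  obtain \<kappa> where c: "basis_coords R M A \<kappa> (\<lambda>b. b)" using is_basis_coords[OF M A(1)] .
  note cD = basis_coordsD[OF c]
  have "\<forall>b\<in>A. \<exists>d. b \<in> H d" using A(2) by blast
  then obtain wt where wt: "\<And>b. b \<in> A \<Longrightarrow> b \<in> H (wt b)" by metis
  let ?C = "coord_grading M A \<kappa> wt"
  have sub: "?C d \<subseteq> H d" for d
  proof
    fix x assume x: "x \<in> ?C d"
    then have xc: "x \<in> carrier M" by (simp add: coord_grading_def)
    show "x \<in> H d"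
    proof (rule coords_sum_in[OF M c xc g(3) g(4)])
      show "\<kappa> x b \<odot>\<^bsub>M\<^esub> b \<in> H d" if b: "b \<in> A" for b
        by (rule g(5)[where i="d - wt b", OF _ wt[OF b]]) (use x b in \<open>auto simp: coord_grading_def\<close>)
    qed
  qed
  have "H d \<subseteq> ?C d" for d
  proof
    fix x assume x: "x \<in> H d"
    then have xc: "x \<in> carrier M" using g(2) by blast
    obtain a where a: "homogeneous_sum M ?C a x" using coord_grading_decomp[OF M c xc] by blast
    have aH: "homogeneous_sum M H a x" using a sub by (auto simp: homogeneous_sum_def)
    interpret M: module R M by (rule M)
    have "homogeneous_sum M H (\<lambda>i. if i = d then x else \<zero>\<^bsub>M\<^esub>) x"
      by (rule homogeneous_sumI[OF M g(2), where S="{d}"]) (use x xc g(3) in auto)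
    then have "a = (\<lambda>i. if i = d then x else \<zero>\<^bsub>M\<^esub>)" using g(6)[OF xc] aH by blast
    then have "a d = x" by simp
    moreover have "a d \<in> ?C d" using a by (simp add: homogeneous_sum_def)
    ultimately show "x \<in> ?C d" by simp
  qed
  then have "H d = ?C d" for d using sub by blast
  then show ?thesis using c that by blast
qed

lemma graded_free_cong:
  "graded_free R G M H \<Longrightarrow> (\<And>d. H d = H' d) \<Longrightarrow> graded_free R G M H'"
  using ext[of H H'] by metis

text \<open>With respect to the products of basis elements, the subgroup generated by the pure tensors of
total degree \<open>d\<close> is the component of degree \<open>d\<close> of the grading by coordinates.\<close>

lemma tensor_graded_free:
  assumes M: "graded_free R G M H" and N: "graded_free R G N H'"
  shows "graded_free R G (tensor R M N) (tensor_grading R M H N H')"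
proof -
  have gM: "graded_module R G M H" and gN: "graded_module R G N H'"
    using M N by (auto simp: graded_free_def)
  note mM = graded_moduleD(1)[OF gM] and mN = graded_moduleD(1)[OF gN]
    and sH = graded_moduleD(2)[OF gM] and sH' = graded_moduleD(2)[OF gN]
  obtain A \<kappa> wt where c: "basis_coords R M A \<kappa> (\<lambda>b. b)" and H: "\<And>d. H d = coord_grading M A \<kappa> wt d"
    by (rule graded_free_coords[OF M]) blast
  obtain B \<mu> wt' where c': "basis_coords R N B \<mu> (\<lambda>b. b)" and H': "\<And>d. H' d = coord_grading N B \<mu> wt' d"
    by (rule graded_free_coords[OF N]) blast
  let ?T = "tensor R M N" and ?e = "\<lambda>(a, b). pure_tensor R M N a b"
  let ?wt = "\<lambda>(a, b). wt a + wt' b"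
  note T = tensor_module[OF mM mN]
  interpret T: module R ?T by (rule T)
  interpret M: module R M by (rule mM)
  obtain \<nu> where n: "basis_coords R ?T (A \<times> B) \<nu> ?e"
    "\<And>x y a b. x \<in> carrier M \<Longrightarrow> y \<in> carrier N \<Longrightarrow> \<nu> (pure_tensor R M N x y) (a, b) = \<kappa> x a \<otimes> \<mu> y b"
    by (rule tensor_coords[OF mM mN c c']) blast
  note p = coord_grading_props[OF T n(1)]
  let ?C = "coord_grading ?T (A \<times> B) \<nu> ?wt"
  have "tensor_grading R M H N H' d = ?C d" for d
  proof
    let ?gens = "{pure_tensor R M N x y | x y i j. x \<in> H i \<and> y \<in> H' j \<and> i + j = d}"
    have cg: "graded_free R G ?T ?C" by (rule coord_grading_graded_free[OF T n(1)])
    then have sg: "subgroup (?C d) (add_monoid ?T)" by (simp add: graded_free_def graded_module_def)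
    have gens: "?gens \<subseteq> ?C d"
    proof clarify
      fix x y i j assume x: "x \<in> H i" and y: "y \<in> H' j" and d: "d = i + j"
      have xc: "x \<in> carrier M" and yc: "y \<in> carrier N" using x y sH sH' by blast+
      have "\<kappa> x a \<otimes> \<mu> y b \<in> G (i + j - (wt a + wt' b))" if "a \<in> A" "b \<in> B" for a b
        by (rule G_mult[where i="i - wt a" and j="j - wt' b"])
          (use x y that in \<open>auto simp: H H' coord_grading_def\<close>)
      then show "pure_tensor R M N x y \<in> ?C (i + j)"
        using xc yc by (auto simp: coord_grading_def pure_closed[OF mM mN] n(2))
    qed
    show "tensor_grading R M H N H' d \<subseteq> ?C d"
      unfolding tensor_grading_def by (rule T.add.generate_subgroup_incl[OF gens sg])
    show "?C d \<subseteq> tensor_grading R M H N H' d"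
    proof
      fix z assume z: "z \<in> ?C d"
      then have zc: "z \<in> carrier ?T" by (simp add: coord_grading_def)
      show "z \<in> tensor_grading R M H N H' d"
      proof (rule coords_sum_in[OF T n(1) zc])
        show "\<zero>\<^bsub>?T\<^esub> \<in> tensor_grading R M H N H' d"
          using generate.one[of "add_monoid ?T"] by (simp add: tensor_grading_def)
        show "x \<oplus>\<^bsub>?T\<^esub> y \<in> tensor_grading R M H N H' d"
          if "x \<in> tensor_grading R M H N H' d" "y \<in> tensor_grading R M H N H' d" for x y
          using generate.eng[of x "add_monoid ?T" _ y] that by (simp add: tensor_grading_def)
        fix q assume "q \<in> A \<times> B"
        then obtain a b where q: "q = (a, b)" "a \<in> A" "b \<in> B" by blast
        have r: "\<nu> z q \<in> G (d - wt a - wt' b)" using z q by (auto simp: coord_grading_def diff_diff_eq)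
        then have rc: "\<nu> z q \<in> carrier R" using G_sub by blast
        have a: "a \<in> H (wt a)" unfolding H by (rule coord_grading_props(5)[OF mM c q(2)])
        have b: "b \<in> H' (wt' b)" unfolding H' by (rule coord_grading_props(5)[OF mN c' q(3)])
        have ra: "\<nu> z q \<odot>\<^bsub>M\<^esub> a \<in> H (d - wt' b)"
          using a unfolding H by (intro coord_grading_props(4)[OF mM c r]) auto
        have eq: "\<nu> z q \<odot>\<^bsub>?T\<^esub> ?e q = pure_tensor R M N (\<nu> z q \<odot>\<^bsub>M\<^esub> a) b"
          using pure_smult_left[OF mM mN rc, of a b] a b sH sH' q(1) by auto
        have "pure_tensor R M N (\<nu> z q \<odot>\<^bsub>M\<^esub> a) b \<in> ?gens"
          using ra b by force
        then show "\<nu> z q \<odot>\<^bsub>?T\<^esub> ?e q \<in> tensor_grading R M H N H' d"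
          unfolding eq tensor_grading_def by (rule generate.incl)
      qed
    qed
  qed
  then show ?thesis using graded_free_cong[OF coord_grading_graded_free[OF T n(1), where wt="?wt"]] by metis
qed

lemma direct_sum_graded_free:
  assumes M: "\<And>i. i \<in> A \<Longrightarrow> graded_free R G (M i) (H i)"
  shows "graded_free R G (direct_sum A M) (\<lambda>d. {u \<in> carrier (direct_sum A M). \<forall>i\<in>A. u i \<in> H i d})"
proof -
  have m: "module R (M i)" if "i \<in> A" for i
    using M[OF that] graded_moduleD by (auto simp: graded_free_def)
  have "\<forall>i\<in>A. \<exists>B \<kappa> wt. basis_coords R (M i) B \<kappa> (\<lambda>b. b) \<and> (\<forall>d. H i d = coord_grading (M i) B \<kappa> wt d)"
    using graded_free_coords[OF M] by metis
  then obtain B \<kappa> wt where c: "\<And>i. i \<in> A \<Longrightarrow> basis_coords R (M i) (B i) (\<kappa> i) (\<lambda>b. b)"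
    and H: "\<And>i d. i \<in> A \<Longrightarrow> H i d = coord_grading (M i) (B i) (\<kappa> i) (wt i) d" by metis
  let ?S = "direct_sum A M" and ?k = "\<lambda>u (i, b). if i \<in> A then \<kappa> i (u i) b else \<zero>"
  note cs = direct_sum_coords[OF m c]
  have e: "coord_grading ?S (Sigma A B) ?k (\<lambda>(i, b). wt i b) d = {u \<in> carrier ?S. \<forall>i\<in>A. u i \<in> H i d}" for d
    by (auto simp: coord_grading_def H direct_sum_carrier)
  show ?thesis
  proof (rule graded_free_cong[OF _ e])
    show "graded_free R G ?S (coord_grading ?S (Sigma A B) ?k (\<lambda>(i, b). wt i b))"
      by (rule coord_grading_graded_free[OF direct_sum_module[OF m] cs])
  qed
qed

lemma zero_graded_free:
  assumes M: "module R M" and 0: "carrier M = {\<zero>\<^bsub>M\<^esub>}"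
  shows "graded_free R G M (\<lambda>d. {\<zero>\<^bsub>M\<^esub>})"
proof -
  have "coord_grading M {} (\<lambda>_ _. \<zero>) undefined d = {\<zero>\<^bsub>M\<^esub>}" for d
    using 0 by (auto simp: coord_grading_def)
  then show ?thesis
    by (rule graded_free_cong[OF coord_grading_graded_free[OF M zero_module_coords[OF M 0]]])
qed

lemma tensor_map_grading:
  assumes M: "module R M" and N: "module R N" and M': "module R M'" and N': "module R N'"
    and f: "f \<in> linear_maps R M M'" and g: "g \<in> linear_maps R N N'"
    and sH: "\<And>d. H d \<subseteq> carrier M" and sL: "\<And>d. L d \<subseteq> carrier N"
    and fH: "\<And>d x. x \<in> H d \<Longrightarrow> f x \<in> H' d" and gL: "\<And>d y. y \<in> L d \<Longrightarrow> g y \<in> L' d"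
    and z: "z \<in> tensor_grading R M H N L d"
  shows "tensor_map R M N M' N' f g z \<in> tensor_grading R M' H' N' L' d"
proof -
  let ?T = "tensor R M N" and ?T' = "tensor R M' N'" and ?t = "tensor_map R M N M' N' f g"
  note T = tensor_module[OF M N] and T' = tensor_module[OF M' N']
  note l = tensor_map_linear[OF M N M' N' f g]
  interpret T: module R ?T by (rule T)
  let ?g = "{pure_tensor R M N x y | x y i j. x \<in> H i \<and> y \<in> L j \<and> i + j = d}"
  let ?g' = "{pure_tensor R M' N' x y | x y i j. x \<in> H' i \<and> y \<in> L' j \<and> i + j = d}"
  have gc: "?g \<subseteq> carrier ?T" using sH sL pure_closed[OF M N] by blast
  have gg: "?t w \<in> ?g'" if wg: "w \<in> ?g" for w
  proof -
    obtain x y i j where w: "w = pure_tensor R M N x y" "x \<in> H i" "y \<in> L j" "i + j = d" using wg by blast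
    then have "?t w = pure_tensor R M' N' (f x) (g y)"
      using sH sL tensor_map_pure[OF M N M' N' f g, of x y] by blast
    then show ?thesis using w fH gL by blast
  qed
  have "z \<in> carrier ?T \<and> ?t z \<in> generate (add_monoid ?T') ?g'"
    using z unfolding tensor_grading_def
  proof (induction rule: generate.induct)
    case one
    then show ?case using linear_zero[OF l T T'] generate.one[of "add_monoid ?T'" ?g'] by simp
  next
    case (incl h)
    then show ?case using gc generate.incl[OF gg[OF incl], of "add_monoid ?T'"] by blast
  next
    case (inv h)
    have hc: "h \<in> carrier ?T" using inv gc by blast
    then show ?case using generate.inv[OF gg[OF inv], of "add_monoid ?T'"] linear_neg[OF l T T' hc]
      by (simp add: a_inv_def[symmetric])
  next
    case (eng h1 h2)
    then show ?case using linear_add[OF l, of h1 h2] generate.eng[of "?t h1" "add_monoid ?T'" ?g' "?t h2"] by simp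
  qed
  then show ?thesis by (simp add: tensor_grading_def)
qed

end

section \<open>The augmentation onto the quotient by the product ideal\<close>

context base_ring begin

lemma regular_coset: "I +>\<^bsub>regular_module R\<^esub> x = I +>\<^bsub>R\<^esub> x"
  by (rule Set.set_eqI) (simp add: mem_a_r_coset)

text \<open>The augmentation need not be the residue map of the ring, but it sends the generator \<open>\<phi> \<one>\<close> to some
generator of \<open>R/I\<close>, and the annihilator of any generator of \<open>R/I\<close> is \<open>I\<close>.\<close>

lemma resolution_ideal:
  assumes I: "ideal I R" and \<eta>: "is_augmentation R E (cyclic_module R I) \<eta>" and mE: "module R (component E 0)"
    and \<phi>: "\<phi> \<in> linear_isos R (regular_module R) (component E 0)"
    and \<phi>': "\<And>r. r \<in> carrier R \<Longrightarrow> \<phi>' (\<phi> r) = r"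
    and x: "x \<in> carrier (component E 0)"
  shows "x \<in> boundaries E 0 \<longleftrightarrow> \<phi>' x \<in> I"
proof -
  let ?M = "cyclic_module R I" and ?reg = "regular_module R"
  note M = cyclic_module_module[OF I] and sI = ideal_submodule[OF I]
  interpret M: module R ?M by (rule M)
  interpret I: ideal I R by (rule I)
  note pl = quot_proj_linear[OF regular_module_module sI, folded cyclic_module_def]
  have q0: "I +>\<^bsub>?reg\<^esub> r = \<zero>\<^bsub>?M\<^esub> \<longleftrightarrow> r \<in> I" if "r \<in> carrier R" for r
    using quot_zero_iff[OF regular_module_module sI, of r] that by (simp add: cyclic_module_def)
  have \<eta>l: "\<eta> \<in> linear_maps R (component E 0) ?M" and \<eta>s: "\<eta> ` carrier (component E 0) = carrier ?M"
    and \<eta>k: "x \<in> boundaries E 0 \<longleftrightarrow> \<eta> x = \<zero>\<^bsub>?M\<^esub>"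
    using \<eta> x unfolding is_augmentation_def by auto
  have \<phi>l: "\<phi> \<in> linear_maps R ?reg (component E 0)" and \<phi>s: "\<phi> ` carrier R = carrier (component E 0)"
    using \<phi> by (auto simp: linear_isos_def bij_betw_def)
  let ?c = "\<eta> (\<phi> \<one>)"
  have c: "?c \<in> carrier ?M" using linear_closed[OF \<eta>l linear_closed[OF \<phi>l, of \<one>]] by simp
  have ev: "\<eta> (\<phi> r) = r \<odot>\<^bsub>?M\<^esub> ?c" if "r \<in> carrier R" for r
    using linear_smult[OF linear_comp[OF \<eta>l \<phi>l], of r \<one>] that by simp
  obtain r where r: "r \<in> carrier R" "x = \<phi> r" using x \<phi>s by blast
  have "r \<odot>\<^bsub>?M\<^esub> ?c = \<zero>\<^bsub>?M\<^esub> \<longleftrightarrow> r \<in> I"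
  proof
    assume rI: "r \<in> I"
    obtain c0 where c0: "c0 \<in> carrier R" "?c = I +>\<^bsub>?reg\<^esub> c0"
      using c unfolding cyclic_module_def quot_carrier[OF regular_module_module sI] by auto
    have "r \<odot>\<^bsub>?M\<^esub> ?c = I +>\<^bsub>?reg\<^esub> (r \<otimes> c0)"
      using linear_smult[OF pl r(1), of c0] c0 by simp
    then show "r \<odot>\<^bsub>?M\<^esub> ?c = \<zero>\<^bsub>?M\<^esub>" using q0[of "r \<otimes> c0"] rI c0 r(1) by (simp add: I.I_r_closed)
  next
    assume 0: "r \<odot>\<^bsub>?M\<^esub> ?c = \<zero>\<^bsub>?M\<^esub>"
    have "I +>\<^bsub>?reg\<^esub> \<one> \<in> carrier ?M" using linear_closed[OF pl, of \<one>] by simp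
    then obtain y where y: "y \<in> carrier (component E 0)" "I +>\<^bsub>?reg\<^esub> \<one> = \<eta> y"
      unfolding \<eta>s[symmetric] by blast
    obtain s where s: "s \<in> carrier R" "y = \<phi> s" using y(1) unfolding \<phi>s[symmetric] by blast
    have "I +>\<^bsub>?reg\<^esub> r = r \<odot>\<^bsub>?M\<^esub> (I +>\<^bsub>?reg\<^esub> \<one>)" using linear_smult[OF pl r(1), of \<one>] r(1) by simp
    also have "\<dots> = r \<odot>\<^bsub>?M\<^esub> (s \<odot>\<^bsub>?M\<^esub> ?c)" unfolding y(2) s(2) ev[OF s(1)] ..
    also have "\<dots> = (r \<otimes> s) \<odot>\<^bsub>?M\<^esub> ?c" by (rule M.smult_assoc1[OF r(1) s(1) c, symmetric])
    also have "\<dots> = s \<odot>\<^bsub>?M\<^esub> (r \<odot>\<^bsub>?M\<^esub> ?c)"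
      unfolding m_comm[OF r(1) s(1)] by (rule M.smult_assoc1[OF s(1) r(1) c])
    also have "\<dots> = \<zero>\<^bsub>?M\<^esub>" using 0 s(1) by simp
    finally show "r \<in> I" using q0 r(1) by simp
  qed
  moreover have "\<eta> x = r \<odot>\<^bsub>?M\<^esub> ?c" unfolding r(2) by (rule ev[OF r(1)])
  moreover have "\<phi>' x = r" unfolding r(2) by (rule \<phi>'[OF r(1)])
  ultimately show ?thesis unfolding \<eta>k by (simp only:)
qed

text \<open>The isomorphisms of the degree zero modules with the ring induce an isomorphism \<open>\<mu>\<close> of their tensor
product with the ring. It carries \<open>\<partial> x \<otimes> \<partial> y\<close> to a product of an element of \<open>I\<close> and an element of
\<open>J\<close>, and all such products arise. So the image of \<open>\<partial> \<otimes> \<partial>\<close> corresponds to the sums of such products,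
which form the ideal \<open>I J\<close>. The isomorphism is exported, since in the graded case it has to be
compared with the grading.\<close>

lemma star_augmentation:
  assumes I: "ideal I R" and J: "ideal J R" and E: "is_complex R E" and B: "is_complex R B"
    and \<eta>: "is_augmentation R E (cyclic_module R I) \<eta>" and \<theta>: "is_augmentation R B (cyclic_module R J) \<theta>"
    and \<phi>: "\<phi> \<in> linear_isos R (regular_module R) (component E 0)"
    and \<psi>: "\<psi> \<in> linear_isos R (regular_module R) (component B 0)"
  obtains \<phi>' \<psi>' \<mu> where
    "\<And>r. r \<in> carrier R \<Longrightarrow> \<phi>' (\<phi> r) = r" "\<And>r. r \<in> carrier R \<Longrightarrow> \<psi>' (\<psi> r) = r"
    "\<mu> \<in> linear_maps R (tensor R (component E 0) (component B 0)) (regular_module R)"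
    "\<And>x y. x \<in> carrier (component E 0) \<Longrightarrow> y \<in> carrier (component B 0) \<Longrightarrow>
       \<mu> (pure_tensor R (component E 0) (component B 0) x y) = \<phi>' x \<otimes> \<psi>' y"
    "is_augmentation R (star_product R E B) (cyclic_module R (ideal_prod R I J))
       (\<lambda>u. ideal_prod R I J +>\<^bsub>R\<^esub> \<mu> (u (0, 0)))"
proof -
  let ?E0 = "component E 0" and ?B0 = "component B 0" and ?E1 = "component E 1" and ?B1 = "component B 1"
  let ?reg = "regular_module R" and ?S = "star_product R E B"
  let ?T = "tensor R ?E0 ?B0" and ?T1 = "tensor R ?E1 ?B1"
  let ?IJ = "ideal_prod R I J"
  note mE = is_complexD(1)[OF E] and mB = is_complexD(1)[OF B] and reg = regular_module_module
  note T = tensor_module[OF mE mB, of 0 0] and T1 = tensor_module[OF mE mB, of 1 1]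
  interpret T: module R ?T by (rule T)
  have dE: "bd E 1 \<in> linear_maps R ?E1 ?E0" and dB: "bd B 1 \<in> linear_maps R ?B1 ?B0"
    using complex_bd_up(1)[OF E, of 0] complex_bd_up(1)[OF B, of 0] by simp_all
  have IJ: "ideal ?IJ R" by (rule ideal_prod_is_ideal[OF I J])
  interpret IJ: ideal ?IJ R by (rule IJ)
  note sIJ = ideal_submodule[OF IJ]
  obtain \<phi>' where \<phi>': "\<phi>' \<in> linear_isos R ?E0 ?reg" "\<And>r. r \<in> carrier ?reg \<Longrightarrow> \<phi>' (\<phi> r) = r"
    "\<And>y. y \<in> carrier ?E0 \<Longrightarrow> \<phi> (\<phi>' y) = y"
    by (rule linear_iso_inverse[OF \<phi> reg mE]) blast
  obtain \<psi>' where \<psi>': "\<psi>' \<in> linear_isos R ?B0 ?reg" "\<And>r. r \<in> carrier ?reg \<Longrightarrow> \<psi>' (\<psi> r) = r"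
    "\<And>y. y \<in> carrier ?B0 \<Longrightarrow> \<psi> (\<psi>' y) = y"
    by (rule linear_iso_inverse[OF \<psi> reg mB]) blast
  have \<phi>'l: "\<phi>' \<in> linear_maps R ?E0 ?reg" and \<psi>'l: "\<psi>' \<in> linear_maps R ?B0 ?reg"
    and \<phi>l: "\<phi> \<in> linear_maps R ?reg ?E0" and \<psi>l: "\<psi> \<in> linear_maps R ?reg ?B0"
    using \<phi> \<psi> \<phi>'(1) \<psi>'(1) by (auto simp: linear_isos_def)
  have c: "\<phi>' x \<in> carrier R" "\<psi>' y \<in> carrier R" if "x \<in> carrier ?E0" "y \<in> carrier ?B0" for x y
    using linear_closed[OF \<phi>'l that(1)] linear_closed[OF \<psi>'l that(2)] by simp_all
  have "bilinear_map R ?E0 ?B0 ?reg (\<lambda>x y. \<phi>' x \<otimes> \<psi>' y)"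
    unfolding bilinear_map_def
    using linear_closed[OF \<phi>'l] linear_closed[OF \<psi>'l]
    by (auto intro!: linear_mapsI simp: linear_add[OF \<phi>'l] linear_add[OF \<psi>'l] linear_smult[OF \<phi>'l]
        linear_smult[OF \<psi>'l] l_distr r_distr m_assoc m_lcomm)
  then obtain \<mu> where \<mu>: "\<mu> \<in> linear_maps R ?T ?reg"
    "\<And>x y. x \<in> carrier ?E0 \<Longrightarrow> y \<in> carrier ?B0 \<Longrightarrow> \<mu> (pure_tensor R ?E0 ?B0 x y) = \<phi>' x \<otimes> \<psi>' y"
    using tensor_lift[OF mE mB reg] by blast
  have p1: "\<psi> \<one> \<in> carrier ?B0" using linear_closed[OF \<psi>l, of \<one>] by simp
  have \<mu>c: "\<mu> t \<in> carrier R" if "t \<in> carrier ?T" for t using linear_closed[OF \<mu>(1) that] by simp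
  have \<mu>inv: "\<mu> (pure_tensor R ?E0 ?B0 (\<phi> r) (\<psi> \<one>)) = r" "pure_tensor R ?E0 ?B0 (\<phi> r) (\<psi> \<one>) \<in> carrier ?T"
    if "r \<in> carrier R" for r
  proof -
    have "\<phi> r \<in> carrier ?E0" using linear_closed[OF \<phi>l, of r] that by simp
    then show "\<mu> (pure_tensor R ?E0 ?B0 (\<phi> r) (\<psi> \<one>)) = r" "pure_tensor R ?E0 ?B0 (\<phi> r) (\<psi> \<one>) \<in> carrier ?T"
      using p1 \<mu>(2) \<phi>'(2)[of r] \<psi>'(2)[of \<one>] that pure_closed[OF mE mB] by auto
  qed
  have \<mu>inj: "t = pure_tensor R ?E0 ?B0 (\<phi> (\<mu> t)) (\<psi> \<one>)" if t: "t \<in> carrier ?T" for t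
  proof -
    obtain x where x: "x \<in> carrier ?E0" "t = pure_tensor R ?E0 ?B0 x (\<psi> \<one>)"
      using tensor_rank_one_pure[OF mE mB \<psi> t] by blast
    then have "\<mu> t = \<phi>' x" using \<mu>(2)[OF x(1) p1] \<psi>'(2)[of \<one>] c(1)[OF x(1) p1] by simp
    then show ?thesis using x \<phi>'(3) by simp
  qed
  let ?d = "tensor_map R ?E1 ?B1 ?E0 ?B0 (bd E 1) (bd B 1)"
  note dl = tensor_map_linear[OF mE mB mE mB dE dB] and dp = tensor_map_pure[OF mE mB mE mB dE dB]
  have bI: "\<phi>' (bd E 1 x) \<in> I" if x: "x \<in> carrier ?E1" for x
    using resolution_ideal[OF I \<eta> mE \<phi> _ linear_closed[OF dE x], of \<phi>'] \<phi>'(2) x by (auto simp: boundaries_def)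
  have bJ: "\<psi>' (bd B 1 y) \<in> J" if y: "y \<in> carrier ?B1" for y
    using resolution_ideal[OF J \<theta> mB \<psi> _ linear_closed[OF dB y], of \<psi>'] \<psi>'(2) y by (auto simp: boundaries_def)
  have Icar: "I \<subseteq> carrier R" and Jcar: "J \<subseteq> carrier R"
    using ideal.Icarr[OF I] ideal.Icarr[OF J] by blast+
  have Ib: "\<exists>x\<in>carrier ?E1. \<phi>' (bd E 1 x) = i" if i: "i \<in> I" for i
  proof -
    have ic: "i \<in> carrier R" using i Icar by blast
    have f: "\<phi> i \<in> carrier ?E0" using linear_closed[OF \<phi>l, of i] ic by simp
    have "\<phi> i \<in> boundaries E 0"
      using resolution_ideal[OF I \<eta> mE \<phi> _ f, of \<phi>'] \<phi>'(2) ic i by auto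
    then obtain x where "x \<in> carrier ?E1" "\<phi> i = bd E 1 x" by (auto simp: boundaries_def)
    then show ?thesis using \<phi>'(2)[of i] ic by auto
  qed
  have Jb: "\<exists>y\<in>carrier ?B1. \<psi>' (bd B 1 y) = j" if j: "j \<in> J" for j
  proof -
    have jc: "j \<in> carrier R" using j Jcar by blast
    have f: "\<psi> j \<in> carrier ?B0" using linear_closed[OF \<psi>l, of j] jc by simp
    have "\<psi> j \<in> boundaries B 0"
      using resolution_ideal[OF J \<theta> mB \<psi> _ f, of \<psi>'] \<psi>'(2) jc j by auto
    then obtain y where "y \<in> carrier ?B1" "\<psi> j = bd B 1 y" by (auto simp: boundaries_def)
    then show ?thesis using \<psi>'(2)[of j] jc by auto
  qed
  have im1: "\<mu> (?d z) \<in> ?IJ" if z: "z \<in> carrier ?T1" for z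
    using z
  proof (induction rule: tensor_induct[OF mE mB, consumes 1, case_names pure add])
    case (pure x y)
    then show ?case
      using dp[OF pure] \<mu>(2) linear_closed[OF dE pure(1)] linear_closed[OF dB pure(2)]
        ideal_prod.prod[OF bI[OF pure(1)] bJ[OF pure(2)]] by simp
  next
    case (add z w)
    then show ?case
      using linear_add[OF linear_comp[OF \<mu>(1) dl], of z w] ideal_prod.sum[of "\<mu> (?d z)" R I J "\<mu> (?d w)"] by simp
  qed
  have im2: "\<exists>z\<in>carrier ?T1. \<mu> (?d z) = s" if "s \<in> ?IJ" for s
    using that
  proof (induction rule: ideal_prod.induct)
    case (prod i j)
    obtain x y where xy: "x \<in> carrier ?E1" "\<phi>' (bd E 1 x) = i" "y \<in> carrier ?B1" "\<psi>' (bd B 1 y) = j"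
      using Ib[OF prod(1)] Jb[OF prod(2)] by blast
    have "\<mu> (?d (pure_tensor R ?E1 ?B1 x y)) = i \<otimes> j"
      using dp[OF xy(1,3)] \<mu>(2) linear_closed[OF dE xy(1)] linear_closed[OF dB xy(3)] xy by simp
    then show ?case using pure_closed[OF mE mB xy(1,3)] by blast
  next
    case (sum s1 s2)
    then obtain z w where zw: "z \<in> carrier ?T1" "\<mu> (?d z) = s1" "w \<in> carrier ?T1" "\<mu> (?d w) = s2" by blast
    interpret T1: module R ?T1 by (rule T1)
    have "\<mu> (?d (z \<oplus>\<^bsub>?T1\<^esub> w)) = s1 \<oplus> s2"
      using linear_add[OF linear_comp[OF \<mu>(1) dl], of z w] zw by simp
    then show ?case using zw by (intro bexI[of _ "z \<oplus>\<^bsub>?T1\<^esub> w"]) auto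
  qed
  have S0: "component ?S 0 = direct_sum {(0, 0)} (\<lambda>_. ?T)" by (rule star_component(2)[OF E B])
  have S0c: "u \<in> carrier (component ?S 0) \<longleftrightarrow> u (0, 0) \<in> carrier ?T \<and> u \<in> extensional {(0, 0)}" for u
    unfolding S0 direct_sum_carrier by auto
  let ?\<epsilon> = "\<lambda>u. ?IJ +>\<^bsub>?reg\<^esub> \<mu> (u (0, 0))"
  have pr: "(\<lambda>u. u (0, 0)) \<in> linear_maps R (component ?S 0) ?T"
    unfolding S0 by (rule direct_sum_proj_linear[OF T]) simp
  note ql = quot_proj_linear[OF reg sIJ, folded cyclic_module_def]
  have el: "?\<epsilon> \<in> linear_maps R (component ?S 0) (cyclic_module R ?IJ)"
    by (rule linear_comp[OF ql linear_comp[OF \<mu>(1) pr]])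
  have "is_augmentation R ?S (cyclic_module R ?IJ) ?\<epsilon>"
    unfolding is_augmentation_def
  proof (intro conjI el subset_antisym subsetI)
    show "v \<in> carrier (cyclic_module R ?IJ)" if "v \<in> ?\<epsilon> ` carrier (component ?S 0)" for v
      using that linear_closed[OF el] by blast
    show "v \<in> ?\<epsilon> ` carrier (component ?S 0)" if v: "v \<in> carrier (cyclic_module R ?IJ)" for v
    proof -
      obtain r where r: "r \<in> carrier R" "v = ?IJ +>\<^bsub>?reg\<^esub> r"
        using v unfolding cyclic_module_def quot_carrier[OF reg sIJ] by auto
      let ?u = "\<lambda>_\<in>{(0, 0)}. pure_tensor R ?E0 ?B0 (\<phi> r) (\<psi> \<one>)"
      have uc: "?u \<in> carrier (component ?S 0)" using \<mu>inv(2)[OF r(1)] by (simp add: S0c)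
      have "v = ?\<epsilon> ?u" using \<mu>inv(1)[OF r(1)] r(2) by simp
      then show ?thesis by (rule image_eqI[where x="?u", OF _ uc])
    qed
    show "u \<in> {u \<in> carrier (component ?S 0). ?\<epsilon> u = \<zero>\<^bsub>cyclic_module R ?IJ\<^esub>}" if u: "u \<in> boundaries ?S 0" for u
    proof -
      obtain w where w: "w \<in> carrier (component ?S 1)" "u = bd ?S 1 w" using u by (auto simp: boundaries_def)
      have uc: "u \<in> carrier (component ?S 0)" using linear_closed[OF star_bd_1_linear[OF E B] w(1)] w(2) by simp
      have "w (1, 1) \<in> carrier ?T1"
        using star_summand_closed[OF E B, of w 2 1 1] w(1) star_component(1)[OF E B, of 1] by (simp add: trunc_simps)
      then have "\<mu> (u (0, 0)) \<in> ?IJ" using im1 w(2) by (simp add: star_bd(2)[OF E B])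
      then show ?thesis
        using uc quot_zero_iff[OF reg sIJ, of "\<mu> (u (0, 0))"] by (simp add: cyclic_module_def IJ.Icarr)
    qed
    show "u \<in> boundaries ?S 0" if u: "u \<in> {u \<in> carrier (component ?S 0). ?\<epsilon> u = \<zero>\<^bsub>cyclic_module R ?IJ\<^esub>}" for u
    proof -
      have uc: "u \<in> carrier (component ?S 0)" and u0: "u (0, 0) \<in> carrier ?T" "u \<in> extensional {(0, 0)}"
        using u S0c by auto
      have "\<mu> (u (0, 0)) \<in> ?IJ"
        using u quot_zero_iff[OF reg sIJ, of "\<mu> (u (0, 0))"] \<mu>c[OF u0(1)] by (simp add: cyclic_module_def)
      then obtain z where z: "z \<in> carrier ?T1" "\<mu> (?d z) = \<mu> (u (0, 0))" using im2 by blast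
      have dz: "?d z \<in> carrier ?T" by (rule linear_closed[OF dl z(1)])
      have e: "?d z = u (0, 0)" using \<mu>inj[OF dz] \<mu>inj[OF u0(1)] z(2) by simp
      let ?DD = "\<lambda>(p, q). tensor R (component (trunc_ge1 E) p) (component (trunc_ge1 B) q)"
      let ?w = "sum_inj (bidegrees 2) ?DD (1, 1) z"
      have b: "(1, 1) \<in> bidegrees 2" by (simp add: bidegrees_def)
      have zc: "z \<in> carrier (?DD (1, 1))" using z(1) by (simp add: trunc_simps)
      have "sum_inj (bidegrees 2) ?DD (1, 1) \<in> linear_maps R (?DD (1, 1)) (direct_sum (bidegrees 2) ?DD)"
        by (rule sum_inj_linear[OF star_summand_module[OF E B] b])
      from linear_closed[OF this zc]
      have wc: "?w \<in> carrier (component ?S 1)"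
        using star_component(1)[OF E B, of 1] tensor_trunc_component[OF E B, of 2] by simp
      have "?w (1, 1) = z" using b by (simp add: sum_inj_def)
      then have "bd ?S 1 ?w = (\<lambda>_\<in>{(0, 0)}. u (0, 0))" by (simp add: star_bd(2)[OF E B] e)
      also have "\<dots> = u" by (rule extensionalityI[of _ "{(0, 0)}"]) (use u0(2) in auto)
      finally show ?thesis using wc unfolding boundaries_def by (intro image_eqI[of _ _ ?w]) auto
    qed
  qed
  then have "is_augmentation R ?S (cyclic_module R ?IJ) (\<lambda>u. ?IJ +>\<^bsub>R\<^esub> \<mu> (u (0, 0)))"
    by (simp add: regular_coset)
  then show ?thesis using \<phi>'(2) \<psi>'(2) by (intro that[OF _ _ \<mu>]) auto
qed

theorem star_free_resolution:
  assumes one: "\<one> \<noteq> \<zero>" and I: "ideal I R" and J: "ideal J R"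
    and E: "free_resolution R E (cyclic_module R I)" and B: "free_resolution R B (cyclic_module R J)"
    and \<phi>: "\<phi> \<in> linear_isos R (regular_module R) (component E 0)"
    and \<psi>: "\<psi> \<in> linear_isos R (regular_module R) (component B 0)"
    and tor: "Tor_independent R I J"
  shows "free_resolution R (star_product R E B) (cyclic_module R (ideal_prod R I J))"
proof -
  note rE = free_resolutionD[OF E] and rB = free_resolutionD[OF B]
  obtain \<eta> where \<eta>: "is_augmentation R E (cyclic_module R I) \<eta>" using rE(5) by blast
  obtain \<theta> where \<theta>: "is_augmentation R B (cyclic_module R J) \<theta>" using rB(5) by blast
  have aug: "\<exists>\<epsilon>. is_augmentation R (star_product R E B) (cyclic_module R (ideal_prod R I J)) \<epsilon>"
    by (rule star_augmentation[OF I J rE(1) rB(1) \<eta> \<theta> \<phi> \<psi>]) blast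
  show ?thesis unfolding free_resolution_def
  proof (intro conjI allI impI star_complex[OF rE(1) rB(1)] star_is_free[OF rE(1) rB(1) rE(2) rB(2) one] aug)
    show "cycles (star_product R E B) n = boundaries (star_product R E B) n" if "n \<ge> 1" for n
    proof (rule star_exact[OF rE(1) rB(1) rE(2) cyclic_module_module[OF J] _ _ \<theta> \<psi> _ that])
      show "x \<in> bd E (n + 1) ` carrier (component E (n + 1))"
        if "n \<ge> 1" "x \<in> carrier (component E n)" "bd E n x = \<zero>\<^bsub>component E (n - 1)\<^esub>" for n x
        by (rule rE(4)[OF that])
      show "x \<in> bd B (n + 1) ` carrier (component B (n + 1))"
        if "n \<ge> 1" "x \<in> carrier (component B n)" "bd B n x = \<zero>\<^bsub>component B (n - 1)\<^esub>" for n x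
        by (rule rB(4)[OF that])
      show "cycles (tensor_cplx_module R E (cyclic_module R J)) n
          \<subseteq> boundaries (tensor_cplx_module R E (cyclic_module R J)) n" if "n \<ge> 1" for n
        by (rule Tor_independent_exact[OF I J one tor E that])
    qed
    show "carrier (component (star_product R E B) n) = {\<zero>\<^bsub>component (star_product R E B) n\<^esub>}" if "n < 0" for n
      by (simp add: star_component(3)[OF rE(1) rB(1) that])
  qed
qed

section \<open>Minimality\<close>

lemma ideal_smult_submodule:
  assumes M: "module R M" and m: "\<mm> \<subseteq> carrier R" shows "submodule (ideal_smult R \<mm> M) R M"
proof -
  interpret M: module R M by fact
  show ?thesis unfolding ideal_smult_def by (rule span_module_submodule[OF M]) (use m in auto)
qed

text \<open>Minimality is a statement about spans; it is propagated through tensor products and direct sums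
by linear maps, such as tensoring with a fixed element and the injections of the summands.\<close>

lemma linear_ideal_smult:
  assumes M: "module R M" and N: "module R N" and m: "\<mm> \<subseteq> carrier R" and h: "h \<in> linear_maps R M N"
    and x: "x \<in> ideal_smult R \<mm> M"
  shows "h x \<in> ideal_smult R \<mm> N"
proof -
  interpret M: module R M by fact
  let ?N = "ideal_smult R \<mm> N"
  interpret N: module R N by fact
  note sub = N.submoduleE[OF ideal_smult_submodule[OF N m]]
  have z: "\<zero>\<^bsub>N\<^esub> \<in> ?N" using subgroup.one_closed[OF submodule.axioms(1)[OF ideal_smult_submodule[OF N m]]] by simp
  have "submodule {x \<in> carrier M. h x \<in> ?N} R M"
    by (rule M.submoduleI)
      (auto simp: z linear_zero[OF h M N] linear_neg[OF h M N] linear_add[OF h] linear_smult[OF h] sub)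
  moreover have "{a \<odot>\<^bsub>M\<^esub> x | a x. a \<in> \<mm> \<and> x \<in> carrier M} \<subseteq> {x \<in> carrier M. h x \<in> ?N}"
  proof clarify
    fix a x assume a: "a \<in> \<mm>" and x: "x \<in> carrier M"
    have ac: "a \<in> carrier R" using a m by blast
    have "a \<odot>\<^bsub>N\<^esub> h x \<in> ?N"
      unfolding ideal_smult_def
      by (rule subsetD[OF span_module_base]) (use a linear_closed[OF h x] in blast)
    then show "a \<odot>\<^bsub>M\<^esub> x \<in> carrier M \<and> h (a \<odot>\<^bsub>M\<^esub> x) \<in> ?N"
      using ac x linear_smult[OF h ac x] by simp
  qed
  ultimately have "ideal_smult R \<mm> M \<subseteq> {x \<in> carrier M. h x \<in> ?N}"
    unfolding ideal_smult_def[of R \<mm> M] by (rule span_module_minimal)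
  then show ?thesis using x by blast
qed

lemma tensor_map_ideal_smult:
  assumes M: "module R M" and N: "module R N" and M': "module R M'" and N': "module R N'"
    and m: "\<mm> \<subseteq> carrier R"
    and f: "f \<in> linear_maps R M M'" and g: "g \<in> linear_maps R N N'"
    and small: "(\<forall>x\<in>carrier M. f x \<in> ideal_smult R \<mm> M') \<or> (\<forall>y\<in>carrier N. g y \<in> ideal_smult R \<mm> N')"
    and z: "z \<in> carrier (tensor R M N)"
  shows "tensor_map R M N M' N' f g z \<in> ideal_smult R \<mm> (tensor R M' N')"
  using z
proof (induction rule: tensor_induct[OF M N, consumes 1, case_names pure add])
  case (pure x y)
  have fx: "f x \<in> carrier M'" and gy: "g y \<in> carrier N'" using linear_closed[OF f] linear_closed[OF g] pure by auto
  have l: "(\<lambda>x. pure_tensor R M' N' x (g y)) \<in> linear_maps R M' (tensor R M' N')"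
    and r: "pure_tensor R M' N' (f x) \<in> linear_maps R N' (tensor R M' N')"
    using pure_bilinear[OF M' N'] fx gy by (auto simp: bilinear_map_def)
  have "pure_tensor R M' N' (f x) (g y) \<in> ideal_smult R \<mm> (tensor R M' N')"
    using small
  proof
    assume "\<forall>x\<in>carrier M. f x \<in> ideal_smult R \<mm> M'"
    then show ?thesis using linear_ideal_smult[OF M' tensor_module[OF M' N'] m l] pure by blast
  next
    assume "\<forall>y\<in>carrier N. g y \<in> ideal_smult R \<mm> N'"
    then show ?thesis using linear_ideal_smult[OF N' tensor_module[OF M' N'] m r] pure by blast
  qed
  then show ?case using tensor_map_pure[OF M N M' N' f g] pure by simp
next
  case (add z w)
  interpret T: module R "tensor R M' N'" by (rule tensor_module[OF M' N'])
  show ?case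
    using T.submoduleE(5)[OF ideal_smult_submodule[OF tensor_module[OF M' N'] m] add(3,4)]
      linear_add[OF tensor_map_linear[OF M N M' N' f g] add(1,2)] by simp
qed

lemma direct_sum_ideal_smult:
  assumes M: "\<And>i. i \<in> A \<Longrightarrow> module R (M i)" and m: "\<mm> \<subseteq> carrier R"
    and u: "u \<in> carrier (direct_sum A M)" and ui: "\<And>i. i \<in> A \<Longrightarrow> u i \<in> ideal_smult R \<mm> (M i)"
  shows "u \<in> ideal_smult R \<mm> (direct_sum A M)"
  by (rule direct_sum_in_submodule[OF M ideal_smult_submodule[OF direct_sum_module[OF M] m] u])
    (auto intro: linear_ideal_smult[OF M direct_sum_module[OF M] m sum_inj_linear[OF M]] ui)

lemma trunc_minimal:
  assumes C: "is_complex R C" and m: "\<mm> \<subseteq> carrier R" and min: "minimal_complex R \<mm> C"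
    and x: "x \<in> carrier (component (trunc_ge1 C) n)"
  shows "bd (trunc_ge1 C) n x \<in> ideal_smult R \<mm> (component (trunc_ge1 C) (n - 1))"
proof (cases "n > 1")
  case True
  then have "bd C n x \<in> ideal_smult R \<mm> (component C (n - 1))"
    using min x by (auto simp: minimal_complex_def trunc_simps)
  then show ?thesis using True by (simp add: trunc_simps)
next
  case False
  then show ?thesis
    using subgroup.one_closed[OF submodule.axioms(1)[OF ideal_smult_submodule[OF trunc_module[OF C, of "n - 1"] m]]]
    by (simp add: trunc_simps(4) trunc_zero)
qed

lemma star_minimal:
  assumes E: "is_complex R E" and B: "is_complex R B" and m: "\<mm> \<subseteq> carrier R"
    and minE: "minimal_complex R \<mm> E" and minB: "minimal_complex R \<mm> B"
  shows "minimal_complex R \<mm> (star_product R E B)"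
  unfolding minimal_complex_def
proof (intro allI subsetI)
  let ?S = "star_product R E B"
  let ?E = "component (trunc_ge1 E)" and ?B = "component (trunc_ge1 B)"
  let ?D = "\<lambda>(p, q). tensor R (?E p) (?B q)"
  fix n v assume "v \<in> bd ?S n ` carrier (component ?S n)"
  then obtain u where u: "u \<in> carrier (component ?S n)" "v = bd ?S n u" by blast
  have vc: "v \<in> carrier (component ?S (n - 1))" using linear_closed[OF star_bd_linear[OF E B] u(1)] u(2) by simp
  note tE = trunc_module[OF E] and tB = trunc_module[OF B]
  note cE = complex_bd_up(1)[OF trunc_complex[OF E]] and cB = complex_bd_up(1)[OF trunc_complex[OF B]]
  consider "n \<ge> 2" | "n = 1" | "n \<le> 0" by linarith
  then show "v \<in> ideal_smult R \<mm> (component ?S (n - 1))"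
  proof cases
    case 1
    have S: "component ?S (n - 1) = direct_sum (bidegrees n) ?D"
      using star_component(1)[OF E B, of "n - 1"] tensor_trunc_component[OF E B, of n] 1 by simp
    have uT: "u \<in> carrier (component (tensor_cplx R (trunc_ge1 E) (trunc_ge1 B)) (n + 1))"
      using u(1) star_component(1)[OF E B, of n] 1 by simp
    have "v i \<in> ideal_smult R \<mm> (?D i)" if i: "i \<in> bidegrees n" for i
    proof -
      obtain p q where pq: "i = (p, q)" "p + q = n" using i by (auto simp: bidegrees_def)
      let ?P = "tensor R (?E p) (?B q)"
      have P: "module R ?P" by (rule tensor_module[OF tE tB])
      interpret P: module R ?P by (rule P)
      have a: "u (p + 1, q) \<in> carrier (tensor R (?E (p + 1)) (?B q))"
        and b: "u (p, q + 1) \<in> carrier (tensor R (?E p) (?B (q + 1)))"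
        using star_summand_closed[OF E B uT, of "p + 1" q] star_summand_closed[OF E B uT, of p "q + 1"] pq by auto
      have sa: "tensor_map R (?E (p + 1)) (?B q) (?E p) (?B q) (bd (trunc_ge1 E) (p + 1)) (\<lambda>y. y) (u (p + 1, q))
          \<in> ideal_smult R \<mm> ?P"
        by (rule tensor_map_ideal_smult[OF tE tB tE tB m cE linear_id _ a])
          (use trunc_minimal[OF E m minE, of _ "p + 1"] in auto)
      have sb: "tensor_map R (?E p) (?B (q + 1)) (?E p) (?B q) (\<lambda>x. x) (bd (trunc_ge1 B) (q + 1)) (u (p, q + 1))
          \<in> ideal_smult R \<mm> ?P"
        by (rule tensor_map_ideal_smult[OF tE tB tE tB m linear_id cB _ b])
          (use trunc_minimal[OF B m minB, of _ "q + 1"] in auto)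
      show ?thesis
        using tensor_trunc_bd_at[OF E B, of p q "n + 1" u] pq 1 u(2) star_bd(1)[OF E B, of n]
          P.submoduleE(5)[OF ideal_smult_submodule[OF P m] sa
            linear_ideal_smult[OF P P m sign_twist_linear[OF P] sb]] by simp
    qed
    then show ?thesis
      using vc unfolding S by (intro direct_sum_ideal_smult[OF star_summand_module[OF E B] m]) auto
  next
    case 2
    note mE = is_complexD(1)[OF E] and mB = is_complexD(1)[OF B]
    have S0: "component ?S 0 = direct_sum {(0, 0)} (\<lambda>_. tensor R (component E 0) (component B 0))"
      by (rule star_component(2)[OF E B])
    have u1: "u (1, 1) \<in> carrier (tensor R (component E 1) (component B 1))"
      using star_summand_closed[OF E B, of u 2 1 1] u(1) star_component(1)[OF E B, of 1] 2 by (simp add: trunc_simps)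
    have d: "bd E 1 \<in> linear_maps R (component E 1) (component E 0)"
      "bd B 1 \<in> linear_maps R (component B 1) (component B 0)"
      using complex_bd_up(1)[OF E, of 0] complex_bd_up(1)[OF B, of 0] by simp_all
    have "tensor_map R (component E 1) (component B 1) (component E 0) (component B 0) (bd E 1) (bd B 1) (u (1, 1))
        \<in> ideal_smult R \<mm> (tensor R (component E 0) (component B 0))"
    proof (rule tensor_map_ideal_smult[OF mE mB mE mB m d _ u1], rule disjI1, rule ballI)
      have "bd E 1 ` carrier (component E 1) \<subseteq> ideal_smult R \<mm> (component E (1 - 1))"
        using minE unfolding minimal_complex_def by blast
      then show "bd E 1 x \<in> ideal_smult R \<mm> (component E 0)" if "x \<in> carrier (component E 1)" for x
        using that by auto
    qed
    then have "v i \<in> ideal_smult R \<mm> (tensor R (component E 0) (component B 0))" if "i \<in> {(0, 0)}" for i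
      using that u(2) 2 by (simp add: star_bd(2)[OF E B])
    then have "v \<in> ideal_smult R \<mm> (component ?S 0)"
      unfolding S0 using vc 2 by (intro direct_sum_ideal_smult[OF tensor_module[OF mE mB] m]) (auto simp: S0)
    then show ?thesis using 2 by simp
  next
    case 3
    then show ?thesis
      using subgroup.one_closed[OF submodule.axioms(1)[OF ideal_smult_submodule[OF star_component_module[OF E B, of "n - 1"] m]]] u(2)
      by (simp add: star_bd(3)[OF E B])
  qed
qed

end

section \<open>The grading of the star product\<close>

context graded_base_ring begin

lemma trunc_graded_free:
  assumes C: "is_complex R C" and g: "\<And>n. graded_free R G (component C n) (K n)"
  shows "graded_free R G (component (trunc_ge1 C) q) (trunc_grading C K q)"
  using g[of q] zero_graded_free[OF zero_submodule_module[OF is_complexD(1)[OF C]]]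
  by (cases "q \<ge> 1") (auto simp: trunc_simps trunc_grading_def[abs_def])

lemma star_graded:
  assumes E: "is_complex R E" and B: "is_complex R B"
    and gE: "\<And>n. graded_free R G (component E n) (K n)" and gB: "\<And>n. graded_free R G (component B n) (L n)"
  shows "graded_free R G (component (star_product R E B) n) (star_grading R E K B L n)"
proof -
  let ?S = "star_product R E B"
  let ?E = "component (trunc_ge1 E)" and ?B = "component (trunc_ge1 B)"
  let ?D = "\<lambda>(p, q). tensor R (?E p) (?B q)"
  note tE = trunc_graded_free[OF E gE] and tB = trunc_graded_free[OF B gB]
  consider "n \<ge> 1" | "n = 0" | "n < 0" by linarith
  then show ?thesis
  proof cases
    case 1
    have S: "component ?S n = direct_sum (bidegrees (n + 1)) ?D"
      using star_component(1)[OF E B 1] tensor_trunc_component[OF E B, of "n + 1"] by simp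
    let ?H = "\<lambda>(p, q). tensor_grading R (?E p) (trunc_grading E K p) (?B q) (trunc_grading B L q)"
    have "graded_free R G (?D i) (?H i)" for i by (cases i) (simp add: tensor_graded_free[OF tE tB])
    from direct_sum_graded_free[OF this, of "bidegrees (n + 1)"]
    show ?thesis unfolding S
      by (rule graded_free_cong) (use 1 S in \<open>auto simp: star_grading_def\<close>)
  next
    case 2
    from direct_sum_graded_free[OF tensor_graded_free[OF gE[of 0] gB[of 0]], of "{(0, 0)}"]
    show ?thesis unfolding 2 star_component(2)[OF E B]
      by (rule graded_free_cong) (auto simp: star_grading_def star_component(2)[OF E B])
  next
    case 3
    have c: "carrier (component ?S n) = {\<zero>\<^bsub>component ?S n\<^esub>}" by (simp add: star_component(3)[OF E B 3])
    from zero_graded_free[OF star_component_module[OF E B] c]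
    show ?thesis by (rule graded_free_cong) (use 3 in \<open>simp add: star_grading_def\<close>)
  qed
qed

lemma graded_freeD:
  assumes "graded_free R G M H"
  shows "H d \<subseteq> carrier M" "\<zero>\<^bsub>M\<^esub> \<in> H d" "x \<in> H d \<Longrightarrow> y \<in> H d \<Longrightarrow> x \<oplus>\<^bsub>M\<^esub> y \<in> H d"
    "x \<in> H d \<Longrightarrow> \<ominus>\<^bsub>M\<^esub> x \<in> H d"
proof -
  have g: "graded_module R G M H" using assms by (simp add: graded_free_def)
  show "H d \<subseteq> carrier M" "\<zero>\<^bsub>M\<^esub> \<in> H d" "x \<in> H d \<Longrightarrow> y \<in> H d \<Longrightarrow> x \<oplus>\<^bsub>M\<^esub> y \<in> H d"
    using graded_moduleD[OF g] by auto
  have "subgroup (H d) (add_monoid M)" using g by (simp add: graded_module_def)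
  then show "x \<in> H d \<Longrightarrow> \<ominus>\<^bsub>M\<^esub> x \<in> H d" using subgroup.m_inv_closed[of "H d" "add_monoid M" x] by (simp add: a_inv_def)
qed

lemma trunc_bd_grading:
  assumes K: "\<And>n d. bd C n ` K n d \<subseteq> K (n - 1) d" and x: "x \<in> trunc_grading C K (n + 1) d"
    and z: "\<zero>\<^bsub>component C n\<^esub> \<in> K n d"
  shows "bd (trunc_ge1 C) (n + 1) x \<in> trunc_grading C K n d"
  using K[of "n + 1" d] x z by (cases "n \<ge> 1") (auto simp: trunc_simps trunc_grading_def)

text \<open>The differential of the truncated complex in degree one is zero, so the truncated gradings are
preserved as well, and both summands of the differential have the right degree.\<close>

lemma star_bd_grading:
  assumes E: "is_complex R E" and B: "is_complex R B"
    and gE: "\<And>n. graded_free R G (component E n) (K n)" and gB: "\<And>n. graded_free R G (component B n) (L n)"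
    and bE: "\<And>n d. bd E n ` K n d \<subseteq> K (n - 1) d" and bB: "\<And>n d. bd B n ` L n d \<subseteq> L (n - 1) d"
  shows "bd (star_product R E B) n ` star_grading R E K B L n d \<subseteq> star_grading R E K B L (n - 1) d"
proof
  let ?S = "star_product R E B"
  let ?E = "component (trunc_ge1 E)" and ?B = "component (trunc_ge1 B)"
  let ?K = "trunc_grading E K" and ?L = "trunc_grading B L"
  fix v assume "v \<in> bd ?S n ` star_grading R E K B L n d"
  then obtain u where u: "u \<in> star_grading R E K B L n d" "v = bd ?S n u" by blast
  have uc: "u \<in> carrier (component ?S n)" using graded_freeD(1)[OF star_graded[OF E B gE gB]] u(1) by blast
  have vc: "v \<in> carrier (component ?S (n - 1))" using linear_closed[OF star_bd_linear[OF E B] uc] u(2) by simp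
  note tE = trunc_module[OF E] and tB = trunc_module[OF B]
  note cE = complex_bd_up(1)[OF trunc_complex[OF E]] and cB = complex_bd_up(1)[OF trunc_complex[OF B]]
  have sK: "?K q d \<subseteq> carrier (?E q)" for q d
    using graded_freeD(1)[OF gE] by (cases "q \<ge> 1") (auto simp: trunc_grading_def trunc_simps)
  have sL: "?L q d \<subseteq> carrier (?B q)" for q d
    using graded_freeD(1)[OF gB] by (cases "q \<ge> 1") (auto simp: trunc_grading_def trunc_simps)
  note gt = tensor_graded_free[OF trunc_graded_free[OF E gE] trunc_graded_free[OF B gB]]
  consider "n \<ge> 2" | "n = 1" | "n \<le> 0" by linarith
  then show "v \<in> star_grading R E K B L (n - 1) d"
  proof cases
    case 1
    have ui: "u (p, q) \<in> tensor_grading R (?E p) (?K p) (?B q) (?L q) d" if "p + q = n + 1" for p q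
      using u(1) 1 that by (auto simp: star_grading_def bidegrees_def)
    have "v (p, q) \<in> tensor_grading R (?E p) (?K p) (?B q) (?L q) d" if pq: "p + q = n" for p q
    proof -
      have a: "u (p + 1, q) \<in> tensor_grading R (?E (p + 1)) (?K (p + 1)) (?B q) (?L q) d"
        and b: "u (p, q + 1) \<in> tensor_grading R (?E p) (?K p) (?B (q + 1)) (?L (q + 1)) d"
        using ui pq by auto
      have "tensor_map R (?E (p + 1)) (?B q) (?E p) (?B q) (bd (trunc_ge1 E) (p + 1)) (\<lambda>y. y) (u (p + 1, q))
          \<in> tensor_grading R (?E p) (?K p) (?B q) (?L q) d"
        by (rule tensor_map_grading[OF tE tB tE tB cE linear_id sK sL
              trunc_bd_grading[where K=K, OF bE _ graded_freeD(2)[OF gE]] _ a])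
      moreover have "tensor_map R (?E p) (?B (q + 1)) (?E p) (?B q) (\<lambda>x. x) (bd (trunc_ge1 B) (q + 1)) (u (p, q + 1))
          \<in> tensor_grading R (?E p) (?K p) (?B q) (?L q) d"
        by (rule tensor_map_grading[OF tE tB tE tB linear_id cB sK sL _
              trunc_bd_grading[where K=L, OF bB _ graded_freeD(2)[OF gB]] b])
      ultimately show ?thesis
        using tensor_trunc_bd_at[OF E B, of p q "n + 1" u] pq 1 u(2) star_bd(1)[OF E B, of n]
          graded_freeD(3,4)[OF gt] by (simp add: sign_twist_def)
    qed
    then show ?thesis using vc 1 by (auto simp: star_grading_def bidegrees_def)
  next
    case 2
    have u11: "u (1, 1) \<in> tensor_grading R (component E 1) (K 1) (component B 1) (L 1) d"
    proof -
      have "u (1, 1) \<in> tensor_grading R (?E 1) (?K 1) (?B 1) (?L 1) d"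
        using u(1) 2 by (auto simp: star_grading_def bidegrees_def)
      moreover have "?K 1 = K 1" "?L 1 = L 1" by (auto simp: trunc_grading_def)
      ultimately show ?thesis by (simp add: trunc_simps)
    qed
    have d: "bd E 1 \<in> linear_maps R (component E 1) (component E 0)"
      "bd B 1 \<in> linear_maps R (component B 1) (component B 0)"
      using complex_bd_up(1)[OF E, of 0] complex_bd_up(1)[OF B, of 0] by simp_all
    have k: "bd E 1 x \<in> K 0 i" if "x \<in> K 1 i" for x i using bE[of 1 i] that by auto
    have l: "bd B 1 x \<in> L 0 i" if "x \<in> L 1 i" for x i using bB[of 1 i] that by auto
    have "v (0, 0) \<in> tensor_grading R (component E 0) (K 0) (component B 0) (L 0) d"
      using tensor_map_grading[OF is_complexD(1)[OF E] is_complexD(1)[OF B] is_complexD(1)[OF E] is_complexD(1)[OF B]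
          d graded_freeD(1)[OF gE] graded_freeD(1)[OF gB] k l u11] u(2) 2 by (simp add: star_bd(2)[OF E B])
    then show ?thesis using vc 2 by (simp add: star_grading_def)
  next
    case 3
    then show ?thesis using u(2) by (simp add: star_grading_def star_bd(3)[OF E B])
  qed
qed

lemma tensor_grading_into:
  assumes M: "module R M" and N: "module R N" and sH: "\<And>d. H d \<subseteq> carrier M" and sH': "\<And>d. H' d \<subseteq> carrier N"
    and \<mu>: "\<mu> \<in> linear_maps R (tensor R M N) (regular_module R)"
    and p: "\<And>x y i j. x \<in> H i \<Longrightarrow> y \<in> H' j \<Longrightarrow> \<mu> (pure_tensor R M N x y) \<in> G (i + j)"
    and z: "z \<in> tensor_grading R M H N H' d"
  shows "\<mu> z \<in> G d"
proof -
  let ?T = "tensor R M N"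
  note T = tensor_module[OF M N]
  interpret T: module R ?T by (rule T)
  have neg: "\<ominus>\<^bsub>regular_module R\<^esub> r \<in> G d" if "r \<in> G d" for r
  proof -
    have "subgroup (G d) (add_monoid (regular_module R))" using grading by (simp add: graded_module_def)
    from subgroup.m_inv_closed[OF this that] show ?thesis by (simp add: a_inv_def)
  qed
  let ?g = "{pure_tensor R M N x y | x y i j. x \<in> H i \<and> y \<in> H' j \<and> i + j = d}"
  have gc: "?g \<subseteq> carrier ?T" using sH sH' pure_closed[OF M N] by blast
  have gg: "\<mu> h \<in> G d" if "h \<in> ?g" for h using that p by auto
  have "z \<in> carrier ?T \<and> \<mu> z \<in> G d"
    using z unfolding tensor_grading_def
  proof (induction rule: generate.induct)
    case one
    then show ?case using linear_zero[OF \<mu> T regular_module_module] G_zero by simp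
  next
    case (incl h)
    then show ?case using gc gg by blast
  next
    case (inv h)
    have hc: "h \<in> carrier ?T" using inv gc by blast
    then show ?case using neg[OF gg[OF inv]] linear_neg[OF \<mu> T regular_module_module hc]
      by (simp add: a_inv_def[symmetric])
  next
    case (eng h1 h2)
    then show ?case using linear_add[OF \<mu>, of h1 h2] G_add by simp
  qed
  then show ?thesis by simp
qed

theorem star_graded_free_resolution:
  assumes I: "ideal I R" and J: "ideal J R"
    and E: "graded_free_resolution R G E K (cyclic_module R I) (cyclic_grading R G I)"
    and B: "graded_free_resolution R G B L (cyclic_module R J) (cyclic_grading R G J)"
    and \<phi>: "\<phi> \<in> linear_isos R (regular_module R) (component E 0)" and \<phi>G: "\<And>d. \<phi> ` G d = K 0 d"
    and \<psi>: "\<psi> \<in> linear_isos R (regular_module R) (component B 0)" and \<psi>G: "\<And>d. \<psi> ` G d = L 0 d"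
    and tor: "Tor_independent R I J"
  shows "graded_free_resolution R G (star_product R E B) (star_grading R E K B L)
            (cyclic_module R (ideal_prod R I J)) (cyclic_grading R G (ideal_prod R I J))"
proof -
  have rE: "free_resolution R E (cyclic_module R I)" and rB: "free_resolution R B (cyclic_module R J)"
    and gE: "\<And>n. graded_free R G (component E n) (K n)" and gB: "\<And>n. graded_free R G (component B n) (L n)"
    and bE: "\<And>n d. bd E n ` K n d \<subseteq> K (n - 1) d" and bB: "\<And>n d. bd B n ` L n d \<subseteq> L (n - 1) d"
    using E B by (simp_all add: graded_free_resolution_def)
  note cE = free_resolutionD(1)[OF rE] and cB = free_resolutionD(1)[OF rB]
  note mE = is_complexD(1)[OF cE] and mB = is_complexD(1)[OF cB]
  obtain \<eta> where \<eta>: "is_augmentation R E (cyclic_module R I) \<eta>" using free_resolutionD(5)[OF rE] by blast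
  obtain \<theta> where \<theta>: "is_augmentation R B (cyclic_module R J) \<theta>" using free_resolutionD(5)[OF rB] by blast
  let ?IJ = "ideal_prod R I J"
  obtain \<phi>' \<psi>' \<mu> where i: "\<And>r. r \<in> carrier R \<Longrightarrow> \<phi>' (\<phi> r) = r" "\<And>r. r \<in> carrier R \<Longrightarrow> \<psi>' (\<psi> r) = r"
    and \<mu>: "\<mu> \<in> linear_maps R (tensor R (component E 0) (component B 0)) (regular_module R)"
    "\<And>x y. x \<in> carrier (component E 0) \<Longrightarrow> y \<in> carrier (component B 0) \<Longrightarrow>
       \<mu> (pure_tensor R (component E 0) (component B 0) x y) = \<phi>' x \<otimes> \<psi>' y"
    and aug: "is_augmentation R (star_product R E B) (cyclic_module R ?IJ) (\<lambda>u. ?IJ +>\<^bsub>R\<^esub> \<mu> (u (0, 0)))"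
    by (rule star_augmentation[OF I J cE cB \<eta> \<theta> \<phi> \<psi>]) blast
  have "\<mu> (pure_tensor R (component E 0) (component B 0) x y) \<in> G (i + j)" if x: "x \<in> K 0 i" and y: "y \<in> L 0 j" for x y i j
  proof -
    obtain r s where r: "r \<in> G i" "x = \<phi> r" "s \<in> G j" "y = \<psi> s" using x y \<phi>G \<psi>G by (metis imageE)
    have "r \<in> carrier R" "s \<in> carrier R" using r G_sub by blast+
    then have "\<phi>' x = r" "\<psi>' y = s" using i r by auto
    moreover have "x \<in> carrier (component E 0)" "y \<in> carrier (component B 0)"
      using x y graded_freeD(1)[OF gE[of 0]] graded_freeD(1)[OF gB[of 0]] by blast+
    ultimately show ?thesis using \<mu>(2)[of x y] G_mult[OF r(1,3) refl] by simp
  qed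
  then have "\<mu> z \<in> G d" if "z \<in> tensor_grading R (component E 0) (K 0) (component B 0) (L 0) d" for z d
    using tensor_grading_into[OF mE mB graded_freeD(1)[OF gE] graded_freeD(1)[OF gB] \<mu>(1) _ that] by blast
  then have "(\<lambda>u. ?IJ +>\<^bsub>R\<^esub> \<mu> (u (0, 0))) ` star_grading R E K B L 0 d \<subseteq> cyclic_grading R G ?IJ d" for d
    by (auto simp: star_grading_def cyclic_grading_def)
  then show ?thesis
    unfolding graded_free_resolution_def
    using star_free_resolution[OF one_not_zero I J rE rB \<phi> \<psi> tor] star_graded[OF cE cB gE gB]
      star_bd_grading[OF cE cB gE gB bE bB] aug by blast
qed

end


section \<open>The star product of Tor-independent resolutions\<close>

theorem theorem3p4:
  fixes R :: "('a, 'r) ring_scheme"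
    and \<mm> I J :: "'a set"
    and G :: "int \<Rightarrow> 'a set"
    and Xs :: "('a, 'm) cplx"
    and Ys :: "('a, 'n) cplx"
  assumes "cring R" and "noetherian_ring R"
    and "local_ring R \<mm> \<or> (standard_graded_ring R G \<and> \<mm> = irrelevant_ideal R G)"
    and "ideal I R" and "ideal J R"
    and "free_resolution R Xs (cyclic_module R I)"
    and "free_resolution R Ys (cyclic_module R J)"
    and "linear_isos R (regular_module R) (component Xs 0) \<noteq> {}"
    and "linear_isos R (regular_module R) (component Ys 0) \<noteq> {}"
    and "Tor_independent R I J"
  shows "free_resolution R (star_product R Xs Ys) (cyclic_module R (ideal_prod R I J)) \<and>
    (local_ring R \<mm> \<longrightarrow>
       minimal_complex R \<mm> Xs \<longrightarrow> minimal_complex R \<mm> Ys \<longrightarrow>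
       minimal_complex R \<mm> (star_product R Xs Ys)) \<and>
    (standard_graded_ring R G \<and> \<mm> = irrelevant_ideal R G \<longrightarrow>
       homogeneous_ideal R G I \<longrightarrow> homogeneous_ideal R G J \<longrightarrow>
       (\<forall>K L.
          graded_free_resolution R G Xs K (cyclic_module R I) (cyclic_grading R G I) \<longrightarrow>
          graded_free_resolution R G Ys L (cyclic_module R J) (cyclic_grading R G J) \<longrightarrow>
          (\<exists>\<phi> \<in> linear_isos R (regular_module R) (component Xs 0). \<forall>d. \<phi> ` G d = K 0 d) \<longrightarrow>
          (\<exists>\<psi> \<in> linear_isos R (regular_module R) (component Ys 0). \<forall>d. \<psi> ` G d = L 0 d) \<longrightarrow>
          minimal_complex R \<mm> Xs \<longrightarrow> minimal_complex R \<mm> Ys \<longrightarrow>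
          graded_free_resolution R G (star_product R Xs Ys) (star_grading R Xs K Ys L)
            (cyclic_module R (ideal_prod R I J)) (cyclic_grading R G (ideal_prod R I J)) \<and>
          minimal_complex R \<mm> (star_product R Xs Ys)))"
proof -
  interpret base_ring R by (rule base_ring.intro[OF assms(1)])
  have graded: "graded_base_ring R G" if g: "standard_graded_ring R G"
  proof -
    have sf: "subfield (G 0) R" using g by (simp add: standard_graded_ring_def)
    show ?thesis
      using g subcringE(3)[OF subfieldE(2)[OF sf]] subfieldE(6)[OF sf]
      by (intro graded_base_ring.intro graded_base_ring_axioms.intro base_ring_axioms)
        (auto simp: standard_graded_ring_def)
  qed
  have one: "\<one>\<^bsub>R\<^esub> \<noteq> \<zero>\<^bsub>R\<^esub>" and m: "\<mm> \<subseteq> carrier R"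
  proof -
    have "\<one>\<^bsub>R\<^esub> \<noteq> \<zero>\<^bsub>R\<^esub> \<and> \<mm> \<subseteq> carrier R"
      using assms(3)
    proof
      assume "local_ring R \<mm>"
      then have mx: "maximalideal \<mm> R" by (simp add: local_ring_def)
      then interpret mx: maximalideal \<mm> R .
      have sub: "\<mm> \<subseteq> carrier R" by (rule mx.a_subset)
      moreover have "\<one>\<^bsub>R\<^esub> \<noteq> \<zero>\<^bsub>R\<^esub>"
      proof
        assume "\<one>\<^bsub>R\<^esub> = \<zero>\<^bsub>R\<^esub>"
        then have "\<one>\<^bsub>R\<^esub> \<in> \<mm>" using mx.zero_closed by simp
        then have "carrier R = \<mm>" by (rule mx.one_imp_carrier[symmetric])
        then show False using mx.I_notcarr by simp
      qed
      ultimately show ?thesis by simp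
    next
      assume g: "standard_graded_ring R G \<and> \<mm> = irrelevant_ideal R G"
      interpret g: graded_base_ring R G by (rule graded) (use g in simp)
      have "ideal \<mm> R"
        using g g.G_sub by (auto simp: irrelevant_ideal_def intro!: genideal_ideal)
      then have "\<mm> \<subseteq> carrier R" by (intro subsetI) (rule ideal.Icarr)
      then show ?thesis using g.one_not_zero by simp
    qed
    then show "\<one>\<^bsub>R\<^esub> \<noteq> \<zero>\<^bsub>R\<^esub>" "\<mm> \<subseteq> carrier R" by auto
  qed
  obtain \<phi> \<psi> where i: "\<phi> \<in> linear_isos R (regular_module R) (component Xs 0)"
    "\<psi> \<in> linear_isos R (regular_module R) (component Ys 0)" using assms(8,9) by blast
  have min: "minimal_complex R \<mm> (star_product R Xs Ys)"
    if "minimal_complex R \<mm> Xs" "minimal_complex R \<mm> Ys"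
    by (rule star_minimal[OF free_resolutionD(1)[OF assms(6)] free_resolutionD(1)[OF assms(7)] m that])
  show ?thesis
  proof (intro conjI impI allI)
    show "free_resolution R (star_product R Xs Ys) (cyclic_module R (ideal_prod R I J))"
      by (rule star_free_resolution[OF one assms(4-7) i assms(10)])
    show "minimal_complex R \<mm> (star_product R Xs Ys)"
      if "minimal_complex R \<mm> Xs" "minimal_complex R \<mm> Ys" by (rule min[OF that])
    show "minimal_complex R \<mm> (star_product R Xs Ys)"
      if "minimal_complex R \<mm> Xs" "minimal_complex R \<mm> Ys" by (rule min[OF that])
    fix K L
    assume g: "standard_graded_ring R G \<and> \<mm> = irrelevant_ideal R G"
      and X: "graded_free_resolution R G Xs K (cyclic_module R I) (cyclic_grading R G I)"
      and Y: "graded_free_resolution R G Ys L (cyclic_module R J) (cyclic_grading R G J)"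
      and "\<exists>\<phi> \<in> linear_isos R (regular_module R) (component Xs 0). \<forall>d. \<phi> ` G d = K 0 d"
      and "\<exists>\<psi> \<in> linear_isos R (regular_module R) (component Ys 0). \<forall>d. \<psi> ` G d = L 0 d"
    then obtain \<alpha> \<beta> where ab: "\<alpha> \<in> linear_isos R (regular_module R) (component Xs 0)" "\<And>d. \<alpha> ` G d = K 0 d"
      "\<beta> \<in> linear_isos R (regular_module R) (component Ys 0)" "\<And>d. \<beta> ` G d = L 0 d" by blast
    interpret g: graded_base_ring R G by (rule graded) (use g in simp)
    show "graded_free_resolution R G (star_product R Xs Ys) (star_grading R Xs K Ys L)
        (cyclic_module R (ideal_prod R I J)) (cyclic_grading R G (ideal_prod R I J))"
      by (rule g.star_graded_free_resolution[OF assms(4,5) X Y ab assms(10)])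
  qed
qed

end
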